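(* Let $S$ be a finite-dimensional semisimple $\mathbb{C}$-algebra with a fixed nondegenerate trace, $V$ a finite-dimensional $S$-bimodule, and $e\in S$ an idempotent such that $SeS=S$. If $M\subset T_SV$ is an $S$-bimodule, then there is a Morita equivalence between $A=T_SV/\langle M\rangle$ and $$T_{eSe}\,eVe/\langle eMe\rangle,$$ and if $\omega$ is a (twisted) weak potential and $e^\tau=e$ (where $\tau$ is the twist), then $$e\,\mathcal{D}(\omega,k)\,e=\mathcal{D}(e\omega e,k).$$
   Context: $\langle M\rangle$ is the smallest two-sided ideal containing $M$. $eT_SVe$ is identified with $T_{eSe}eVe$, and $eSe$ carries the (nondegenerate) restriction of the trace $\mathrm{Tr}$ of $S$. $V^*=\mathrm{Hom}_{\mathbb{C}}(V,\mathbb{C})$ with $(s_1\psi s_2)(w)=\psi(s_2ws_1)$. For $\psi\in V^*$, $w\in V$, $[\psi w]\in S$ is defined by $\mathrm{Tr}([\psi w]s)=\psi(ws)$ for all $s\in S$. Tensor powers are over $S$. Set $[\psi\, w_1\otimes\cdots\otimes w_l]=[\psi w_1]w_2\otimes\cdots\otimes w_l$ and $[\phi_1\otimes\cdots\otimes\phi_k\, w]=[\phi_1[\phi_2\cdots[\phi_kw]\cdots]]$; $(V^{\otimes k})^*\cong(V^* )^{\otimes k}$. A weak potential of degree $n$ is $\omega\in V^{\otimes n}$ with $s\omega=\omega s$ for all $s\in S$ (twist $\tau=\mathrm{id}$). For a graded $\mathbb{C}$-algebra automorphism $\tau$ of $T_SV$ preserving the trace, a twisted weak potential of degree $n$ is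 $\omega\in V^{\otimes n}$ with $s^\tau\omega=\omega s$ for all $s\in S$. $W_{n-k}\subset V^{\otimes(n-k)}$ is the image of $\Delta_k^\omega:(V^{\otimes k})^*\otimes S_\tau\to V^{\otimes(n-k)}$, $\psi\otimes x\mapsto[\psi\omega x]$ (where $S_\tau$ is $S$ with right action twisted by $\tau$), and the derivation-quotient algebra of order $k$ is $\mathcal{D}(\omega,k)=T_SV/\langle W_{n-k}\rangle$; $\mathcal{D}(e\omega e,k)$ is the same construction over $eSe$ with bimodule $eVe$. *)

theory Defs
  imports
    Complex_Main
    "HOL-Library.FuncSet"
    "HOL-Library.Poly_Mapping"
    "HOL-Algebra.Ideal"
    "HOL-Algebra.QuotRing"
    "HOL-Algebra.Module"
    "HOL-Algebra.Generated_Groups"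
begin

section \<open>Algebras and bimodules over the complex numbers\<close>

definition complex_ring :: "complex ring" where
  "complex_ring = \<lparr>carrier = UNIV, mult = (*), one = 1, zero = 0, add = (+)\<rparr>"

text \<open>The library locale \<open>algebra\<close> covers commutative algebras only.\<close>

locale complex_alg = ring A + Module.module complex_ring A for A (structure) +
  assumes smult_mult_left: "\<lbrakk>x \<in> carrier A; y \<in> carrier A\<rbrakk> \<Longrightarrow> c \<odot> (x \<otimes> y) = (c \<odot> x) \<otimes> y"
    and smult_mult_right: "\<lbrakk>x \<in> carrier A; y \<in> carrier A\<rbrakk> \<Longrightarrow> c \<odot> (x \<otimes> y) = x \<otimes> (c \<odot> y)"

record ('s, 'v) bimodule = "(complex, 'v) module" +
  lact :: "'s \<Rightarrow> 'v \<Rightarrow> 'v"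
  ract :: "'v \<Rightarrow> 's \<Rightarrow> 'v"

locale complex_bimodule =
  S: complex_alg S + V: Module.module complex_ring V
  for S :: "(complex, 's) module" and V :: "('s, 'v) bimodule" +
  assumes lact_closed: "\<lbrakk>s \<in> carrier S; v \<in> carrier V\<rbrakk> \<Longrightarrow> lact V s v \<in> carrier V"
    and ract_closed: "\<lbrakk>s \<in> carrier S; v \<in> carrier V\<rbrakk> \<Longrightarrow> ract V v s \<in> carrier V"
    and lact_add_scalar: "\<lbrakk>s \<in> carrier S; t \<in> carrier S; v \<in> carrier V\<rbrakk> \<Longrightarrow>
      lact V (s \<oplus>\<^bsub>S\<^esub> t) v = lact V s v \<oplus>\<^bsub>V\<^esub> lact V t v"
    and ract_add_scalar: "\<lbrakk>s \<in> carrier S; t \<in> carrier S; v \<in> carrier V\<rbrakk> \<Longrightarrow>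
      ract V v (s \<oplus>\<^bsub>S\<^esub> t) = ract V v s \<oplus>\<^bsub>V\<^esub> ract V v t"
    and lact_add: "\<lbrakk>s \<in> carrier S; v \<in> carrier V; w \<in> carrier V\<rbrakk> \<Longrightarrow>
      lact V s (v \<oplus>\<^bsub>V\<^esub> w) = lact V s v \<oplus>\<^bsub>V\<^esub> lact V s w"
    and ract_add: "\<lbrakk>s \<in> carrier S; v \<in> carrier V; w \<in> carrier V\<rbrakk> \<Longrightarrow>
      ract V (v \<oplus>\<^bsub>V\<^esub> w) s = ract V v s \<oplus>\<^bsub>V\<^esub> ract V w s"
    and lact_mult: "\<lbrakk>s \<in> carrier S; t \<in> carrier S; v \<in> carrier V\<rbrakk> \<Longrightarrow>
      lact V (s \<otimes>\<^bsub>S\<^esub> t) v = lact V s (lact V t v)"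
    and ract_mult: "\<lbrakk>s \<in> carrier S; t \<in> carrier S; v \<in> carrier V\<rbrakk> \<Longrightarrow>
      ract V v (s \<otimes>\<^bsub>S\<^esub> t) = ract V (ract V v s) t"
    and lact_ract: "\<lbrakk>s \<in> carrier S; t \<in> carrier S; v \<in> carrier V\<rbrakk> \<Longrightarrow>
      ract V (lact V s v) t = lact V s (ract V v t)"
    and lact_complex: "v \<in> carrier V \<Longrightarrow> lact V (c \<odot>\<^bsub>S\<^esub> \<one>\<^bsub>S\<^esub>) v = c \<odot>\<^bsub>V\<^esub> v"
    and ract_complex: "v \<in> carrier V \<Longrightarrow> ract V v (c \<odot>\<^bsub>S\<^esub> \<one>\<^bsub>S\<^esub>) = c \<odot>\<^bsub>V\<^esub> v"

definition finite_dim :: "(complex, 'a, 'z) module_scheme \<Rightarrow> bool" where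
  "finite_dim M \<longleftrightarrow> (\<exists>B. finite B \<and> B \<subseteq> carrier M \<and>
     (\<forall>x\<in>carrier M. \<exists>c. x = finsum M (\<lambda>b. c b \<odot>\<^bsub>M\<^esub> b) B))"

definition left_ideal :: "'a set \<Rightarrow> ('a, 'z) ring_scheme \<Rightarrow> bool" where
  "left_ideal I R \<longleftrightarrow> subgroup I (add_monoid R) \<and>
     (\<forall>r\<in>carrier R. \<forall>x\<in>I. r \<otimes>\<^bsub>R\<^esub> x \<in> I)"

text \<open>The regular left module is semisimple: every submodule is a direct summand.\<close>

definition semisimple_ring :: "('a, 'z) ring_scheme \<Rightarrow> bool" where
  "semisimple_ring R \<longleftrightarrow> ring R \<and>
     (\<forall>I. left_ideal I R \<longrightarrow>
        (\<exists>J. left_ideal J R \<and> I \<inter> J = {\<zero>\<^bsub>R\<^esub>} \<and> I <+>\<^bsub>R\<^esub> J = carrier R))"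

definition nondegenerate_trace ::
    "(complex, 's) module \<Rightarrow> ('s \<Rightarrow> complex) \<Rightarrow> bool" where
  "nondegenerate_trace S Tr \<longleftrightarrow>
     (\<forall>x\<in>carrier S. \<forall>y\<in>carrier S. Tr (x \<oplus>\<^bsub>S\<^esub> y) = Tr x + Tr y) \<and>
     (\<forall>c. \<forall>x\<in>carrier S. Tr (c \<odot>\<^bsub>S\<^esub> x) = c * Tr x) \<and>
     (\<forall>x\<in>carrier S. \<forall>y\<in>carrier S. Tr (x \<otimes>\<^bsub>S\<^esub> y) = Tr (y \<otimes>\<^bsub>S\<^esub> x)) \<and>
     (\<forall>x\<in>carrier S. (\<forall>y\<in>carrier S. Tr (x \<otimes>\<^bsub>S\<^esub> y) = 0) \<longrightarrow> x = \<zero>\<^bsub>S\<^esub>)"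

definition alg_iso ::
    "(complex, 'a) module \<Rightarrow> (complex, 'b) module \<Rightarrow> ('a \<Rightarrow> 'b) set" where
  "alg_iso A B = {h \<in> ring_iso A B. \<forall>c. \<forall>x\<in>carrier A. h (c \<odot>\<^bsub>A\<^esub> x) = c \<odot>\<^bsub>B\<^esub> h x}"

text \<open>\<open>R Quot I\<close> together with the induced scalar multiplication.\<close>

definition quot_alg :: "(complex, 'a) module \<Rightarrow> 'a set \<Rightarrow> (complex, 'a set) module" where
  "quot_alg A I =
     \<lparr>carrier = carrier (A Quot I), mult = mult (A Quot I), one = one (A Quot I),
      zero = zero (A Quot I), add = add (A Quot I),
      smult = (\<lambda>c X. \<Union>x\<in>X. I +>\<^bsub>A\<^esub> (c \<odot>\<^bsub>A\<^esub> x))\<rparr>"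


section \<open>Corners\<close>

definition corner :: "(complex, 'a) module \<Rightarrow> 'a \<Rightarrow> (complex, 'a) module" where
  "corner A e = A\<lparr>carrier := {e \<otimes>\<^bsub>A\<^esub> x \<otimes>\<^bsub>A\<^esub> e | x. x \<in> carrier A}, one := e\<rparr>"

definition corner_bimod :: "('s, 'v) bimodule \<Rightarrow> 's \<Rightarrow> ('s, 'v) bimodule" where
  "corner_bimod V e = V\<lparr>carrier := {ract V (lact V e v) e | v. v \<in> carrier V}\<rparr>"

text \<open>The subgroup \<open>SeS\<close> of finite sums of products \<open>s e t\<close>.\<close>

definition two_sided_span :: "(complex, 's) module \<Rightarrow> 's \<Rightarrow> 's set" where
  "two_sided_span S e = generate (add_monoid S)
     {s \<otimes>\<^bsub>S\<^esub> e \<otimes>\<^bsub>S\<^esub> t | s t. s \<in> carrier S \<and> t \<in> carrier S}"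


section \<open>The tensor algebra of a bimodule\<close>

text \<open>
  The tensor algebra is the direct sum of the tensor powers of \<open>V\<close> over \<open>S\<close>, the power of
  exponent \<open>0\<close> being \<open>S\<close>. For \<open>n \<ge> 1\<close> the \<open>n\<close>-th power is the free complex vector space on the
  \<open>n\<close>-tuples \<open>Tensor [v\<^sub>1, \<dots>, v\<^sub>n]\<close> modulo the multilinearity and \<open>S\<close>-balancing relations; \<open>S\<close> is
  presented in the same way as the free vector space on the symbols \<open>Scalar s\<close> modulo linearity.
  All degrees are treated simultaneously, so that the tensor algebra becomes a single quotient;
  since every relation is homogeneous, this quotient is the direct sum of the tensor powers.
\<close>

datatype ('s, 'v) tensor_word = Scalar 's | Tensor "'v list"

type_synonym ('s, 'v) free_tensor = "('s, 'v) tensor_word \<Rightarrow>\<^sub>0 complex"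

type_synonym ('s, 'v) tensor = "('s, 'v) free_tensor set"

fun word_degree :: "('s, 'v) tensor_word \<Rightarrow> nat" where
  "word_degree (Scalar s) = 0"
| "word_degree (Tensor vs) = length vs"

definition tensor_words ::
    "(complex, 's) module \<Rightarrow> ('s, 'v) bimodule \<Rightarrow> ('s, 'v) tensor_word set" where
  "tensor_words S V = Scalar ` carrier S \<union> {Tensor vs | vs. vs \<noteq> [] \<and> set vs \<subseteq> carrier V}"

fun word_mult :: "(complex, 's) module \<Rightarrow> ('s, 'v) bimodule \<Rightarrow>
    ('s, 'v) tensor_word \<Rightarrow> ('s, 'v) tensor_word \<Rightarrow> ('s, 'v) tensor_word" where
  "word_mult S V (Scalar s) (Scalar t) = Scalar (s \<otimes>\<^bsub>S\<^esub> t)"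
| "word_mult S V (Scalar s) (Tensor vs) = Tensor (lact V s (hd vs) # tl vs)"
| "word_mult S V (Tensor vs) (Scalar s) = Tensor (butlast vs @ [ract V (last vs) s])"
| "word_mult S V (Tensor vs) (Tensor ws) = Tensor (vs @ ws)"

definition free_scale :: "complex \<Rightarrow> ('s, 'v) free_tensor \<Rightarrow> ('s, 'v) free_tensor" where
  "free_scale c f = Poly_Mapping.map ((*) c) f"

text \<open>
  The free vector space on the tensor words, with the bilinear extension of \<open>word_mult\<close>. This
  multiplication is associative only modulo the balancing relations.
\<close>

definition free_tensor_alg :: "(complex, 's) module \<Rightarrow> ('s, 'v) bimodule \<Rightarrow>
    (complex, ('s, 'v) free_tensor) module" where
  "free_tensor_alg S V =
     \<lparr>carrier = {f. Poly_Mapping.keys f \<subseteq> tensor_words S V},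
      mult = (\<lambda>f g. \<Sum>u\<in>Poly_Mapping.keys f. \<Sum>w\<in>Poly_Mapping.keys g.
         Poly_Mapping.single (word_mult S V u w)
           (Poly_Mapping.lookup f u * Poly_Mapping.lookup g w)),
      one = Poly_Mapping.single (Scalar \<one>\<^bsub>S\<^esub>) 1,
      zero = 0,
      add = (+),
      smult = free_scale\<rparr>"

abbreviation word :: "('s, 'v) tensor_word \<Rightarrow> ('s, 'v) free_tensor" where
  "word u \<equiv> Poly_Mapping.single u 1"

inductive_set tensor_relations ::
    "(complex, 's) module \<Rightarrow> ('s, 'v) bimodule \<Rightarrow> ('s, 'v) free_tensor set"
  for S :: "(complex, 's) module" and V :: "('s, 'v) bimodule" where
  scalar_add: "\<lbrakk>s \<in> carrier S; t \<in> carrier S\<rbrakk> \<Longrightarrow>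
    word (Scalar (s \<oplus>\<^bsub>S\<^esub> t)) - (word (Scalar s) + word (Scalar t)) \<in> tensor_relations S V"
| scalar_smult: "s \<in> carrier S \<Longrightarrow>
    word (Scalar (c \<odot>\<^bsub>S\<^esub> s)) - free_scale c (word (Scalar s)) \<in> tensor_relations S V"
| tensor_add: "\<lbrakk>set us \<subseteq> carrier V; v \<in> carrier V; w \<in> carrier V; set ws \<subseteq> carrier V\<rbrakk> \<Longrightarrow>
    word (Tensor (us @ [v \<oplus>\<^bsub>V\<^esub> w] @ ws))
      - (word (Tensor (us @ [v] @ ws)) + word (Tensor (us @ [w] @ ws))) \<in> tensor_relations S V"
| tensor_smult: "\<lbrakk>set us \<subseteq> carrier V; v \<in> carrier V; set ws \<subseteq> carrier V\<rbrakk> \<Longrightarrow>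
    word (Tensor (us @ [c \<odot>\<^bsub>V\<^esub> v] @ ws))
      - free_scale c (word (Tensor (us @ [v] @ ws))) \<in> tensor_relations S V"
| tensor_balanced: "\<lbrakk>set us \<subseteq> carrier V; v \<in> carrier V; s \<in> carrier S; w \<in> carrier V;
      set ws \<subseteq> carrier V\<rbrakk> \<Longrightarrow>
    word (Tensor (us @ [ract V v s, w] @ ws)) - word (Tensor (us @ [v, lact V s w] @ ws))
      \<in> tensor_relations S V"

inductive_set tensor_null ::
    "(complex, 's) module \<Rightarrow> ('s, 'v) bimodule \<Rightarrow> ('s, 'v) free_tensor set"
  for S :: "(complex, 's) module" and V :: "('s, 'v) bimodule" where
  zero: "0 \<in> tensor_null S V"
| add_rel: "\<lbrakk>f \<in> tensor_null S V; r \<in> tensor_relations S V\<rbrakk> \<Longrightarrow>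
    f + free_scale c r \<in> tensor_null S V"

definition tensor_alg :: "(complex, 's) module \<Rightarrow> ('s, 'v) bimodule \<Rightarrow>
    (complex, ('s, 'v) tensor) module" where
  "tensor_alg S V = quot_alg (free_tensor_alg S V) (tensor_null S V)"

definition tensor_class :: "(complex, 's) module \<Rightarrow> ('s, 'v) bimodule \<Rightarrow>
    ('s, 'v) free_tensor \<Rightarrow> ('s, 'v) tensor" where
  "tensor_class S V f = tensor_null S V +>\<^bsub>free_tensor_alg S V\<^esub> f"

text \<open>The degree \<open>n\<close> part of the tensor algebra, i.e. the \<open>n\<close>-th tensor power of \<open>V\<close> over \<open>S\<close>.\<close>

definition tensor_power ::
    "(complex, 's) module \<Rightarrow> ('s, 'v) bimodule \<Rightarrow> nat \<Rightarrow> ('s, 'v) tensor set" where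
  "tensor_power S V n = {tensor_class S V f | f.
     f \<in> carrier (free_tensor_alg S V) \<and> (\<forall>u\<in>Poly_Mapping.keys f. word_degree u = n)}"

definition tensor_scalar :: "(complex, 's) module \<Rightarrow> ('s, 'v) bimodule \<Rightarrow>
    's \<Rightarrow> ('s, 'v) tensor" where
  "tensor_scalar S V s = tensor_class S V (word (Scalar s))"

definition sub_bimodule :: "(complex, 's) module \<Rightarrow> ('s, 'v) bimodule \<Rightarrow>
    ('s, 'v) tensor set \<Rightarrow> bool" where
  "sub_bimodule S V M \<longleftrightarrow> subgroup M (add_monoid (tensor_alg S V)) \<and>
     (\<forall>s\<in>carrier S. \<forall>m\<in>M.
        tensor_scalar S V s \<otimes>\<^bsub>tensor_alg S V\<^esub> m \<in> M \<and>
        m \<otimes>\<^bsub>tensor_alg S V\<^esub> tensor_scalar S V s \<in> M)"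

text \<open>
  The canonical map from the tensor algebra of \<open>eVe\<close> over \<open>eSe\<close> to the tensor algebra of \<open>V\<close>
  over \<open>S\<close> induced by the inclusions, i.e. the class of \<open>f\<close> over \<open>eSe\<close> goes to the class
  of \<open>f\<close> over \<open>S\<close>.
\<close>

definition corner_map :: "(complex, 's) module \<Rightarrow> ('s, 'v) bimodule \<Rightarrow>
    ('s, 'v) tensor \<Rightarrow> ('s, 'v) tensor" where
  "corner_map S V X = (\<Union>f\<in>X. tensor_class S V f)"

text \<open>
  The inverse of \<open>corner_map\<close>, through which elements of \<open>e T e\<close>, for \<open>T\<close> the tensor algebra of
  \<open>V\<close>, are regarded as elements of the tensor algebra of \<open>eVe\<close>.
\<close>

definition corner_identify :: "(complex, 's) module \<Rightarrow> ('s, 'v) bimodule \<Rightarrow> 's \<Rightarrow>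
    ('s, 'v) tensor \<Rightarrow> ('s, 'v) tensor" where
  "corner_identify S V e =
     inv_into (carrier (tensor_alg (corner S e) (corner_bimod V e))) (corner_map S V)"

definition corner_elt :: "(complex, 's) module \<Rightarrow> ('s, 'v) bimodule \<Rightarrow> 's \<Rightarrow>
    ('s, 'v) tensor \<Rightarrow> ('s, 'v) tensor" where
  "corner_elt S V e x = tensor_scalar S V e \<otimes>\<^bsub>tensor_alg S V\<^esub> x \<otimes>\<^bsub>tensor_alg S V\<^esub> tensor_scalar S V e"


section \<open>Twisted weak potentials and derivation-quotient algebras\<close>

definition dual_space :: "('s, 'v) bimodule \<Rightarrow> ('v \<Rightarrow> complex) set" where
  "dual_space V = {\<phi>.
     (\<forall>v\<in>carrier V. \<forall>w\<in>carrier V. \<phi> (v \<oplus>\<^bsub>V\<^esub> w) = \<phi> v + \<phi> w) \<and>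
     (\<forall>c. \<forall>v\<in>carrier V. \<phi> (c \<odot>\<^bsub>V\<^esub> v) = c * \<phi> v)}"

definition bracket :: "(complex, 's) module \<Rightarrow> ('s \<Rightarrow> complex) \<Rightarrow> ('s, 'v) bimodule \<Rightarrow>
    ('v \<Rightarrow> complex) \<Rightarrow> 'v \<Rightarrow> 's" where
  "bracket S Tr V \<phi> w =
     (THE r. r \<in> carrier S \<and> (\<forall>s\<in>carrier S. Tr (r \<otimes>\<^bsub>S\<^esub> s) = \<phi> (ract V w s)))"

text \<open>
  Contraction with \<open>\<phi>\<close> lowers the degree by one. It is only meaningful in positive degrees and is
  set to \<open>0\<close> in degree \<open>0\<close>.
\<close>

fun contract_word :: "(complex, 's) module \<Rightarrow> ('s \<Rightarrow> complex) \<Rightarrow> ('s, 'v) bimodule \<Rightarrow>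
    ('v \<Rightarrow> complex) \<Rightarrow> ('s, 'v) tensor_word \<Rightarrow> ('s, 'v) free_tensor" where
  "contract_word S Tr V \<phi> (Tensor [w]) = word (Scalar (bracket S Tr V \<phi> w))"
| "contract_word S Tr V \<phi> (Tensor (w1 # w2 # ws)) =
     word (Tensor (lact V (bracket S Tr V \<phi> w1) w2 # ws))"
| "contract_word S Tr V \<phi> _ = 0"

definition contract_free :: "(complex, 's) module \<Rightarrow> ('s \<Rightarrow> complex) \<Rightarrow> ('s, 'v) bimodule \<Rightarrow>
    ('v \<Rightarrow> complex) \<Rightarrow> ('s, 'v) free_tensor \<Rightarrow> ('s, 'v) free_tensor" where
  "contract_free S Tr V \<phi> f =
     (\<Sum>u\<in>Poly_Mapping.keys f. free_scale (Poly_Mapping.lookup f u) (contract_word S Tr V \<phi> u))"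

definition contract :: "(complex, 's) module \<Rightarrow> ('s \<Rightarrow> complex) \<Rightarrow> ('s, 'v) bimodule \<Rightarrow>
    ('v \<Rightarrow> complex) \<Rightarrow> ('s, 'v) tensor \<Rightarrow> ('s, 'v) tensor" where
  "contract S Tr V \<phi> X = (\<Union>f\<in>X. tensor_class S V (contract_free S Tr V \<phi> f))"

text \<open>
  The image of \<open>\<psi> \<otimes> x \<mapsto> [\<psi> \<omega> x]\<close>. The \<open>k\<close>-th tensor power of the dual is additively generated by the
  tensors \<open>s \<phi>\<^sub>1 \<otimes> \<dots> \<otimes> \<phi>\<^sub>k\<close>, acting as \<open>s [\<phi>\<^sub>1 [\<dots> [\<phi>\<^sub>k w] \<dots>]]\<close>; the factor \<open>s\<close> is
  redundant for \<open>k \<ge> 1\<close> but makes the case \<open>k = 0\<close>, where the power is \<open>S\<close>, uniform.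
\<close>

definition derivative_space :: "(complex, 's) module \<Rightarrow> ('s \<Rightarrow> complex) \<Rightarrow>
    ('s, 'v) bimodule \<Rightarrow> ('s, 'v) tensor \<Rightarrow> nat \<Rightarrow> ('s, 'v) tensor set" where
  "derivative_space S Tr V \<omega> k = generate (add_monoid (tensor_alg S V))
     {tensor_scalar S V s \<otimes>\<^bsub>tensor_alg S V\<^esub>
        foldr (contract S Tr V) \<phi>s (\<omega> \<otimes>\<^bsub>tensor_alg S V\<^esub> tensor_scalar S V x) | s \<phi>s x.
      s \<in> carrier S \<and> x \<in> carrier S \<and> set \<phi>s \<subseteq> dual_space V \<and> length \<phi>s = k}"

definition derivation_ideal :: "(complex, 's) module \<Rightarrow> ('s \<Rightarrow> complex) \<Rightarrow>
    ('s, 'v) bimodule \<Rightarrow> ('s, 'v) tensor \<Rightarrow> nat \<Rightarrow> ('s, 'v) tensor set" where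
  "derivation_ideal S Tr V \<omega> k = Idl\<^bsub>tensor_alg S V\<^esub> (derivative_space S Tr V \<omega> k)"

definition derivation_quotient :: "(complex, 's) module \<Rightarrow> ('s \<Rightarrow> complex) \<Rightarrow>
    ('s, 'v) bimodule \<Rightarrow> ('s, 'v) tensor \<Rightarrow> nat \<Rightarrow> (complex, ('s, 'v) tensor set) module" where
  "derivation_quotient S Tr V \<omega> k = quot_alg (tensor_alg S V) (derivation_ideal S Tr V \<omega> k)"

definition graded_trace_automorphism :: "(complex, 's) module \<Rightarrow> ('s \<Rightarrow> complex) \<Rightarrow>
    ('s, 'v) bimodule \<Rightarrow> (('s, 'v) tensor \<Rightarrow> ('s, 'v) tensor) \<Rightarrow> bool" where
  "graded_trace_automorphism S Tr V \<tau> \<longleftrightarrow>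
     \<tau> \<in> alg_iso (tensor_alg S V) (tensor_alg S V) \<and>
     (\<forall>n. \<tau> ` tensor_power S V n = tensor_power S V n) \<and>
     (\<forall>s\<in>carrier S. \<forall>t\<in>carrier S. \<tau> (tensor_scalar S V s) = tensor_scalar S V t \<longrightarrow> Tr t = Tr s)"

text \<open>The untwisted weak potentials are those with \<open>\<tau> = id\<close>.\<close>

definition twisted_weak_potential :: "(complex, 's) module \<Rightarrow> ('s, 'v) bimodule \<Rightarrow>
    (('s, 'v) tensor \<Rightarrow> ('s, 'v) tensor) \<Rightarrow> nat \<Rightarrow> ('s, 'v) tensor \<Rightarrow> bool" where
  "twisted_weak_potential S V \<tau> n \<omega> \<longleftrightarrow> \<omega> \<in> tensor_power S V n \<and>
     (\<forall>s\<in>carrier S. \<tau> (tensor_scalar S V s) \<otimes>\<^bsub>tensor_alg S V\<^esub> \<omega>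
        = \<omega> \<otimes>\<^bsub>tensor_alg S V\<^esub> tensor_scalar S V s)"


section \<open>Morita equivalence\<close>

text \<open>
  Categories whose morphism sets carry an addition and a multiplication by complex numbers;
  \<open>Comp C X Y Z g f\<close> is the composite of \<open>f : X \<rightarrow> Y\<close> and \<open>g : Y \<rightarrow> Z\<close>.
\<close>

record ('o, 'f) linear_cat =
  Ob :: "'o set"
  Hom :: "'o \<Rightarrow> 'o \<Rightarrow> 'f set"
  Idn :: "'o \<Rightarrow> 'f"
  Comp :: "'o \<Rightarrow> 'o \<Rightarrow> 'o \<Rightarrow> 'f \<Rightarrow> 'f \<Rightarrow> 'f"
  Hom_add :: "'o \<Rightarrow> 'o \<Rightarrow> 'f \<Rightarrow> 'f \<Rightarrow> 'f"
  Hom_scale :: "'o \<Rightarrow> 'o \<Rightarrow> complex \<Rightarrow> 'f \<Rightarrow> 'f"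

definition linear_functor :: "('o, 'f) linear_cat \<Rightarrow> ('p, 'g) linear_cat \<Rightarrow>
    ('o \<Rightarrow> 'p) \<Rightarrow> ('o \<Rightarrow> 'o \<Rightarrow> 'f \<Rightarrow> 'g) \<Rightarrow> bool" where
  "linear_functor C D F F' \<longleftrightarrow>
     (\<forall>X\<in>Ob C. F X \<in> Ob D) \<and>
     (\<forall>X\<in>Ob C. \<forall>Y\<in>Ob C. \<forall>f\<in>Hom C X Y. F' X Y f \<in> Hom D (F X) (F Y)) \<and>
     (\<forall>X\<in>Ob C. F' X X (Idn C X) = Idn D (F X)) \<and>
     (\<forall>X\<in>Ob C. \<forall>Y\<in>Ob C. \<forall>Z\<in>Ob C. \<forall>f\<in>Hom C X Y. \<forall>g\<in>Hom C Y Z.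
        F' X Z (Comp C X Y Z g f) = Comp D (F X) (F Y) (F Z) (F' Y Z g) (F' X Y f)) \<and>
     (\<forall>X\<in>Ob C. \<forall>Y\<in>Ob C. \<forall>f\<in>Hom C X Y. \<forall>g\<in>Hom C X Y.
        F' X Y (Hom_add C X Y f g) = Hom_add D (F X) (F Y) (F' X Y f) (F' X Y g)) \<and>
     (\<forall>X\<in>Ob C. \<forall>Y\<in>Ob C. \<forall>f\<in>Hom C X Y. \<forall>c.
        F' X Y (Hom_scale C X Y c f) = Hom_scale D (F X) (F Y) c (F' X Y f))"

definition cat_iso :: "('o, 'f) linear_cat \<Rightarrow> 'o \<Rightarrow> 'o \<Rightarrow> 'f \<Rightarrow> bool" where
  "cat_iso C X Y f \<longleftrightarrow> f \<in> Hom C X Y \<and>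
     (\<exists>g\<in>Hom C Y X. Comp C X Y X g f = Idn C X \<and> Comp C Y X Y f g = Idn C Y)"

definition natural_iso :: "('o, 'f) linear_cat \<Rightarrow> ('p, 'g) linear_cat \<Rightarrow>
    ('o \<Rightarrow> 'p) \<Rightarrow> ('o \<Rightarrow> 'o \<Rightarrow> 'f \<Rightarrow> 'g) \<Rightarrow>
    ('o \<Rightarrow> 'p) \<Rightarrow> ('o \<Rightarrow> 'o \<Rightarrow> 'f \<Rightarrow> 'g) \<Rightarrow> ('o \<Rightarrow> 'g) \<Rightarrow> bool" where
  "natural_iso C D F F' G G' \<eta> \<longleftrightarrow>
     (\<forall>X\<in>Ob C. cat_iso D (F X) (G X) (\<eta> X)) \<and>
     (\<forall>X\<in>Ob C. \<forall>Y\<in>Ob C. \<forall>f\<in>Hom C X Y.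
        Comp D (F X) (G X) (G Y) (G' X Y f) (\<eta> X) = Comp D (F X) (F Y) (G Y) (\<eta> Y) (F' X Y f))"

definition equivalent_cats :: "('o, 'f) linear_cat \<Rightarrow> ('p, 'g) linear_cat \<Rightarrow> bool" where
  "equivalent_cats C D \<longleftrightarrow> (\<exists>F F' G G' \<eta> \<epsilon>.
     linear_functor C D F F' \<and> linear_functor D C G G' \<and>
     natural_iso C C (\<lambda>X. X) (\<lambda>X Y f. f) (\<lambda>X. G (F X)) (\<lambda>X Y f. G' (F X) (F Y) (F' X Y f)) \<eta> \<and>
     natural_iso D D (\<lambda>X. F (G X)) (\<lambda>X Y f. F' (G X) (G Y) (G' X Y f)) (\<lambda>X. X) (\<lambda>X Y f. f) \<epsilon>)"

text \<open>The library locale \<open>module\<close> covers modules over commutative rings only.\<close>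

locale left_module = A: ring A + M: abelian_group M
  for A :: "(complex, 'a) module" and M :: "('a, 'm) module" +
  assumes smult_closed: "\<lbrakk>a \<in> carrier A; x \<in> carrier M\<rbrakk> \<Longrightarrow> a \<odot>\<^bsub>M\<^esub> x \<in> carrier M"
    and smult_l_distr: "\<lbrakk>a \<in> carrier A; b \<in> carrier A; x \<in> carrier M\<rbrakk> \<Longrightarrow>
      (a \<oplus>\<^bsub>A\<^esub> b) \<odot>\<^bsub>M\<^esub> x = a \<odot>\<^bsub>M\<^esub> x \<oplus>\<^bsub>M\<^esub> b \<odot>\<^bsub>M\<^esub> x"
    and smult_r_distr: "\<lbrakk>a \<in> carrier A; x \<in> carrier M; y \<in> carrier M\<rbrakk> \<Longrightarrow>
      a \<odot>\<^bsub>M\<^esub> (x \<oplus>\<^bsub>M\<^esub> y) = a \<odot>\<^bsub>M\<^esub> x \<oplus>\<^bsub>M\<^esub> a \<odot>\<^bsub>M\<^esub> y"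
    and smult_assoc: "\<lbrakk>a \<in> carrier A; b \<in> carrier A; x \<in> carrier M\<rbrakk> \<Longrightarrow>
      (a \<otimes>\<^bsub>A\<^esub> b) \<odot>\<^bsub>M\<^esub> x = a \<odot>\<^bsub>M\<^esub> (b \<odot>\<^bsub>M\<^esub> x)"
    and smult_one: "x \<in> carrier M \<Longrightarrow> \<one>\<^bsub>A\<^esub> \<odot>\<^bsub>M\<^esub> x = x"

definition module_homs :: "(complex, 'a) module \<Rightarrow> ('a, 'm) module \<Rightarrow> ('a, 'm) module \<Rightarrow>
    ('m \<Rightarrow> 'm) set" where
  "module_homs A M N = {f \<in> carrier M \<rightarrow>\<^sub>E carrier N.
     (\<forall>x\<in>carrier M. \<forall>y\<in>carrier M. f (x \<oplus>\<^bsub>M\<^esub> y) = f x \<oplus>\<^bsub>N\<^esub> f y) \<and>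
     (\<forall>a\<in>carrier A. \<forall>x\<in>carrier M. f (a \<odot>\<^bsub>M\<^esub> x) = a \<odot>\<^bsub>N\<^esub> f x)}"

text \<open>The category of left \<open>A\<close>-modules whose underlying set is contained in the type \<open>'m\<close>.\<close>

definition module_cat :: "'m itself \<Rightarrow> (complex, 'a) module \<Rightarrow>
    (('a, 'm) module, 'm \<Rightarrow> 'm) linear_cat" where
  "module_cat u A =
     \<lparr>Ob = {M. left_module A M},
      Hom = module_homs A,
      Idn = (\<lambda>M. \<lambda>x\<in>carrier M. x),
      Comp = (\<lambda>L M N g f. compose (carrier L) g f),
      Hom_add = (\<lambda>M N f g. \<lambda>x\<in>carrier M. f x \<oplus>\<^bsub>N\<^esub> g x),
      Hom_scale = (\<lambda>M N c f. \<lambda>x\<in>carrier M. (c \<odot>\<^bsub>A\<^esub> \<one>\<^bsub>A\<^esub>) \<odot>\<^bsub>N\<^esub> f x)\<rparr>"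

text \<open>
  The type \<open>'m\<close> plays the role of a universe. A statement in which it is a free type variable
  asserts the equivalence of the module categories in every universe.
\<close>

definition morita_equivalent :: "'m itself \<Rightarrow> (complex, 'a) module \<Rightarrow>
    (complex, 'b) module \<Rightarrow> bool" where
  "morita_equivalent u A B \<longleftrightarrow> equivalent_cats (module_cat u A) (module_cat u B)"

end

theory Submission
  imports Defs
begin

text \<open>
  Write \<open>1 = \<Sum> p\<^sub>i e q\<^sub>i\<close>, which is possible since \<open>SeS = S\<close>. Inserting this sum between
  consecutive factors turns \<open>e v\<^sub>1 \<otimes> \<dots> \<otimes> v\<^sub>m e\<close> into a tensor over \<open>eSe\<close> with factors
  \<open>e q\<^sub>i v p\<^sub>j e\<close>; this inverts the map from the tensor algebra of \<open>eVe\<close> to \<open>eTe\<close>. The same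
  sum gives \<open>e\<langle>M\<rangle>e = \<langle>eMe\<rangle>\<close>, so \<open>T'/\<langle>eMe\<rangle>\<close> is the corner at \<open>e\<close> of \<open>T/\<langle>M\<rangle>\<close>, and \<open>e\<close> remains full
  in this quotient. For a full idempotent \<open>\<epsilon>\<close> of \<open>A\<close> the functor \<open>M \<mapsto> \<epsilon>M\<close> to \<open>\<epsilon>A\<epsilon>\<close>-modules is
  fully faithful and essentially surjective. For derivation quotients one takes \<open>M\<close> to be the space of
  derivatives of \<open>\<omega>\<close>. As \<open>\<tau>\<close> fixes \<open>e\<close>, \<open>\<omega> x e = \<tau>(x) (e\<omega>e)\<close>, and contracting \<open>e\<omega>e\<close> with
  arbitrary functionals on \<open>V\<close> yields left \<open>S\<close>-combinations of contractions with functionals on \<open>eVe\<close>.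
\<close>

section \<open>Free vector spaces on tensor words\<close>

text \<open>The product on the free space of words is associative only modulo the relations, so
  computations run on representatives, up to the congruence \<open>tcong\<close>, and descend to
  classes afterwards. Every relation over the corner is one over \<open>S\<close>, but the converse
  inclusion of null spaces is not visible: over \<open>S\<close>, elements outside
  \<open>eSe\<close> may cross tensor signs in intermediate words. Injectivity of
  \<open>corner_map\<close> therefore rests on the explicit retraction \<open>cut_word\<close>, and
  the crux is that it respects balancing by an arbitrary \<open>s\<close>; there \<open>s\<close> is
  replaced by the matrix of the elements \<open>e q_m s p_i e\<close> of the corner.

  Essential surjectivity meets a different obstacle: both module categories live in one type
  \<open>'m\<close>, so the coinduced module, a set of functions, must be encoded in that type by a
  cardinality argument.

  For the brackets, nondegeneracy of the trace has to yield that each linear form on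
  \<open>S\<close> is \<open>Tr(r _)\<close>. The corner inherits this property by extending a form
  \<open>f\<close> on \<open>eSe\<close> to \<open>s |-> f(ese)\<close>.\<close>

lemma lookup_free_scale [simp]:
  "Poly_Mapping.lookup (free_scale c f) u = c * Poly_Mapping.lookup f u"
  by (simp add: free_scale_def Poly_Mapping.map.rep_eq when_def)

interpretation free: vector_space free_scale
  by unfold_locales
    (auto intro!: poly_mapping_eqI simp: lookup_add algebra_simps)

lemma free_scale_single [simp]:
  "free_scale c (Poly_Mapping.single u d) = Poly_Mapping.single u (c * d)"
  by (rule poly_mapping_eqI) (simp add: lookup_single when_def)

lemma free_decomposition:
  "f = (\<Sum>u\<in>Poly_Mapping.keys f. free_scale (Poly_Mapping.lookup f u) (word u))"
proof (rule poly_mapping_eqI)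
  fix k
  have "(\<Sum>u\<in>Poly_Mapping.keys f. Poly_Mapping.lookup f u when u = k) = Poly_Mapping.lookup f k"
    by (simp add: when_def if_distrib in_keys_iff cong: if_cong)
  then show "Poly_Mapping.lookup f k =
      Poly_Mapping.lookup (\<Sum>u\<in>Poly_Mapping.keys f. free_scale (Poly_Mapping.lookup f u) (word u)) k"
    by (simp add: lookup_sum lookup_single)
qed

lemma free_induct:
  assumes "free.subspace P" "\<And>u. u \<in> Poly_Mapping.keys f \<Longrightarrow> word u \<in> P"
  shows "f \<in> P"
proof -
  have "(\<Sum>u\<in>Poly_Mapping.keys f. free_scale (Poly_Mapping.lookup f u) (word u)) \<in> P"
    using assms by (intro free.subspace_sum free.subspace_scale)
  then show ?thesis
    by (subst free_decomposition)
qed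

text \<open>Linear extension from words to the free space. Multiplication, contraction and the
  cutting map are all of this form, so linearity and descent to classes are treated once.\<close>

definition lin :: "(('s, 'v) tensor_word \<Rightarrow> ('s, 'v) free_tensor) \<Rightarrow>
    ('s, 'v) free_tensor \<Rightarrow> ('s, 'v) free_tensor" where
  "lin \<phi> f = (\<Sum>u\<in>Poly_Mapping.keys f. free_scale (Poly_Mapping.lookup f u) (\<phi> u))"

text \<open>Keys can cancel in \<open>f + g\<close>; additivity is obtained by comparing the sums
  for \<open>f\<close>, \<open>g\<close> and \<open>f + g\<close> over one finite set containing all
  three supports.\<close>

lemma lin_superset:
  assumes "finite K" "Poly_Mapping.keys f \<subseteq> K"
  shows "lin \<phi> f = (\<Sum>u\<in>K. free_scale (Poly_Mapping.lookup f u) (\<phi> u))"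
  unfolding lin_def using assms
  by (intro sum.mono_neutral_left) (auto simp: in_keys_iff)

lemma lin_add [simp]: "lin \<phi> (f + g) = lin \<phi> f + lin \<phi> g"
proof -
  let ?K = "Poly_Mapping.keys f \<union> Poly_Mapping.keys g"
  have K: "Poly_Mapping.keys (f + g) \<subseteq> ?K"
    by (rule keys_add)
  show ?thesis
    using lin_superset[of ?K "f + g" \<phi>] lin_superset[of ?K f \<phi>] lin_superset[of ?K g \<phi>] K
    by (simp add: lookup_add free.scale_left_distrib sum.distrib)
qed

lemma lin_scale [simp]: "lin \<phi> (free_scale c f) = free_scale c (lin \<phi> f)"
proof -
  have "Poly_Mapping.keys (free_scale c f) \<subseteq> Poly_Mapping.keys f"
    by (auto simp: in_keys_iff)
  then show ?thesis
    using lin_superset[of "Poly_Mapping.keys f" "free_scale c f" \<phi>]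
    by (simp add: free.scale_sum_right lin_def)
qed

lemma lin_zero [simp]: "lin \<phi> 0 = 0"
  by (simp add: lin_def)

lemma lin_uminus [simp]: "lin \<phi> (- f) = - lin \<phi> f"
  using lin_scale[of \<phi> "-1" f] by simp

lemma lin_diff [simp]: "lin \<phi> (f - g) = lin \<phi> f - lin \<phi> g"
  using lin_add[of \<phi> f "- g"] by simp

lemma lin_sum [simp]: "lin \<phi> (\<Sum>i\<in>I. f i) = (\<Sum>i\<in>I. lin \<phi> (f i))"
  by (induction I rule: infinite_finite_induct) auto

lemma lin_word [simp]: "lin \<phi> (word u) = \<phi> u"
  by (simp add: lin_def)

lemma lin_single: "lin \<phi> (Poly_Mapping.single u c) = free_scale c (\<phi> u)"
  using lin_scale[of \<phi> c "word u"] by (simp add: lin_word)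

lemma lin_cong:
  "(\<And>u. u \<in> Poly_Mapping.keys f \<Longrightarrow> \<phi> u = \<psi> u) \<Longrightarrow> lin \<phi> f = lin \<psi> f"
  by (simp add: lin_def)

lemma lin_fun_add: "lin (\<lambda>u. \<phi> u + \<psi> u) f = lin \<phi> f + lin \<psi> f"
  by (simp add: lin_def free.scale_right_distrib sum.distrib)

lemma lin_fun_scale: "lin (\<lambda>u. free_scale c (\<phi> u)) f = free_scale c (lin \<phi> f)"
  by (simp add: lin_def free.scale_sum_right mult.commute)

lemma lin_subspace:
  assumes "free.subspace P" "\<And>u. u \<in> Poly_Mapping.keys f \<Longrightarrow> \<phi> u \<in> P"
  shows "lin \<phi> f \<in> P"
  unfolding lin_def using assms by (intro free.subspace_sum free.subspace_scale)

lemma lin_vimage_subspace: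
  assumes "free.subspace P" shows "free.subspace {f. lin \<phi> f \<in> P}"
  using assms by (intro free.subspaceI) (auto simp: free.subspace_0 free.subspace_add free.subspace_scale)

lemma lin_span:
  assumes "f \<in> free.span R" "free.subspace P" "\<And>r. r \<in> R \<Longrightarrow> lin \<phi> r \<in> P"
  shows "lin \<phi> f \<in> P"
proof -
  have "free.span R \<subseteq> {f. lin \<phi> f \<in> P}"
    using assms by (intro free.span_minimal lin_vimage_subspace) auto
  then show ?thesis using assms(1) by auto
qed

section \<open>Carrier and bilinear product of the free space on words\<close>

abbreviation fcarrier where "fcarrier S V \<equiv> carrier (free_tensor_alg S V)"
abbreviation fmult where "fmult S V \<equiv> mult (free_tensor_alg S V)"

lemma fcarrier_def: "fcarrier S V = {f. Poly_Mapping.keys f \<subseteq> tensor_words S V}"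
  by (simp add: free_tensor_alg_def)

lemma free_add [simp]: "add (free_tensor_alg S V) = (+)"
  and free_zero [simp]: "zero (free_tensor_alg S V) = 0"
  and free_one: "one (free_tensor_alg S V) = word (Scalar (one S))"
  and free_smult [simp]: "smult (free_tensor_alg S V) = free_scale"
  by (simp_all add: free_tensor_alg_def)

lemma fcarrier_subspace: "free.subspace (fcarrier S V)"
proof (rule free.subspaceI)
  show "f + g \<in> fcarrier S V" if "f \<in> fcarrier S V" "g \<in> fcarrier S V" for f g
    using that keys_add[of f g] by (auto simp: fcarrier_def)
  show "free_scale c f \<in> fcarrier S V" if "f \<in> fcarrier S V" for c f
    using that by (auto simp: fcarrier_def in_keys_iff)
qed (simp add: fcarrier_def)

lemma word_fcarrier [simp]: "word u \<in> fcarrier S V \<longleftrightarrow> u \<in> tensor_words S V"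
  by (simp add: fcarrier_def)

lemma fcarrier_add [simp]: "f \<in> fcarrier S V \<Longrightarrow> g \<in> fcarrier S V \<Longrightarrow> f + g \<in> fcarrier S V"
  and fcarrier_diff [simp]: "f \<in> fcarrier S V \<Longrightarrow> g \<in> fcarrier S V \<Longrightarrow> f - g \<in> fcarrier S V"
  and fcarrier_scale [simp]: "f \<in> fcarrier S V \<Longrightarrow> free_scale c f \<in> fcarrier S V"
  and fcarrier_zero [simp]: "0 \<in> fcarrier S V"
  and fcarrier_sum: "(\<And>i. i \<in> I \<Longrightarrow> F i \<in> fcarrier S V) \<Longrightarrow> sum F I \<in> fcarrier S V"
  using fcarrier_subspace[of S V]
  by (simp_all add: free.subspace_add free.subspace_diff free.subspace_scale free.subspace_0
    free.subspace_sum)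

lemma fcarrier_induct:
  assumes "f \<in> fcarrier S V" "free.subspace P" "\<And>u. u \<in> tensor_words S V \<Longrightarrow> word u \<in> P"
  shows "f \<in> P"
  using assms(2) by (rule free_induct) (use assms in \<open>auto simp: fcarrier_def\<close>)

lemma fcarrier_lin:
  "f \<in> fcarrier S V \<Longrightarrow> (\<And>u. u \<in> tensor_words S V \<Longrightarrow> \<phi> u \<in> fcarrier S' V') \<Longrightarrow> lin \<phi> f \<in> fcarrier S' V'"
  by (rule lin_subspace[OF fcarrier_subspace]) (auto simp: fcarrier_def)

text \<open>As a nested linear extension the product is visibly linear in each argument, for
  arbitrary elements of the type and not only for those of the carrier.\<close>

lemma fmult_lin: "fmult S V f g = lin (\<lambda>u. lin (\<lambda>w. word (word_mult S V u w)) g) f"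
  by (simp add: free_tensor_alg_def lin_def free.scale_sum_right)

lemma fmult_add_left [simp]: "fmult S V (f + g) h = fmult S V f h + fmult S V g h"
  and fmult_diff_left [simp]: "fmult S V (f - g) h = fmult S V f h - fmult S V g h"
  and fmult_scale_left [simp]: "fmult S V (free_scale c f) h = free_scale c (fmult S V f h)"
  and fmult_zero_left [simp]: "fmult S V 0 h = 0"
  and fmult_sum_left: "fmult S V (\<Sum>i\<in>I. F i) h = (\<Sum>i\<in>I. fmult S V (F i) h)"
  by (simp_all add: fmult_lin)

lemma fmult_add_right [simp]: "fmult S V h (f + g) = fmult S V h f + fmult S V h g"
  and fmult_scale_right [simp]: "fmult S V h (free_scale c f) = free_scale c (fmult S V h f)"
  by (simp_all add: fmult_lin lin_fun_add lin_fun_scale)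

lemma fmult_zero_right [simp]: "fmult S V h 0 = 0"
  using fmult_scale_right[of S V h 0 0] by simp

lemma fmult_diff_right [simp]: "fmult S V h (f - g) = fmult S V h f - fmult S V h g"
  using fmult_add_right[of S V h "f - g" g] by (simp add: algebra_simps)

lemma fmult_sum_right: "fmult S V h (\<Sum>i\<in>I. F i) = (\<Sum>i\<in>I. fmult S V h (F i))"
  by (induction I rule: infinite_finite_induct) auto

lemma fmult_word [simp]: "fmult S V (word u) (word w) = word (word_mult S V u w)"
  by (simp add: fmult_lin)

text \<open>The inductive definition adds one multiple of a relation at a time; as a span, the null
  space gets the closure and induction rules of vector spaces.\<close>

lemma tensor_null_span: "tensor_null S V = free.span (tensor_relations S V)"
proof
  have "f \<in> free.span (tensor_relations S V)" if "f \<in> tensor_null S V" for f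
    using that by induction (auto intro: free.span_zero free.span_add free.span_scale free.span_base)
  then show "tensor_null S V \<subseteq> free.span (tensor_relations S V)" by blast
  have "f \<in> tensor_null S V" if "f \<in> free.span (tensor_relations S V)" for f
    using that
  proof (induction rule: free.span_induct_alt)
    case base
    show ?case by (rule tensor_null.zero)
  next
    case (step c x y)
    then show ?case using tensor_null.add_rel[of y S V x c] by (simp add: add.commute)
  qed
  then show "free.span (tensor_relations S V) \<subseteq> tensor_null S V" by blast
qed

lemma tensor_null_subspace: "free.subspace (tensor_null S V)"
  by (simp add: tensor_null_span)

lemma null_add: "f \<in> tensor_null S V \<Longrightarrow> g \<in> tensor_null S V \<Longrightarrow> f + g \<in> tensor_null S V"
  and null_uminus: "f \<in> tensor_null S V \<Longrightarrow> - f \<in> tensor_null S V"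
  and null_scale: "f \<in> tensor_null S V \<Longrightarrow> free_scale c f \<in> tensor_null S V"
  and null_zero [simp]: "0 \<in> tensor_null S V"
  and null_sum: "(\<And>i. i \<in> I \<Longrightarrow> F i \<in> tensor_null S V) \<Longrightarrow> sum F I \<in> tensor_null S V"
  using tensor_null_subspace[of S V]
  by (simp_all add: free.subspace_add free.subspace_diff free.subspace_neg
    free.subspace_scale free.subspace_0 free.subspace_sum)

lemma null_rel: "r \<in> tensor_relations S V \<Longrightarrow> r \<in> tensor_null S V"
  by (simp add: tensor_null_span free.span_base)

lemma lin_null:
  assumes "f \<in> tensor_null S V" "free.subspace P" "\<And>r. r \<in> tensor_relations S V \<Longrightarrow> lin \<phi> r \<in> P"
  shows "lin \<phi> f \<in> P"
  using assms lin_span unfolding tensor_null_span by blast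

subsection \<open>Congruence modulo the tensor relations\<close>

definition tcong :: "(complex, 's) module \<Rightarrow> ('s, 'v) bimodule \<Rightarrow>
    ('s, 'v) free_tensor \<Rightarrow> ('s, 'v) free_tensor \<Rightarrow> bool" where
  "tcong S V f g \<longleftrightarrow> f - g \<in> tensor_null S V"

lemma tcong_refl [simp]: "tcong S V f f"
  by (simp add: tcong_def)

lemma tcong_sym: "tcong S V f g \<Longrightarrow> tcong S V g f"
  using null_uminus[of "f - g" S V] by (simp add: tcong_def)

lemma tcong_trans [trans]: "tcong S V f g \<Longrightarrow> tcong S V g h \<Longrightarrow> tcong S V f h"
  using null_add[of "f - g" S V "g - h"] by (simp add: tcong_def)

lemma tcong_add: "tcong S V f g \<Longrightarrow> tcong S V f' g' \<Longrightarrow> tcong S V (f + f') (g + g')"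
  using null_add[of "f - g" S V "f' - g'"] by (simp add: tcong_def algebra_simps)

lemma tcong_scale: "tcong S V f g \<Longrightarrow> tcong S V (free_scale c f) (free_scale c g)"
  using null_scale[of "f - g" S V c] by (simp add: tcong_def free.scale_right_diff_distrib)

lemma tcong_sum: "(\<And>i. i \<in> I \<Longrightarrow> tcong S V (F i) (G i)) \<Longrightarrow> tcong S V (sum F I) (sum G I)"
  using null_sum[of I "\<lambda>i. F i - G i" S V] by (simp add: tcong_def sum_subtractf)

text \<open>Criterion for a map on words to induce a map on tensor classes: by linearity the null
  element \<open>f - g\<close> may be replaced by single relations.\<close>

lemma lin_tcong:
  assumes "tcong S V f g" "\<And>r. r \<in> tensor_relations S V \<Longrightarrow> lin \<phi> r \<in> tensor_null S' V'"
  shows "tcong S' V' (lin \<phi> f) (lin \<phi> g)"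
  using lin_null[of "f - g" S V "tensor_null S' V'" \<phi>] assms tensor_null_subspace
  by (auto simp: tcong_def)

lemma coset_eq: "tensor_class S V f = {h + f | h. h \<in> tensor_null S V}"
  unfolding tensor_class_def a_r_coset_def r_coset_def by (simp, blast)

lemma mem_tensor_class: "g \<in> tensor_class S V f \<longleftrightarrow> tcong S V g f"
proof
  assume "tcong S V g f"
  then have "g - f \<in> tensor_null S V \<and> g = (g - f) + f"
    by (simp add: tcong_def)
  then show "g \<in> tensor_class S V f"
    unfolding coset_eq by blast
next
  assume "g \<in> tensor_class S V f"
  then show "tcong S V g f"
    by (auto simp: coset_eq tcong_def)
qed

lemma tensor_class_eq_iff: "tensor_class S V f = tensor_class S V g \<longleftrightarrow> tcong S V f g"
  proof
  assume "tensor_class S V f = tensor_class S V g"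
  then show "tcong S V f g"
    using mem_tensor_class[of f S V f] mem_tensor_class[of f S V g] by simp
next
  assume "tcong S V f g"
  then show "tensor_class S V f = tensor_class S V g"
    using tcong_trans[of S V _ f g] tcong_trans[OF _ tcong_sym[of S V f g]] by (auto simp: mem_tensor_class)
qed

section \<open>The tensor algebra is an algebra\<close>

lemma complex_ring_simps [simp]:
  "carrier complex_ring = UNIV" "mult complex_ring = (*)" "one complex_ring = 1"
  "zero complex_ring = 0" "add complex_ring = (+)"
  by (simp_all add: complex_ring_def)

lemma cring_complex_ring: "cring complex_ring"
proof (rule cringI)
  show "abelian_group complex_ring"
  proof (rule abelian_groupI)
    show "\<exists>y\<in>carrier complex_ring. y \<oplus>\<^bsub>complex_ring\<^esub> x = \<zero>\<^bsub>complex_ring\<^esub>" for x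
      by (rule bexI[of _ "- x"]) auto
  qed (auto simp: algebra_simps)
  show "comm_monoid complex_ring"
    by (rule comm_monoidI) (auto simp: algebra_simps)
qed (auto simp: algebra_simps)

context complex_alg
begin

text \<open>Scalars act as the central elements \<open>c 1\<close>, which turns laws for scalars
  into instances of ring and bimodule laws.\<close>

lemma smult_eq_mult_left: "x \<in> carrier A \<Longrightarrow> c \<odot> x = (c \<odot> \<one>) \<otimes> x"
  using smult_mult_left[of \<one> x c] by simp

lemma smult_eq_mult_right: "x \<in> carrier A \<Longrightarrow> c \<odot> x = x \<otimes> (c \<odot> \<one>)"
  using smult_mult_right[of x \<one> c] by simp

lemma smult_carrier [simp]: "x \<in> carrier A \<Longrightarrow> c \<odot> x \<in> carrier A"
  using smult_closed[of c x] by simp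

text \<open>
  Facts about the ring \<open>A\<close> that the locale otherwise hides behind those about \<open>complex_ring\<close>.
\<close>

lemma ring_A: "ring A"
  by unfold_locales

lemma semiring_A: "semiring A"
proof -
  interpret R: ring A by (rule ring_A)
  show ?thesis by unfold_locales
qed

lemmas A_l_distr = semiring.l_distr[OF semiring_A]
  and A_r_distr = semiring.r_distr[OF semiring_A]
  and A_m_assoc = monoid.m_assoc[OF ring.is_monoid[OF ring_A]]

end

lemma word_mult_hd_tl:
  "word_mult S V (Scalar s) (Tensor (v # vs)) = Tensor (lact V s v # vs)"
  "word_mult S V (Tensor (vs @ [v])) (Scalar s) = Tensor (vs @ [ract V v s])"
  "word_mult S V (Tensor [v]) (Scalar s) = Tensor [ract V v s]"
  by simp_all

context complex_bimodule
begin

lemma tensor_words_cases: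
  assumes "u \<in> tensor_words S V"
  obtains s where "u = Scalar s" "s \<in> carrier S"
  | v vs where "u = Tensor (v # vs)" "v \<in> carrier V" "set vs \<subseteq> carrier V"
  using assms unfolding tensor_words_def by (auto simp: neq_Nil_conv)

text \<open>The counterpart of \<open>tensor_words_cases\<close> for right multiplication, which
  acts on the last factor instead of the first.\<close>

lemma tensor_words_rev_cases:
  assumes "u \<in> tensor_words S V"
  obtains s where "u = Scalar s" "s \<in> carrier S"
  | v vs where "u = Tensor (vs @ [v])" "v \<in> carrier V" "set vs \<subseteq> carrier V"
proof -
  consider s where "u = Scalar s" "s \<in> carrier S"
    | vs where "u = Tensor vs" "vs \<noteq> []" "set vs \<subseteq> carrier V"
    using assms unfolding tensor_words_def by auto
  then show ?thesis
  proof cases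
    case (2 vs)
    then show ?thesis by (cases vs rule: rev_cases) (use that in auto)
  qed (rule that)
qed

lemma Scalar_tensor_words [simp]: "Scalar s \<in> tensor_words S V \<longleftrightarrow> s \<in> carrier S"
  and Tensor_tensor_words [simp]: "Tensor vs \<in> tensor_words S V \<longleftrightarrow> vs \<noteq> [] \<and> set vs \<subseteq> carrier V"
  by (auto simp: tensor_words_def)

lemmas act_closed [simp] = lact_closed ract_closed

lemma word_mult_closed [simp]:
  assumes "u \<in> tensor_words S V" "w \<in> tensor_words S V"
  shows "word_mult S V u w \<in> tensor_words S V"
  using assms(2)
proof (cases rule: tensor_words_cases)
  case (1 s)
  with assms(1) show ?thesis
    by (cases rule: tensor_words_rev_cases) (auto simp: word_mult_hd_tl simp del: word_mult.simps(3))
next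
  case (2 v vs)
  with assms(1) show ?thesis
    by (cases rule: tensor_words_cases) auto
qed

lemma fmult_closed [simp]:
  assumes "f \<in> fcarrier S V" "g \<in> fcarrier S V" shows "fmult S V f g \<in> fcarrier S V"
  unfolding fmult_lin using assms by (intro fcarrier_lin) auto

lemma lact_smult_left:
  "s \<in> carrier S \<Longrightarrow> v \<in> carrier V \<Longrightarrow> lact V (c \<odot>\<^bsub>S\<^esub> s) v = c \<odot>\<^bsub>V\<^esub> lact V s v"
  by (subst S.smult_eq_mult_left) (simp_all add: lact_mult lact_complex)

lemma lact_smult_right:
  assumes "s \<in> carrier S" "v \<in> carrier V"
  shows "lact V s (c \<odot>\<^bsub>V\<^esub> v) = c \<odot>\<^bsub>V\<^esub> lact V s v"
proof -
  have "lact V s (c \<odot>\<^bsub>V\<^esub> v) = lact V (s \<otimes>\<^bsub>S\<^esub> (c \<odot>\<^bsub>S\<^esub> \<one>\<^bsub>S\<^esub>)) v"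
    using assms by (simp add: lact_mult lact_complex)
  then show ?thesis
    using assms by (simp add: lact_smult_left flip: S.smult_eq_mult_right)
qed

lemma ract_smult_right:
  "s \<in> carrier S \<Longrightarrow> v \<in> carrier V \<Longrightarrow> ract V v (c \<odot>\<^bsub>S\<^esub> s) = c \<odot>\<^bsub>V\<^esub> ract V v s"
  by (subst S.smult_eq_mult_right) (simp_all add: ract_mult ract_complex)

lemma ract_smult_left:
  assumes "s \<in> carrier S" "v \<in> carrier V"
  shows "ract V (c \<odot>\<^bsub>V\<^esub> v) s = c \<odot>\<^bsub>V\<^esub> ract V v s"
proof -
  have "ract V (c \<odot>\<^bsub>V\<^esub> v) s = ract V v ((c \<odot>\<^bsub>S\<^esub> \<one>\<^bsub>S\<^esub>) \<otimes>\<^bsub>S\<^esub> s)"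
    using assms by (simp add: ract_mult ract_complex)
  then show ?thesis
    using assms by (simp add: ract_smult_right flip: S.smult_eq_mult_left)
qed

lemma lact_one [simp]: "v \<in> carrier V \<Longrightarrow> lact V \<one>\<^bsub>S\<^esub> v = v"
  and ract_one [simp]: "v \<in> carrier V \<Longrightarrow> ract V v \<one>\<^bsub>S\<^esub> = v"
  using lact_complex[of v 1] ract_complex[of v 1] V.smult_one[of v] S.smult_one[of "\<one>\<^bsub>S\<^esub>"] by auto

section \<open>The null space is a two-sided ideal, and the product is associative modulo it\<close>

lemma relations_fcarrier: "r \<in> tensor_relations S V \<Longrightarrow> r \<in> fcarrier S V"
  by (induction rule: tensor_relations.induct)
    (auto intro!: fcarrier_diff fcarrier_add fcarrier_scale simp del: free_scale_single)

lemma null_fcarrier: "f \<in> tensor_null S V \<Longrightarrow> f \<in> fcarrier S V"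
  using free.span_minimal[OF _ fcarrier_subspace] relations_fcarrier
  unfolding tensor_null_span by blast

lemma relation_Tensor_add:
  assumes "set us \<subseteq> carrier V" "v \<in> carrier V" "w \<in> carrier V" "set ws \<subseteq> carrier V"
    "x = Tensor (us @ [v \<oplus>\<^bsub>V\<^esub> w] @ ws)" "y = Tensor (us @ [v] @ ws)" "z = Tensor (us @ [w] @ ws)"
  shows "word x - (word y + word z) \<in> tensor_null S V"
  using null_rel[OF tensor_relations.tensor_add[of us V v w ws S]] assms by simp

lemma relation_Tensor_smult:
  assumes "set us \<subseteq> carrier V" "v \<in> carrier V" "set ws \<subseteq> carrier V"
    "x = Tensor (us @ [c \<odot>\<^bsub>V\<^esub> v] @ ws)" "y = Tensor (us @ [v] @ ws)"
  shows "word x - free_scale c (word y) \<in> tensor_null S V"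
  using null_rel[OF tensor_relations.tensor_smult[of us V v ws c S]] assms by simp

lemma relation_Tensor_balanced:
  assumes "set us \<subseteq> carrier V" "v \<in> carrier V" "s \<in> carrier S" "w \<in> carrier V"
    "set ws \<subseteq> carrier V"
    "x = Tensor (us @ [ract V v s, w] @ ws)" "y = Tensor (us @ [v, lact V s w] @ ws)"
  shows "word x - word y \<in> tensor_null S V"
  using null_rel[OF tensor_relations.tensor_balanced[of us V v s S w ws]] assms by simp

lemma relation_Scalar_add:
  assumes "s \<in> carrier S" "t \<in> carrier S"
  shows "word (Scalar (s \<oplus>\<^bsub>S\<^esub> t)) - (word (Scalar s) + word (Scalar t)) \<in> tensor_null S V"
  using null_rel[OF tensor_relations.scalar_add[of s S t V]] assms by simp

lemma relation_Scalar_smult: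
  assumes "s \<in> carrier S"
  shows "word (Scalar (c \<odot>\<^bsub>S\<^esub> s)) - free_scale c (word (Scalar s)) \<in> tensor_null S V"
  using null_rel[OF tensor_relations.scalar_smult[of s S c V]] assms by simp

text \<open>Right multiplication by a scalar changes only the last factor. A relation further to the
  left survives with that factor changed; one that involves the last factor is carried over by
  additivity, by homogeneity or, for balancing, because the two actions commute.\<close>

lemma relation_mult_Scalar:
  assumes "r \<in> tensor_relations S V" "t \<in> carrier S"
  shows "fmult S V r (word (Scalar t)) \<in> tensor_null S V"
  using assms(1)
proof cases
  case (scalar_add s s')
  then show ?thesis
    using assms relation_Scalar_add[of "s \<otimes>\<^bsub>S\<^esub> t" "s' \<otimes>\<^bsub>S\<^esub> t"] by (simp add: S.A_l_distr)
next
  case (scalar_smult s c)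
  then show ?thesis
    using assms relation_Scalar_smult[of "s \<otimes>\<^bsub>S\<^esub> t" c]
    by (simp add: S.smult_mult_left del: free_scale_single)
next
  case (tensor_add us v w ws)
  then show ?thesis
  proof (cases ws rule: rev_cases)
    case Nil
    then show ?thesis
      using tensor_add assms
        relation_Tensor_add[of us "ract V v t" "ract V w t" "[]"]
      by (simp add: ract_add)
  next
    case (snoc ws' z)
    then show ?thesis
      using tensor_add assms
        relation_Tensor_add[of us v w "ws' @ [ract V z t]"]
      by (simp add: butlast_append)
  qed
next
  case (tensor_smult us v ws c)
  then show ?thesis
  proof (cases ws rule: rev_cases)
    case Nil
    then show ?thesis
      using tensor_smult assms
        relation_Tensor_smult[of us "ract V v t" "[]" _ c]
      by (simp add: ract_smult_left del: free_scale_single)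
  next
    case (snoc ws' z)
    then show ?thesis
      using tensor_smult assms
        relation_Tensor_smult[of us v "ws' @ [ract V z t]" _ c]
      by (simp add: butlast_append del: free_scale_single)
  qed
next
  case (tensor_balanced us v s w ws)
  then show ?thesis
  proof (cases ws rule: rev_cases)
    case Nil
    then show ?thesis
      using tensor_balanced assms
        relation_Tensor_balanced[of us v s "ract V w t" "[]"]
      by (simp add: butlast_append lact_ract)
  next
    case (snoc ws' z)
    then show ?thesis
      using tensor_balanced assms
        relation_Tensor_balanced[of us v s w "ws' @ [ract V z t]"]
      by (simp add: butlast_append)
  qed
qed

lemma Scalar_mult_relation:
  assumes "r \<in> tensor_relations S V" "t \<in> carrier S"
  shows "fmult S V (word (Scalar t)) r \<in> tensor_null S V"
  using assms(1)
proof cases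
  case (scalar_add s s')
  then show ?thesis
    using assms relation_Scalar_add[of "t \<otimes>\<^bsub>S\<^esub> s" "t \<otimes>\<^bsub>S\<^esub> s'"] by (simp add: S.A_r_distr)
next
  case (scalar_smult s c)
  then show ?thesis
    using assms relation_Scalar_smult[of "t \<otimes>\<^bsub>S\<^esub> s" c]
    by (simp add: S.smult_mult_right[symmetric] del: free_scale_single)
next
  case (tensor_add us v w ws)
  then show ?thesis
  proof (cases us)
    case Nil
    then show ?thesis
      using tensor_add assms
        relation_Tensor_add[of "[]" "lact V t v" "lact V t w" ws]
      by (simp add: lact_add)
  next
    case (Cons z us')
    then show ?thesis
      using tensor_add assms
        relation_Tensor_add[of "lact V t z # us'" v w ws]
      by simp
  qed
next
  case (tensor_smult us v ws c)
  then show ?thesis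
  proof (cases us)
    case Nil
    then show ?thesis
      using tensor_smult assms
        relation_Tensor_smult[of "[]" "lact V t v" ws _ c]
      by (simp add: lact_smult_right del: free_scale_single)
  next
    case (Cons z us')
    then show ?thesis
      using tensor_smult assms
        relation_Tensor_smult[of "lact V t z # us'" v ws _ c]
      by (simp del: free_scale_single)
  qed
next
  case (tensor_balanced us v s w ws)
  then show ?thesis
  proof (cases us)
    case Nil
    then show ?thesis
      using tensor_balanced assms
        relation_Tensor_balanced[of "[]" "lact V t v" s w ws]
      by (simp add: lact_ract)
  next
    case (Cons z us')
    then show ?thesis
      using tensor_balanced assms
        relation_Tensor_balanced[of "lact V t z # us'" v s w ws]
      by simp
  qed
qed

text \<open>A relation between scalars turns into a relation in the first factor \<open>x\<close>,
  since the left action is linear in the scalar. The tensor relations merely get longer.\<close>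

lemma relation_mult_Tensor:
  assumes "r \<in> tensor_relations S V" "x \<in> carrier V" "set xs \<subseteq> carrier V"
  shows "fmult S V r (word (Tensor (x # xs))) \<in> tensor_null S V"
  using assms(1)
proof cases
  case (scalar_add s s')
  then show ?thesis
    using assms relation_Tensor_add[of "[]" "lact V s x" "lact V s' x" xs]
    by (simp add: lact_add_scalar)
next
  case (scalar_smult s c)
  then show ?thesis
    using assms relation_Tensor_smult[of "[]" "lact V s x" xs _ c]
    by (simp add: lact_smult_left del: free_scale_single)
next
  case (tensor_add us v w ws)
  then show ?thesis
    using assms relation_Tensor_add[of us v w "ws @ x # xs"] by simp
next
  case (tensor_smult us v ws c)
  then show ?thesis
    using assms relation_Tensor_smult[of us v "ws @ x # xs" _ c] by (simp del: free_scale_single)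
next
  case (tensor_balanced us v s w ws)
  then show ?thesis
    using assms relation_Tensor_balanced[of us v s w "ws @ x # xs"] by simp
qed

lemma Tensor_mult_relation:
  assumes "r \<in> tensor_relations S V" "x \<in> carrier V" "set xs \<subseteq> carrier V"
  shows "fmult S V (word (Tensor (xs @ [x]))) r \<in> tensor_null S V"
  using assms(1)
proof cases
  case (scalar_add s s')
  then show ?thesis
    using assms relation_Tensor_add[of xs "ract V x s" "ract V x s'" "[]"]
    by (simp add: ract_add_scalar)
next
  case (scalar_smult s c)
  then show ?thesis
    using assms relation_Tensor_smult[of xs "ract V x s" "[]" _ c]
    by (simp add: ract_smult_right del: free_scale_single)
next
  case (tensor_add us v w ws)
  then show ?thesis
    using assms relation_Tensor_add[of "xs @ x # us" v w "ws"] by simp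
next
  case (tensor_smult us v ws c)
  then show ?thesis
    using assms relation_Tensor_smult[of "xs @ x # us" v "ws" _ c] by (simp del: free_scale_single)
next
  case (tensor_balanced us v s w ws)
  then show ?thesis
    using assms relation_Tensor_balanced[of "xs @ x # us" v s w "ws"] by simp
qed

text \<open>With \<open>mult_null\<close> this makes products of classes independent of
  representatives. Bilinearity reduces the claim to a relation times a word.\<close>

lemma null_mult:
  assumes "f \<in> tensor_null S V" "g \<in> fcarrier S V"
  shows "fmult S V f g \<in> tensor_null S V"
proof -
  have "g \<in> {g. fmult S V f g \<in> tensor_null S V}"
    using assms(2)
  proof (rule fcarrier_induct)
  show "free.subspace {g. fmult S V f g \<in> tensor_null S V}" for f
    by (rule free.subspaceI) (auto intro: null_add null_scale)
  fix u assume u: "u \<in> tensor_words S V"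
  have "fmult S V r (word u) \<in> tensor_null S V" if "r \<in> tensor_relations S V" for r
    using u by (cases rule: tensor_words_cases) (simp_all add: that relation_mult_Scalar relation_mult_Tensor)
  then have "lin (\<lambda>w. word (word_mult S V w u)) f \<in> tensor_null S V"
    by (intro lin_null[OF assms(1) tensor_null_subspace]) (simp add: fmult_lin)
  then show "word u \<in> {g. fmult S V f g \<in> tensor_null S V}"
    by (simp add: fmult_lin)
  qed
  then show ?thesis by simp
qed

lemma mult_null:
  assumes "f \<in> tensor_null S V" "g \<in> fcarrier S V"
  shows "fmult S V g f \<in> tensor_null S V"
proof -
  have "g \<in> {g. fmult S V g f \<in> tensor_null S V}"
    using assms(2)
  proof (rule fcarrier_induct)
  show "free.subspace {g. fmult S V g f \<in> tensor_null S V}" for f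
    by (rule free.subspaceI) (auto intro: null_add null_scale)
  fix u assume u: "u \<in> tensor_words S V"
  have "fmult S V (word u) r \<in> tensor_null S V" if "r \<in> tensor_relations S V" for r
    using u by (cases rule: tensor_words_rev_cases) (simp_all add: that Scalar_mult_relation Tensor_mult_relation)
  then have "lin (\<lambda>w. word (word_mult S V u w)) f \<in> tensor_null S V"
    by (intro lin_null[OF assms(1) tensor_null_subspace]) (simp add: fmult_lin)
  then show "word u \<in> {g. fmult S V g f \<in> tensor_null S V}"
    by (simp add: fmult_lin)
  qed
  then show ?thesis by simp
qed

text \<open>\<open>f g - f' g' = (f - f') g + f' (g - g')\<close>, so only \<open>g\<close> and
  \<open>f'\<close> have to lie in the carrier.\<close>

lemma tcong_mult:
  assumes "tcong S V f f'" "tcong S V g g'" "f' \<in> fcarrier S V" "g \<in> fcarrier S V"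
  shows "tcong S V (fmult S V f g) (fmult S V f' g')"
  using null_add[OF null_mult[of "f - f'" g] mult_null[of "g - g'" f']] assms
  by (simp add: tcong_def)

lemma tcong_fcarrier: "tcong S V f g \<Longrightarrow> g \<in> fcarrier S V \<Longrightarrow> f \<in> fcarrier S V"
  using null_fcarrier[of "f - g"] fcarrier_add[of "f - g" S V g] by (simp add: tcong_def)

text \<open>Both bracketings give the same word except for a scalar between two tensors: it acts on
  the last factor to its left or on the first factor to its right, and the difference is exactly a
  balancing relation.\<close>

lemma word_mult_assoc:
  assumes "u \<in> tensor_words S V" "v \<in> tensor_words S V" "w \<in> tensor_words S V"
  shows "tcong S V (word (word_mult S V (word_mult S V u v) w)) (word (word_mult S V u (word_mult S V v w)))"
  using assms(2)
proof (cases rule: tensor_words_cases)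
  case (1 s)
  from assms(1) show ?thesis
  proof (cases rule: tensor_words_rev_cases)
    case u: (1 t)
    from assms(3) show ?thesis
      by (cases rule: tensor_words_cases) (use 1 u in \<open>auto simp: S.A_m_assoc lact_mult\<close>)
  next
    case u: (2 x xs)
    from assms(3) show ?thesis
    proof (cases rule: tensor_words_cases)
      case w: (1 t)
      then show ?thesis using 1 u by (simp add: ract_mult)
    next
      case w: (2 y ys)
      then show ?thesis
        using 1 u relation_Tensor_balanced[of xs x s y ys] by (simp add: tcong_def)
    qed
  qed
next
  case (2 y ys)
  from assms(1) show ?thesis
  proof (cases rule: tensor_words_rev_cases)
    case u: (1 t)
    from assms(3) show ?thesis
      by (cases rule: tensor_words_cases; cases ys rule: rev_cases)
        (use 2 u in \<open>auto simp: lact_ract\<close>)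
  next
    case u: (2 x xs)
    from assms(3) show ?thesis
      by (cases rule: tensor_words_cases) (use 2 u in \<open>auto simp: butlast_append\<close>)
  qed
qed

text \<open>The associator is linear in each argument, so its vanishing modulo the null space
  spreads from words to the whole carrier one argument at a time, starting with the last.\<close>

lemma fmult_assoc:
  assumes "f \<in> fcarrier S V" "g \<in> fcarrier S V" "h \<in> fcarrier S V"
  shows "tcong S V (fmult S V (fmult S V f g) h) (fmult S V f (fmult S V g h))"
proof -
  let ?D = "\<lambda>f g h. fmult S V (fmult S V f g) h - fmult S V f (fmult S V g h)"
  have sub: "f + f' - (g + g') \<in> tensor_null S V"
    if "f - g \<in> tensor_null S V" "f' - g' \<in> tensor_null S V" for f f' g g'
    using null_add[OF that] by (simp add: algebra_simps)
  have sub': "free_scale c f - free_scale c g \<in> tensor_null S V"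
    if "f - g \<in> tensor_null S V" for c f g
    using null_scale[OF that, of c] by (simp add: free.scale_right_diff_distrib)
  have D3: "?D (word u) (word v) h \<in> tensor_null S V"
    if "u \<in> tensor_words S V" "v \<in> tensor_words S V" for u v
  proof -
    have "h \<in> {h. ?D (word u) (word v) h \<in> tensor_null S V}"
      using assms(3)
    proof (rule fcarrier_induct)
      show "free.subspace {h. ?D (word u) (word v) h \<in> tensor_null S V}"
        by (intro free.subspaceI) (auto intro: sub sub')
    qed (use word_mult_assoc that in \<open>auto simp: tcong_def\<close>)
    then show ?thesis by simp
  qed
  have D2: "?D (word u) g h \<in> tensor_null S V" if "u \<in> tensor_words S V" for u
  proof -
    have "g \<in> {g. ?D (word u) g h \<in> tensor_null S V}"
      using assms(2)
    proof (rule fcarrier_induct)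
      show "free.subspace {g. ?D (word u) g h \<in> tensor_null S V}"
        by (intro free.subspaceI) (auto intro: sub sub')
    qed (use D3 that in auto)
    then show ?thesis by simp
  qed
  have "f \<in> {f. ?D f g h \<in> tensor_null S V}"
    using assms(1)
  proof (rule fcarrier_induct)
    show "free.subspace {f. ?D f g h \<in> tensor_null S V}"
      by (intro free.subspaceI) (auto intro: sub sub')
  qed (use D2 in auto)
  then show ?thesis by (simp add: tcong_def)
qed

lemma fmult_one_left:
  assumes "f \<in> fcarrier S V" shows "fmult S V (word (Scalar \<one>\<^bsub>S\<^esub>)) f = f"
proof -
  have "f \<in> {f. fmult S V (word (Scalar \<one>\<^bsub>S\<^esub>)) f = f}"
    using assms
  proof (rule fcarrier_induct)
    show "word u \<in> {f. fmult S V (word (Scalar \<one>\<^bsub>S\<^esub>)) f = f}" if "u \<in> tensor_words S V" for u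
      using that by (cases rule: tensor_words_cases) auto
  qed (auto intro: free.subspaceI)
  then show ?thesis by simp
qed

lemma fmult_one_right:
  assumes "f \<in> fcarrier S V" shows "fmult S V f (word (Scalar \<one>\<^bsub>S\<^esub>)) = f"
proof -
  have "f \<in> {f. fmult S V f (word (Scalar \<one>\<^bsub>S\<^esub>)) = f}"
    using assms
  proof (rule fcarrier_induct)
    show "word u \<in> {f. fmult S V f (word (Scalar \<one>\<^bsub>S\<^esub>)) = f}" if "u \<in> tensor_words S V" for u
      using that by (cases rule: tensor_words_rev_cases) auto
  qed (auto intro: free.subspaceI)
  then show ?thesis by simp
qed

end

section \<open>Operations on tensor classes\<close>

lemma tensor_class_self: "f \<in> tensor_class S V f"
  by (simp add: mem_tensor_class)

lemma tensor_alg_carrier: "carrier (tensor_alg S V) = tensor_class S V ` fcarrier S V"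
  by (auto simp: tensor_alg_def quot_alg_def FactRing_def A_RCOSETS_def RCOSETS_def
      tensor_class_def a_r_coset_def)

lemma tensor_class_closed [simp]:
  "f \<in> fcarrier S V \<Longrightarrow> tensor_class S V f \<in> carrier (tensor_alg S V)"
  by (simp add: tensor_alg_carrier)

lemma tensor_alg_zero: "zero (tensor_alg S V) = tensor_class S V 0"
  by (auto simp: tensor_alg_def quot_alg_def FactRing_def mem_tensor_class tcong_def)

lemma tensor_alg_one: "one (tensor_alg S V) = tensor_class S V (word (Scalar (one S)))"
  by (simp add: tensor_alg_def quot_alg_def FactRing_def tensor_class_def free_one)

lemma tensor_alg_add:
  "add (tensor_alg S V) (tensor_class S V f) (tensor_class S V g) = tensor_class S V (f + g)"
proof -
  have "add (tensor_alg S V) (tensor_class S V f) (tensor_class S V g) =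
      {x + y | x y. x \<in> tensor_class S V f \<and> y \<in> tensor_class S V g}"
    by (auto simp: tensor_alg_def quot_alg_def FactRing_def set_add_def set_mult_def)
  also have "\<dots> = tensor_class S V (f + g)"
  proof (rule Set.set_eqI)
    fix h
    have "\<exists>x y. h = x + y \<and> tcong S V x f \<and> tcong S V y g" if "tcong S V h (f + g)"
      using that by (intro exI[of _ "h - g"] exI[of _ g]) (simp add: tcong_def algebra_simps)
    then show "h \<in> {x + y | x y. x \<in> tensor_class S V f \<and> y \<in> tensor_class S V g} \<longleftrightarrow>
        h \<in> tensor_class S V (f + g)"
      by (auto simp: mem_tensor_class tcong_add)
  qed
  finally show ?thesis .
qed

lemma tensor_alg_smult:
  "smult (tensor_alg S V) c (tensor_class S V f) = tensor_class S V (free_scale c f)"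
proof -
  have "smult (tensor_alg S V) c (tensor_class S V f) =
      (\<Union>x\<in>tensor_class S V f. tensor_class S V (free_scale c x))"
    by (simp add: tensor_alg_def quot_alg_def tensor_class_def)
  also have "\<dots> = (\<Union>x\<in>tensor_class S V f. tensor_class S V (free_scale c f))"
    by (intro SUP_cong refl) (simp add: tensor_class_eq_iff mem_tensor_class tcong_scale)
  finally show ?thesis
    using tensor_class_self[of f S V] by auto
qed

context complex_bimodule
begin

text \<open>\<open>rcoset_mult\<close> is a union over all pairs of representatives; by
  \<open>tcong_mult\<close> every coset in that union is the same.\<close>

lemma tensor_alg_mult:
  assumes "f \<in> fcarrier S V" "g \<in> fcarrier S V"
  shows "mult (tensor_alg S V) (tensor_class S V f) (tensor_class S V g) =
    tensor_class S V (fmult S V f g)"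
proof -
  have "mult (tensor_alg S V) (tensor_class S V f) (tensor_class S V g) =
      (\<Union>x\<in>tensor_class S V f. \<Union>y\<in>tensor_class S V g. tensor_class S V (fmult S V x y))"
    by (simp add: tensor_alg_def quot_alg_def FactRing_def rcoset_mult_def tensor_class_def)
  also have "\<dots> = (\<Union>x\<in>tensor_class S V f. \<Union>y\<in>tensor_class S V g. tensor_class S V (fmult S V f g))"
    using assms
    by (intro SUP_cong refl)
      (auto simp: tensor_class_eq_iff mem_tensor_class intro!: tcong_mult intro: tcong_fcarrier)
  finally show ?thesis
    using tensor_class_self[of f S V] tensor_class_self[of g S V] by auto
qed

lemma tensor_alg_cases:
  assumes "x \<in> carrier (tensor_alg S V)"
  obtains f where "f \<in> fcarrier S V" "x = tensor_class S V f"
  using assms by (auto simp: tensor_alg_carrier)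

lemma tensor_alg_complex_alg: "complex_alg (tensor_alg S V)"
proof -
  let ?T = "tensor_alg S V"
  have ab: "abelian_group ?T"
  proof (rule abelian_groupI)
    show "\<exists>y\<in>carrier ?T. y \<oplus>\<^bsub>?T\<^esub> x = \<zero>\<^bsub>?T\<^esub>" if x: "x \<in> carrier ?T" for x
    proof -
      obtain f where "f \<in> fcarrier S V" "x = tensor_class S V f"
        using x by (rule tensor_alg_cases)
      then show ?thesis
        by (intro bexI[of _ "tensor_class S V (0 - f)"])
          (simp_all add: tensor_alg_add tensor_alg_zero del: diff_0)
    qed
  qed (auto simp: tensor_alg_carrier tensor_alg_add tensor_alg_zero algebra_simps)
  have "Group.monoid ?T"
    by (rule monoidI; (elim tensor_alg_cases)?; simp add: tensor_alg_mult tensor_alg_one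
        fmult_one_left fmult_one_right fmult_assoc tensor_class_eq_iff)
  then have "ring ?T"
    using ab by (intro ringI) (auto simp: tensor_alg_carrier tensor_alg_mult tensor_alg_add)
  moreover have "Module.module complex_ring ?T"
    by (rule moduleI[OF cring_complex_ring ab])
      (auto simp: tensor_alg_carrier tensor_alg_smult tensor_alg_add free.scale_left_distrib
        free.scale_right_distrib)
  moreover have "complex_alg_axioms ?T"
    by unfold_locales (auto simp: tensor_alg_carrier tensor_alg_smult tensor_alg_mult)
  ultimately show ?thesis
    by (simp add: complex_alg_def)
qed

lemma tensor_scalar_closed [simp]: "s \<in> carrier S \<Longrightarrow> tensor_scalar S V s \<in> carrier (tensor_alg S V)"
  by (simp add: tensor_scalar_def)

lemma tensor_scalar_mult: "s \<in> carrier S \<Longrightarrow> t \<in> carrier S \<Longrightarrow>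
    tensor_scalar S V s \<otimes>\<^bsub>tensor_alg S V\<^esub> tensor_scalar S V t = tensor_scalar S V (s \<otimes>\<^bsub>S\<^esub> t)"
  by (simp add: tensor_scalar_def tensor_alg_mult)

end

section \<open>Corners\<close>

lemma corner_simps [simp]:
  "mult (corner A e) = mult A" "one (corner A e) = e" "zero (corner A e) = zero A"
  "add (corner A e) = add A" "smult (corner A e) = smult A"
  by (simp_all add: corner_def)

lemma corner_bimod_simps [simp]:
  "mult (corner_bimod V e) = mult V" "one (corner_bimod V e) = one V"
  "zero (corner_bimod V e) = zero V"
  "add (corner_bimod V e) = add V" "smult (corner_bimod V e) = smult V"
  "lact (corner_bimod V e) = lact V" "ract (corner_bimod V e) = ract V"
  by (simp_all add: corner_bimod_def)

section \<open>Finite sums under additive maps, and corners of algebras and bimodules\<close>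

lemma (in abelian_group) add_eq_zeroD: "x \<in> carrier G \<Longrightarrow> x \<oplus> x = x \<Longrightarrow> x = \<zero>"
  using add.l_cancel_one' by auto

lemma additive_zero:
  assumes "abelian_group G" "abelian_group K"
    and "\<And>x. x \<in> carrier G \<Longrightarrow> f x \<in> carrier K"
    and "\<And>x y. x \<in> carrier G \<Longrightarrow> y \<in> carrier G \<Longrightarrow> f (x \<oplus>\<^bsub>G\<^esub> y) = f x \<oplus>\<^bsub>K\<^esub> f y"
  shows "f \<zero>\<^bsub>G\<^esub> = \<zero>\<^bsub>K\<^esub>"
  using assms(3)[of "\<zero>\<^bsub>G\<^esub>"] assms(4)[of "\<zero>\<^bsub>G\<^esub>" "\<zero>\<^bsub>G\<^esub>"] abelian_groupE(2,5)[OF assms(1)]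
  by (intro abelian_group.add_eq_zeroD[OF assms(2)]) auto

text \<open>Pushes the decomposition of 1 through products and actions. For infinite
  \<open>I\<close> both sides are zero by convention.\<close>

lemma finsum_additive:
  assumes "abelian_group G" "abelian_group H"
    and "\<And>x. x \<in> carrier G \<Longrightarrow> f x \<in> carrier H"
    and "\<And>x y. x \<in> carrier G \<Longrightarrow> y \<in> carrier G \<Longrightarrow> f (x \<oplus>\<^bsub>G\<^esub> y) = f x \<oplus>\<^bsub>H\<^esub> f y"
    and "\<And>i. i \<in> I \<Longrightarrow> g i \<in> carrier G"
  shows "f (finsum G g I) = finsum H (\<lambda>i. f (g i)) I"
proof -
  interpret G: abelian_group G by fact
  interpret H: abelian_group H by fact
  note z = additive_zero[OF assms(1-4)]
  show ?thesis
    using assms(5)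
  proof (induction I rule: infinite_finite_induct)
    case (insert i I)
    then have "g \<in> I \<rightarrow> carrier G" "(\<lambda>i. f (g i)) \<in> I \<rightarrow> carrier H"
      using assms(3) by auto
    with insert show ?case
      using assms(3,4) by (simp add: G.finsum_insert H.finsum_insert G.finsum_closed)
  qed (simp_all add: z G.finsum_infinite H.finsum_infinite)
qed

text \<open>The variant for maps that are additive only modulo the relations, such as
  \<open>v |-> word (Tensor [v])\<close>.\<close>

lemma tcong_finsum:
  assumes "abelian_group G"
    and "\<And>x y. x \<in> carrier G \<Longrightarrow> y \<in> carrier G \<Longrightarrow> tcong S V (f (x \<oplus>\<^bsub>G\<^esub> y)) (f x + f y)"
    and "\<And>i. i \<in> I \<Longrightarrow> g i \<in> carrier G"
  shows "tcong S V (f (finsum G g I)) (\<Sum>i\<in>I. f (g i))"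
proof -
  interpret G: abelian_group G by fact
  \<comment> \<open>Congruence of \<open>f(0)\<close> with \<open>f(0) + f(0)\<close> leaves
    \<open>- f(0)\<close> in the null space.\<close>
  have z: "tcong S V (f \<zero>\<^bsub>G\<^esub>) 0"
    using assms(2)[of "\<zero>\<^bsub>G\<^esub>" "\<zero>\<^bsub>G\<^esub>"] null_uminus[of "- f \<zero>\<^bsub>G\<^esub>" S V]
    by (simp add: tcong_def)
  show ?thesis
    using assms(3)
  proof (induction I rule: infinite_finite_induct)
    case (insert i I)
    then have g: "g \<in> I \<rightarrow> carrier G"
      by auto
    have "tcong S V (f (finsum G g (insert i I))) (f (g i) + f (finsum G g I))"
      using insert g assms(2) by (simp add: G.finsum_insert G.finsum_closed)
    also have "tcong S V \<dots> (f (g i) + (\<Sum>i\<in>I. f (g i)))"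
      using insert by (intro tcong_add) auto
    finally show ?case
      using insert by simp
  qed (simp_all add: z G.finsum_infinite)
qed

context complex_alg
begin

lemma abelian_group_A: "abelian_group A"
  using ring_A by (rule ring.is_abelian_group)

lemma A_m_closed [simp]: "x \<in> carrier A \<Longrightarrow> y \<in> carrier A \<Longrightarrow> x \<otimes> y \<in> carrier A"
  and A_l_one [simp]: "x \<in> carrier A \<Longrightarrow> \<one> \<otimes> x = x"
  and A_r_one [simp]: "x \<in> carrier A \<Longrightarrow> x \<otimes> \<one> = x"
  and A_one_closed [simp]: "\<one> \<in> carrier A"
  using monoid.m_closed monoid.l_one monoid.r_one monoid.one_closed ring.is_monoid[OF ring_A] by metis+

end

text \<open>Since \<open>e\<close> is idempotent, \<open>e y e\<close> is fixed by \<open>e\<close>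
  on both sides. Describing the corner by these equations turns later closure proofs into
  computations.\<close>

lemma corner_carrier_iff:
  fixes A (structure)
  assumes "complex_alg A" and e: "e \<in> carrier A" "e \<otimes> e = e"
  shows "x \<in> carrier (corner A e) \<longleftrightarrow> x \<in> carrier A \<and> e \<otimes> x = x \<and> x \<otimes> e = x"
proof -
  interpret complex_alg A by fact
  show ?thesis
  proof
    assume "x \<in> carrier (corner A e)"
    then obtain y where y: "y \<in> carrier A" "x = e \<otimes> y \<otimes> e"
      by (auto simp: corner_def)
    have "e \<otimes> x = e \<otimes> e \<otimes> y \<otimes> e"
      using y e(1) by (simp flip: A_m_assoc)
    moreover have "x \<otimes> e = e \<otimes> y \<otimes> (e \<otimes> e)"
      using y e(1) by (simp add: A_m_assoc)
    ultimately
    show "x \<in> carrier A \<and> e \<otimes> x = x \<and> x \<otimes> e = x"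
      using y e by simp
  next
    assume "x \<in> carrier A \<and> e \<otimes> x = x \<and> x \<otimes> e = x"
    then show "x \<in> carrier (corner A e)"
      by (auto simp: corner_def intro!: exI[of _ x])
  qed
qed

lemma corner_mem:
  fixes A (structure)
  shows "x \<in> carrier A \<Longrightarrow> e \<otimes> x \<otimes> e \<in> carrier (corner A e)"
  by (auto simp: corner_def)

lemma corner_complex_alg:
  fixes A (structure)
  assumes A: "complex_alg A" and e: "e \<in> carrier A" "e \<otimes> e = e"
  shows "complex_alg (corner A e)"
proof -
  interpret complex_alg A by (rule A)
  note c = corner_carrier_iff[OF A e]
  have ab: "abelian_group (corner A e)"
  proof (rule abelian_groupI)
    show "\<exists>y\<in>carrier (corner A e). y \<oplus>\<^bsub>corner A e\<^esub> x = \<zero>\<^bsub>corner A e\<^esub>"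
      if "x \<in> carrier (corner A e)" for x
      using that e abelian_group.l_neg[OF abelian_group_A]
      by (intro bexI[of _ "\<ominus> x"])
        (auto simp: c ring.l_minus[OF ring_A] ring.r_minus[OF ring_A] abelian_group.a_inv_closed[OF abelian_group_A])
  qed (use e in \<open>auto simp: c A_l_distr A_r_distr abelian_groupE(1,2,3,5)[OF abelian_group_A]
      semiring.r_null[OF semiring_A] semiring.l_null[OF semiring_A]
      intro: abelian_groupE(4)[OF abelian_group_A]\<close>)
  have "Group.monoid (corner A e)"
  proof (rule monoidI)
    show "x \<otimes>\<^bsub>corner A e\<^esub> y \<in> carrier (corner A e)"
      if "x \<in> carrier (corner A e)" "y \<in> carrier (corner A e)" for x y
    proof -
      have "e \<otimes> (x \<otimes> y) = (e \<otimes> x) \<otimes> y" "(x \<otimes> y) \<otimes> e = x \<otimes> (y \<otimes> e)"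
        using that e(1) unfolding c by (metis A_m_assoc)+
      then show ?thesis using that by (simp add: c)
    qed
  qed (use e in \<open>auto simp: c A_m_assoc\<close>)
  then have "ring (corner A e)"
    using ab by (intro ringI) (auto simp: c A_l_distr A_r_distr)
  moreover have "Module.module complex_ring (corner A e)"
    by (rule moduleI[OF cring_complex_ring ab])
      (use e in \<open>auto simp: c smult_l_distr smult_r_distr smult_assoc1
        smult_mult_left[symmetric] smult_mult_right[symmetric] intro: smult_l_distr[simplified] smult_assoc1[simplified]
        smult_one[simplified]\<close>)
  moreover have "complex_alg_axioms (corner A e)"
    by unfold_locales (auto simp: c smult_mult_left[symmetric] smult_mult_right[symmetric])
  ultimately show ?thesis
    by (simp add: complex_alg_def)
qed

context complex_bimodule
begin

lemma abelian_group_V: "abelian_group V"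
  by unfold_locales

lemma corner_bimod_carrier_iff:
  assumes "e \<in> carrier S" "e \<otimes>\<^bsub>S\<^esub> e = e"
  shows "v \<in> carrier (corner_bimod V e) \<longleftrightarrow> v \<in> carrier V \<and> lact V e v = v \<and> ract V v e = v"
proof
  assume "v \<in> carrier (corner_bimod V e)"
  then obtain w where w: "w \<in> carrier V" "v = ract V (lact V e w) e"
    by (auto simp: corner_bimod_def)
  have "lact V e v = ract V (lact V (e \<otimes>\<^bsub>S\<^esub> e) w) e" "ract V v e = ract V (lact V e w) (e \<otimes>\<^bsub>S\<^esub> e)"
    using w assms(1) by (simp_all add: lact_ract lact_mult ract_mult)
  then show "v \<in> carrier V \<and> lact V e v = v \<and> ract V v e = v"
    using w assms by simp
next
  assume "v \<in> carrier V \<and> lact V e v = v \<and> ract V v e = v"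
  then show "v \<in> carrier (corner_bimod V e)"
    by (auto simp: corner_bimod_def intro!: exI[of _ v])
qed

lemma corner_complex_bimodule:
  assumes e: "e \<in> carrier S" "e \<otimes>\<^bsub>S\<^esub> e = e"
  shows "complex_bimodule (corner S e) (corner_bimod V e)"
proof -
  note c = corner_carrier_iff[OF S.complex_alg_axioms e] corner_bimod_carrier_iff[OF e]
  have ab: "abelian_group (corner_bimod V e)"
  proof (rule abelian_groupI)
    show "\<exists>y\<in>carrier (corner_bimod V e). y \<oplus>\<^bsub>corner_bimod V e\<^esub> x = \<zero>\<^bsub>corner_bimod V e\<^esub>"
      if "x \<in> carrier (corner_bimod V e)" for x
    \<comment> \<open>The negative is written as a scalar multiple because scalars are known to
      commute with both actions, which keeps it in \<open>eVe\<close>.\<close>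
    proof (rule bexI[of _ "(- 1) \<odot>\<^bsub>V\<^esub> x"])
      show "(- 1) \<odot>\<^bsub>V\<^esub> x \<in> carrier (corner_bimod V e)"
        using that e by (simp add: c lact_smult_right ract_smult_left)
      have "(- 1 + 1) \<odot>\<^bsub>V\<^esub> x = (- 1) \<odot>\<^bsub>V\<^esub> x \<oplus>\<^bsub>V\<^esub> 1 \<odot>\<^bsub>V\<^esub> x"
        using that V.smult_l_distr[of "-1" 1 x] by (simp add: c)
      then show "(- 1) \<odot>\<^bsub>V\<^esub> x \<oplus>\<^bsub>corner_bimod V e\<^esub> x = \<zero>\<^bsub>corner_bimod V e\<^esub>"
        using that V.smult_one[of x] V.smult_l_null[of x] by (simp add: c)
    qed
    show "\<zero>\<^bsub>corner_bimod V e\<^esub> \<in> carrier (corner_bimod V e)"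
      using e lact_smult_right[of e "\<zero>\<^bsub>V\<^esub>" 0] ract_smult_left[of e "\<zero>\<^bsub>V\<^esub>" 0]
        V.smult_l_null[of "lact V e \<zero>\<^bsub>V\<^esub>"] V.smult_l_null[of "ract V \<zero>\<^bsub>V\<^esub> e"] V.smult_l_null[of "\<zero>\<^bsub>V\<^esub>"]
      by (simp add: c)
  qed (use e in \<open>auto simp: c lact_add ract_add abelian_groupE(1,2,3,5)[OF abelian_group_V]
      intro: abelian_groupE(4)[OF abelian_group_V]\<close>)
  have m: "Module.module complex_ring (corner_bimod V e)"
    by (rule moduleI[OF cring_complex_ring ab])
      (use e in \<open>auto simp: c lact_smult_right ract_smult_left
        intro: V.smult_l_distr[simplified] V.smult_r_distr[simplified] V.smult_assoc1[simplified]
        V.smult_one[simplified]\<close>)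
  have "complex_bimodule_axioms (corner S e) (corner_bimod V e)"
  proof (unfold_locales, goal_cases)
    case (1 s v)
    then have "lact V e (lact V s v) = lact V (e \<otimes>\<^bsub>S\<^esub> s) v" "ract V (lact V s v) e = lact V s (ract V v e)"
      using e(1) unfolding c by (metis lact_mult, metis lact_ract)
    with 1 show ?case by (simp add: c)
  next
    case (2 s v)
    then have "lact V e (ract V v s) = ract V (lact V e v) s" "ract V (ract V v s) e = ract V v (s \<otimes>\<^bsub>S\<^esub> e)"
      using e(1) unfolding c by (metis lact_ract, metis ract_mult)
    with 2 show ?case by (simp add: c)
  next
    \<comment> \<open>This case and the next are the axioms on complex scalars. The unit of the
      corner is \<open>e\<close>, and they hold because \<open>e\<close> acts on \<open>eVe\<close>
      as the identity.\<close>
    case (10 v a)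
    then have "lact V (a \<odot>\<^bsub>S\<^esub> e) v = a \<odot>\<^bsub>V\<^esub> lact V e v"
      using e by (simp add: c lact_smult_left)
    with 10 show ?case by (simp add: c)
  next
    case (11 v a)
    then have "ract V v (a \<odot>\<^bsub>S\<^esub> e) = a \<odot>\<^bsub>V\<^esub> ract V v e"
      using e by (simp add: c ract_smult_right)
    with 11 show ?case by (simp add: c)
  qed (auto simp: c lact_add_scalar ract_add_scalar lact_add ract_add lact_mult ract_mult lact_ract)
  then show ?thesis
    using m corner_complex_alg[OF S.complex_alg_axioms e] by (simp add: complex_bimodule_def)
qed

end

text \<open>Passing to the corner changes the carriers and the unit but no operation. Products of
  representatives over the corner and over \<open>S\<close> are therefore the same elements of the
  free space.\<close>

lemma word_mult_corner [simp]: "word_mult (corner S e) (corner_bimod V e) = word_mult S V"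
proof (intro ext)
  fix u w
  show "word_mult (corner S e) (corner_bimod V e) u w = word_mult S V u w"
    by (cases u; cases w) simp_all
qed

lemma fmult_corner [simp]: "fmult (corner S e) (corner_bimod V e) = fmult S V"
  by (simp add: free_tensor_alg_def)

section \<open>Tensor algebras of corners\<close>

locale full_corner = complex_bimodule S V
  for S :: "(complex, 's) module" and V :: "('s, 'v) bimodule" +
  fixes e :: 's and n :: nat and p q :: "nat \<Rightarrow> 's"
  assumes e_closed [simp]: "e \<in> carrier S" and e_idem [simp]: "e \<otimes>\<^bsub>S\<^esub> e = e"
    and p_closed [simp]: "p i \<in> carrier S" and q_closed [simp]: "q i \<in> carrier S"
    and full: "finsum S (\<lambda>i. p i \<otimes>\<^bsub>S\<^esub> e \<otimes>\<^bsub>S\<^esub> q i) {..<n} = \<one>\<^bsub>S\<^esub>"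
begin

abbreviation "S' \<equiv> corner S e"
abbreviation "V' \<equiv> corner_bimod V e"

sublocale C: complex_bimodule S' V'
  by (rule corner_complex_bimodule) simp_all

lemma S'_iff: "x \<in> carrier S' \<longleftrightarrow> x \<in> carrier S \<and> e \<otimes>\<^bsub>S\<^esub> x = x \<and> x \<otimes>\<^bsub>S\<^esub> e = x"
  by (rule corner_carrier_iff[OF S.complex_alg_axioms]) simp_all

lemma V'_iff: "v \<in> carrier V' \<longleftrightarrow> v \<in> carrier V \<and> lact V e v = v \<and> ract V v e = v"
  by (rule corner_bimod_carrier_iff) simp_all

lemma e_e_mult [simp]: "x \<in> carrier S \<Longrightarrow> e \<otimes>\<^bsub>S\<^esub> (e \<otimes>\<^bsub>S\<^esub> x) = e \<otimes>\<^bsub>S\<^esub> x"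
  by (simp flip: S.A_m_assoc)

lemma S'_S: "x \<in> carrier S' \<Longrightarrow> x \<in> carrier S" and V'_V: "v \<in> carrier V' \<Longrightarrow> v \<in> carrier V"
  by (simp_all add: S'_iff V'_iff)

lemma corner_words: "u \<in> tensor_words S' V' \<Longrightarrow> u \<in> tensor_words S V"
  using S'_S V'_V unfolding tensor_words_def by blast

lemma corner_fcarrier: "f \<in> fcarrier S' V' \<Longrightarrow> f \<in> fcarrier S V"
  using corner_words by (auto simp: fcarrier_def)

lemma corner_relations: "r \<in> tensor_relations S' V' \<Longrightarrow> r \<in> tensor_relations S V"
proof (induction rule: tensor_relations.induct)
  case (scalar_add s t)
  then show ?case using tensor_relations.scalar_add[of s S t V] by (simp add: S'_S)
next
  case (scalar_smult s c)
  then show ?case using tensor_relations.scalar_smult[of s S c V] by (simp add: S'_S)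
next
  case (tensor_add us v w ws)
  then show ?case using tensor_relations.tensor_add[of us V v w ws S] V'_V by auto
next
  case (tensor_smult us v ws c)
  then show ?case using tensor_relations.tensor_smult[of us V v ws c S] V'_V by auto
next
  case (tensor_balanced us v s w ws)
  then show ?case using tensor_relations.tensor_balanced[of us V v s S w ws] V'_V S'_S by auto
qed

lemma corner_null: "f \<in> tensor_null S' V' \<Longrightarrow> f \<in> tensor_null S V"
  using free.span_mono[of "tensor_relations S' V'" "tensor_relations S V"] corner_relations
  by (auto simp: tensor_null_span)

lemma corner_tcong: "tcong S' V' f g \<Longrightarrow> tcong S V f g"
  by (simp add: tcong_def corner_null)

lemmas C_mult = C.tcong_mult[simplified] and C_assoc = C.fmult_assoc[simplified]
  and C_closed = C.fmult_closed[simplified]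

section \<open>Cutting tensors into tensors over the corner\<close>

lemma finsum_expand_ract:
  assumes "v \<in> carrier V" "x \<in> carrier S"
  shows "ract V v x = finsum V (\<lambda>i. ract V (ract V v (p i \<otimes>\<^bsub>S\<^esub> e)) (e \<otimes>\<^bsub>S\<^esub> q i \<otimes>\<^bsub>S\<^esub> x)) {..<n}"
proof -
  \<comment> \<open>The middle \<open>e\<close> is split as \<open>e e\<close>, so that each summand
    is right multiplication by \<open>p i e\<close> followed by \<open>e q i x\<close>.\<close>
  have summand: "ract V v ((p i \<otimes>\<^bsub>S\<^esub> e \<otimes>\<^bsub>S\<^esub> q i) \<otimes>\<^bsub>S\<^esub> x) = ract V (ract V v (p i \<otimes>\<^bsub>S\<^esub> e)) (e \<otimes>\<^bsub>S\<^esub> q i \<otimes>\<^bsub>S\<^esub> x)" for i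
    using assms by (simp add: S.A_m_assoc flip: ract_mult)
  have "ract V v x = ract V v (finsum S (\<lambda>i. p i \<otimes>\<^bsub>S\<^esub> e \<otimes>\<^bsub>S\<^esub> q i) {..<n} \<otimes>\<^bsub>S\<^esub> x)"
    using assms by (simp add: full)
  also have "\<dots> = finsum V (\<lambda>i. ract V v ((p i \<otimes>\<^bsub>S\<^esub> e \<otimes>\<^bsub>S\<^esub> q i) \<otimes>\<^bsub>S\<^esub> x)) {..<n}"
    using assms
    by (intro finsum_additive[where f = "\<lambda>y. ract V v (y \<otimes>\<^bsub>S\<^esub> x)" and G = S and H = V])
      (auto simp: S.A_l_distr ract_add_scalar S.abelian_group_A abelian_group_V)
  finally show ?thesis
    by (simp add: summand)
qed

text \<open>
  \<open>cut a vs\<close> represents \<open>e a v\<^sub>1 \<otimes> \<dots> \<otimes> v\<^sub>m e\<close> by tensors over the corner: between any two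
  consecutive factors \<open>1 = \<Sum> p\<^sub>i e q\<^sub>i\<close> is inserted.
\<close>

fun cut :: "'s \<Rightarrow> 'v list \<Rightarrow> ('s, 'v) free_tensor" where
  "cut a [] = 0"
| "cut a [v] = word (Tensor [ract V (lact V (e \<otimes>\<^bsub>S\<^esub> a) v) e])"
| "cut a (v # w # vs) = (\<Sum>i<n. fmult S V
     (word (Tensor [ract V (lact V (e \<otimes>\<^bsub>S\<^esub> a) v) (p i \<otimes>\<^bsub>S\<^esub> e)])) (cut (q i) (w # vs)))"

fun cut_word :: "('s, 'v) tensor_word \<Rightarrow> ('s, 'v) free_tensor" where
  "cut_word (Scalar s) = word (Scalar (e \<otimes>\<^bsub>S\<^esub> s \<otimes>\<^bsub>S\<^esub> e))"
| "cut_word (Tensor vs) = cut e vs"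

lemma cut_Cons:
  "vs \<noteq> [] \<Longrightarrow> cut a (v # vs) = (\<Sum>i<n. fmult S V
     (word (Tensor [ract V (lact V (e \<otimes>\<^bsub>S\<^esub> a) v) (p i \<otimes>\<^bsub>S\<^esub> e)])) (cut (q i) vs))"
  by (cases vs) auto

lemma e_act [simp]: "v \<in> carrier V \<Longrightarrow> lact V e (lact V e v) = lact V e v"
  "v \<in> carrier V \<Longrightarrow> ract V (ract V v e) e = ract V v e"
  by (simp_all flip: lact_mult ract_mult)

lemma compress_closed [simp]:
  assumes "a \<in> carrier S" "b \<in> carrier S" "v \<in> carrier V"
  shows "ract V (lact V (e \<otimes>\<^bsub>S\<^esub> a) v) (b \<otimes>\<^bsub>S\<^esub> e) \<in> carrier V'"
    "ract V (lact V (e \<otimes>\<^bsub>S\<^esub> a) v) e \<in> carrier V'"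
  using assms by (auto simp: V'_iff ract_mult lact_mult lact_ract)

lemma cut_closed:
  assumes "a \<in> carrier S" "set vs \<subseteq> carrier V"
  shows "cut a vs \<in> fcarrier S' V'"
  using assms
  by (induction a vs rule: cut.induct) (auto intro!: fcarrier_sum C_closed)

text \<open>A scalar in front of the first factor merges with the coefficient. The balancing proof
  uses this to trade \<open>s w\<close> for a change of coefficient.\<close>

lemma cut_lact: "a \<in> carrier S \<Longrightarrow> s \<in> carrier S \<Longrightarrow> v \<in> carrier V \<Longrightarrow>
    cut a (lact V s v # vs) = cut (a \<otimes>\<^bsub>S\<^esub> s) (v # vs)"
  by (cases vs) (auto simp: S.A_m_assoc simp flip: lact_mult)

lemma cut_e: "a \<in> carrier S \<Longrightarrow> cut (e \<otimes>\<^bsub>S\<^esub> a) vs = cut a vs"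
  by (cases vs rule: remdups_adj.cases) auto

lemma tcong_single_add:
  "v \<in> carrier V' \<Longrightarrow> w \<in> carrier V' \<Longrightarrow>
    tcong S' V' (word (Tensor [v \<oplus>\<^bsub>V\<^esub> w])) (word (Tensor [v]) + word (Tensor [w]))"
  using C.relation_Tensor_add[of "[]" v w "[]"] by (simp add: tcong_def)

text \<open>Shared by additivity in the coefficient and in the first factor: in both cases only the
  head varies, while the tails \<open>cut (q i) vs\<close> stay fixed.\<close>

lemma cut_head_additive:
  assumes f: "\<And>b. b \<in> carrier S \<Longrightarrow> tcong S' V' (word (Tensor [ract V x (b \<otimes>\<^bsub>S\<^esub> e)]))
      (word (Tensor [ract V y (b \<otimes>\<^bsub>S\<^esub> e)]) + word (Tensor [ract V z (b \<otimes>\<^bsub>S\<^esub> e)]))"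
    and "\<And>b. b \<in> carrier S \<Longrightarrow> ract V y (b \<otimes>\<^bsub>S\<^esub> e) \<in> carrier V'"
    and "\<And>b. b \<in> carrier S \<Longrightarrow> ract V z (b \<otimes>\<^bsub>S\<^esub> e) \<in> carrier V'"
    and "set vs \<subseteq> carrier V"
  shows "tcong S' V' (\<Sum>i<n. fmult S V (word (Tensor [ract V x (p i \<otimes>\<^bsub>S\<^esub> e)])) (cut (q i) vs))
    ((\<Sum>i<n. fmult S V (word (Tensor [ract V y (p i \<otimes>\<^bsub>S\<^esub> e)])) (cut (q i) vs)) +
     (\<Sum>i<n. fmult S V (word (Tensor [ract V z (p i \<otimes>\<^bsub>S\<^esub> e)])) (cut (q i) vs)))"
proof -
  have "tcong S' V' (fmult S V (word (Tensor [ract V x (p i \<otimes>\<^bsub>S\<^esub> e)])) (cut (q i) vs))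
     (fmult S V (word (Tensor [ract V y (p i \<otimes>\<^bsub>S\<^esub> e)]) + word (Tensor [ract V z (p i \<otimes>\<^bsub>S\<^esub> e)])) (cut (q i) vs))" for i
    using assms by (intro C_mult) (auto simp: cut_closed)
  then show ?thesis
    unfolding sum.distrib[symmetric] fmult_add_left[symmetric] by (intro tcong_sum)
qed

lemma cut_add_left:
  assumes "a \<in> carrier S" "b \<in> carrier S" "v \<in> carrier V" "set vs \<subseteq> carrier V"
  shows "tcong S' V' (cut (a \<oplus>\<^bsub>S\<^esub> b) (v # vs)) (cut a (v # vs) + cut b (v # vs))"
proof (cases "vs = []")
  case True
  then show ?thesis
    using assms by (auto simp: S.A_r_distr lact_add_scalar ract_add tcong_single_add)
next
  case False
  show ?thesis
    unfolding cut_Cons[OF False]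
    using assms by (intro cut_head_additive)
      (auto simp: S.A_r_distr lact_add_scalar ract_add tcong_single_add)
qed

text \<open>As \<open>r e = r = e r\<close>, both \<open>r (e a)\<close> and \<open>e (r a)\<close>
  equal \<open>r a\<close>, so an element of the corner is absorbed by the coefficient.\<close>

lemma Scalar_mult_cut:
  assumes "r \<in> carrier S'" "a \<in> carrier S" "v \<in> carrier V" "set vs \<subseteq> carrier V"
  shows "tcong S' V' (fmult S V (word (Scalar r)) (cut a (v # vs))) (cut (r \<otimes>\<^bsub>S\<^esub> a) (v # vs))"
proof -
  have r: "r \<in> carrier S" "e \<otimes>\<^bsub>S\<^esub> r = r" "r \<otimes>\<^bsub>S\<^esub> e = r"
    using assms by (auto simp: S'_iff)
  have "r \<otimes>\<^bsub>S\<^esub> (e \<otimes>\<^bsub>S\<^esub> a) = e \<otimes>\<^bsub>S\<^esub> (r \<otimes>\<^bsub>S\<^esub> a)"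
    using r assms by (simp flip: S.A_m_assoc)
  then have *: "lact V r (ract V (lact V (e \<otimes>\<^bsub>S\<^esub> a) v) b) = ract V (lact V (e \<otimes>\<^bsub>S\<^esub> (r \<otimes>\<^bsub>S\<^esub> a)) v) b"
    if "b \<in> carrier S" for b
    using assms r that by (simp flip: lact_ract lact_mult)
  show ?thesis
  proof (cases "vs = []")
    case True
    then show ?thesis using * by simp
  next
    case False
    let ?x = "\<lambda>i. word (Tensor [ract V (lact V (e \<otimes>\<^bsub>S\<^esub> a) v) (p i \<otimes>\<^bsub>S\<^esub> e)])"
    have "tcong S' V' (\<Sum>i<n. fmult S V (word (Scalar r)) (fmult S V (?x i) (cut (q i) vs)))
       (\<Sum>i<n. fmult S V (fmult S V (word (Scalar r)) (?x i)) (cut (q i) vs))"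
      using assms by (intro tcong_sum tcong_sym[OF C_assoc]) (auto simp: cut_closed)
    then show ?thesis
      unfolding cut_Cons[OF False] fmult_sum_right using * by simp
  qed
qed

lemma S'_sandwich [simp]: "x \<in> carrier S \<Longrightarrow> e \<otimes>\<^bsub>S\<^esub> x \<otimes>\<^bsub>S\<^esub> e \<in> carrier S'"
  by (rule corner_mem)

lemma tcong_finsum_V':
  assumes "\<And>i. i \<in> I \<Longrightarrow> g i \<in> carrier V'"
  shows "tcong S' V' (word (Tensor [finsum V g I])) (\<Sum>i\<in>I. word (Tensor [g i]))"
proof -
  have "finsum V g I = finsum V' g I"
    using assms by (intro finsum_additive[where f = "\<lambda>x. x" and G = V' and H = V, symmetric])
      (auto simp: V'_iff abelian_group_V C.abelian_group_V)
  then show ?thesis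
    using tcong_finsum[OF C.abelian_group_V, of S' V' "\<lambda>x. word (Tensor [x])" I g] assms
    by (auto simp: tcong_single_add)
qed

text \<open>The scalar \<open>s\<close> need not lie in the corner and may not cross a tensor sign
  there. With \<open>x = e a v\<close>, inserting 1 to the left of \<open>s\<close> gives
  \<open>x s p_i e\<close> as the sum over \<open>m\<close> of
  \<open>(x p_m e)(e q_m s p_i e)\<close>. The second factors lie in \<open>eSe\<close>, so they
  cross and become coefficients of the tail. There the sum over \<open>i\<close> of
  \<open>(e q_m s p_i e) q_i\<close> collapses to \<open>e q_m s\<close>, which leaves
  \<open>s\<close> in front of \<open>w\<close>.\<close>

lemma cut_balanced_base:
  assumes a: "a \<in> carrier S" "v \<in> carrier V" "s \<in> carrier S" "w \<in> carrier V" "set ws \<subseteq> carrier V"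
  shows "tcong S' V' (cut a (ract V v s # w # ws)) (cut a (v # lact V s w # ws))"
proof -
  define x where "x = lact V (e \<otimes>\<^bsub>S\<^esub> a) v"
  have x: "x \<in> carrier V" using a by (simp add: x_def)
  define y where "y m = ract V x (p m \<otimes>\<^bsub>S\<^esub> e)" for m
  have y: "y m \<in> carrier V'" "y m \<in> carrier V" for m
    using a by (auto simp: y_def x_def)
  define r where "r m i = e \<otimes>\<^bsub>S\<^esub> (q m \<otimes>\<^bsub>S\<^esub> s \<otimes>\<^bsub>S\<^esub> p i) \<otimes>\<^bsub>S\<^esub> e" for m i
  have r: "r m i \<in> carrier S'" "r m i \<in> carrier S" for m i
    using a by (auto simp: r_def)
  have yr: "ract V (y m) (r m i) \<in> carrier V'" for m i
    using y r C.ract_closed[of "r m i" "y m"] by simp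
  have expand: "ract V (lact V (e \<otimes>\<^bsub>S\<^esub> a) (ract V v s)) (p i \<otimes>\<^bsub>S\<^esub> e) = finsum V (\<lambda>m. ract V (y m) (r m i)) {..<n}" for i
  proof -
    have "ract V (lact V (e \<otimes>\<^bsub>S\<^esub> a) (ract V v s)) (p i \<otimes>\<^bsub>S\<^esub> e) = ract V x (s \<otimes>\<^bsub>S\<^esub> (p i \<otimes>\<^bsub>S\<^esub> e))"
      using a by (simp add: x_def ract_mult lact_ract)
    also have "\<dots> = finsum V (\<lambda>m. ract V (ract V x (p m \<otimes>\<^bsub>S\<^esub> e)) (e \<otimes>\<^bsub>S\<^esub> q m \<otimes>\<^bsub>S\<^esub> (s \<otimes>\<^bsub>S\<^esub> (p i \<otimes>\<^bsub>S\<^esub> e)))) {..<n}"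
      using a x by (intro finsum_expand_ract) auto
    also have "(\<lambda>m. ract V (ract V x (p m \<otimes>\<^bsub>S\<^esub> e)) (e \<otimes>\<^bsub>S\<^esub> q m \<otimes>\<^bsub>S\<^esub> (s \<otimes>\<^bsub>S\<^esub> (p i \<otimes>\<^bsub>S\<^esub> e)))) = (\<lambda>m. ract V (y m) (r m i))"
      using a by (simp add: y_def r_def S.A_m_assoc)
    finally show ?thesis .
  qed
  let ?c = "\<lambda>i. cut (q i) (w # ws)"
  have c: "?c i \<in> fcarrier S' V'" for i
    using a by (intro cut_closed) auto
  have "cut a (ract V v s # w # ws) = (\<Sum>i<n. fmult S V (word (Tensor [finsum V (\<lambda>m. ract V (y m) (r m i)) {..<n}])) (?c i))"
    by (simp add: expand)
  also have "tcong S' V' \<dots> (\<Sum>i<n. fmult S V (\<Sum>m<n. word (Tensor [ract V (y m) (r m i)])) (?c i))"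
    using yr c by (intro tcong_sum C_mult tcong_finsum_V' tcong_refl fcarrier_sum) auto
  also have "\<dots> = (\<Sum>i<n. \<Sum>m<n. fmult S V (fmult S V (word (Tensor [y m])) (word (Scalar (r m i)))) (?c i))"
    by (simp add: fmult_sum_left)
  also have "tcong S' V' \<dots> (\<Sum>i<n. \<Sum>m<n. fmult S V (word (Tensor [y m])) (fmult S V (word (Scalar (r m i))) (?c i)))"
    using y r c by (intro tcong_sum C_assoc) auto
  also have "tcong S' V' \<dots> (\<Sum>i<n. \<Sum>m<n. fmult S V (word (Tensor [y m])) (cut (r m i \<otimes>\<^bsub>S\<^esub> q i) (w # ws)))"
    using y r c a by (intro tcong_sum C_mult Scalar_mult_cut tcong_refl C_closed) auto
  \<comment> \<open>The index \<open>i\<close> came from the tensor sign behind \<open>s\<close> and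
    is summed away first; \<open>m\<close>, from the insertion in front of \<open>s\<close>, takes
    over as the index of the cut.\<close>
  also have "\<dots> = (\<Sum>m<n. fmult S V (word (Tensor [y m])) (\<Sum>i<n. cut (r m i \<otimes>\<^bsub>S\<^esub> q i) (w # ws)))"
    by (subst sum.swap) (simp add: fmult_sum_right)
  also have "tcong S' V' \<dots> (\<Sum>m<n. fmult S V (word (Tensor [y m])) (cut (q m) (lact V s w # ws)))"
  proof (intro tcong_sum C_mult tcong_refl)
    fix m
    have "tcong S' V' (cut (finsum S (\<lambda>i. r m i \<otimes>\<^bsub>S\<^esub> q i) {..<n}) (w # ws)) (\<Sum>i<n. cut (r m i \<otimes>\<^bsub>S\<^esub> q i) (w # ws))"
      using a r by (intro tcong_finsum[OF S.abelian_group_A] cut_add_left) auto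
    moreover have "finsum S (\<lambda>i. r m i \<otimes>\<^bsub>S\<^esub> q i) {..<n} = e \<otimes>\<^bsub>S\<^esub> (q m \<otimes>\<^bsub>S\<^esub> s)"
    proof -
      have "e \<otimes>\<^bsub>S\<^esub> (q m \<otimes>\<^bsub>S\<^esub> s) = (e \<otimes>\<^bsub>S\<^esub> (q m \<otimes>\<^bsub>S\<^esub> s)) \<otimes>\<^bsub>S\<^esub> finsum S (\<lambda>i. p i \<otimes>\<^bsub>S\<^esub> e \<otimes>\<^bsub>S\<^esub> q i) {..<n}"
        using a by (simp add: full)
      also have "\<dots> = finsum S (\<lambda>i. (e \<otimes>\<^bsub>S\<^esub> (q m \<otimes>\<^bsub>S\<^esub> s)) \<otimes>\<^bsub>S\<^esub> (p i \<otimes>\<^bsub>S\<^esub> e \<otimes>\<^bsub>S\<^esub> q i)) {..<n}"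
        using a by (intro finsum_additive[where G = S and H = S] S.abelian_group_A) (auto simp: S.A_r_distr)
      also have "(\<lambda>i. (e \<otimes>\<^bsub>S\<^esub> (q m \<otimes>\<^bsub>S\<^esub> s)) \<otimes>\<^bsub>S\<^esub> (p i \<otimes>\<^bsub>S\<^esub> e \<otimes>\<^bsub>S\<^esub> q i)) = (\<lambda>i. r m i \<otimes>\<^bsub>S\<^esub> q i)"
        using a by (simp add: r_def S.A_m_assoc)
      finally show ?thesis by simp
    qed
    ultimately show "tcong S' V' (\<Sum>i<n. cut (r m i \<otimes>\<^bsub>S\<^esub> q i) (w # ws)) (cut (q m) (lact V s w # ws))"
      using a by (simp add: cut_e cut_lact tcong_sym)
  qed (use y r a in \<open>auto intro!: fcarrier_sum cut_closed\<close>)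
  finally show ?thesis
    by (simp add: y_def x_def)
qed

text \<open>Induction over the factors before the altered one. The coefficient is generalized,
  because behind a first factor the claim reappears with \<open>q i\<close> in its place.\<close>

lemma cut_add:
  assumes "a \<in> carrier S" "set us \<subseteq> carrier V" "v \<in> carrier V" "w \<in> carrier V" "set ws \<subseteq> carrier V"
  shows "tcong S' V' (cut a (us @ [v \<oplus>\<^bsub>V\<^esub> w] @ ws)) (cut a (us @ [v] @ ws) + cut a (us @ [w] @ ws))"
  using assms
proof (induction us arbitrary: a)
  case Nil
  show ?case
  proof (cases "ws = []")
    case True
    with Nil show ?thesis by (auto simp: lact_add ract_add tcong_single_add)
  next
    case False
    show ?thesis
      using Nil by (simp add: cut_Cons[OF False], intro cut_head_additive)
        (auto simp: lact_add ract_add tcong_single_add)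
  qed
next
  case (Cons u us)
  let ?x = "\<lambda>i. word (Tensor [ract V (lact V (e \<otimes>\<^bsub>S\<^esub> a) u) (p i \<otimes>\<^bsub>S\<^esub> e)])"
  have "tcong S' V' (\<Sum>i<n. fmult S V (?x i) (cut (q i) (us @ [v \<oplus>\<^bsub>V\<^esub> w] @ ws)))
    (\<Sum>i<n. fmult S V (?x i) (cut (q i) (us @ [v] @ ws) + cut (q i) (us @ [w] @ ws)))"
    using Cons by (intro tcong_sum C_mult tcong_refl Cons.IH) (auto intro!: cut_closed)
  then show ?case
    by (simp add: cut_Cons sum.distrib)
qed

lemma cut_smult:
  assumes "a \<in> carrier S" "set us \<subseteq> carrier V" "v \<in> carrier V" "set ws \<subseteq> carrier V"
  shows "tcong S' V' (cut a (us @ [c \<odot>\<^bsub>V\<^esub> v] @ ws)) (free_scale c (cut a (us @ [v] @ ws)))"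
  using assms
proof (induction us arbitrary: a)
  case Nil
  have 1: "tcong S' V' (word (Tensor [ract V (lact V (e \<otimes>\<^bsub>S\<^esub> a) (c \<odot>\<^bsub>V\<^esub> v)) b]))
      (free_scale c (word (Tensor [ract V (lact V (e \<otimes>\<^bsub>S\<^esub> a) v) b])))"
    if "b \<in> carrier S" "ract V (lact V (e \<otimes>\<^bsub>S\<^esub> a) v) b \<in> carrier V'" for b
    using that Nil C.relation_Tensor_smult[of "[]" "ract V (lact V (e \<otimes>\<^bsub>S\<^esub> a) v) b" "[]" _ c]
    by (simp add: tcong_def lact_smult_right ract_smult_left)
  show ?case
  proof (cases "ws = []")
    case True
    with Nil show ?thesis using 1[of e] by simp
  next
    case False
    let ?x = "\<lambda>v i. word (Tensor [ract V (lact V (e \<otimes>\<^bsub>S\<^esub> a) v) (p i \<otimes>\<^bsub>S\<^esub> e)])"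
    have "tcong S' V' (\<Sum>i<n. fmult S V (?x (c \<odot>\<^bsub>V\<^esub> v) i) (cut (q i) ws))
      (\<Sum>i<n. fmult S V (free_scale c (?x v i)) (cut (q i) ws))"
      using Nil by (intro tcong_sum C_mult tcong_refl 1) (auto intro!: cut_closed fcarrier_scale simp del: free_scale_single)
    then show ?thesis
      by (simp add: cut_Cons[OF False] free.scale_sum_right del: free_scale_single)
  qed
next
  case (Cons u us)
  let ?x = "\<lambda>i. word (Tensor [ract V (lact V (e \<otimes>\<^bsub>S\<^esub> a) u) (p i \<otimes>\<^bsub>S\<^esub> e)])"
  have "tcong S' V' (\<Sum>i<n. fmult S V (?x i) (cut (q i) (us @ [c \<odot>\<^bsub>V\<^esub> v] @ ws)))
    (\<Sum>i<n. fmult S V (?x i) (free_scale c (cut (q i) (us @ [v] @ ws))))"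
    using Cons by (intro tcong_sum C_mult tcong_refl Cons.IH) (auto intro!: cut_closed)
  then show ?case
    by (simp add: cut_Cons free.scale_sum_right)
qed

lemma cut_balanced:
  assumes "a \<in> carrier S" "set us \<subseteq> carrier V" "v \<in> carrier V" "s \<in> carrier S" "w \<in> carrier V" "set ws \<subseteq> carrier V"
  shows "tcong S' V' (cut a (us @ [ract V v s, w] @ ws)) (cut a (us @ [v, lact V s w] @ ws))"
  using assms
proof (induction us arbitrary: a)
  case Nil
  then show ?case using cut_balanced_base[of a v s w ws] by simp
next
  case (Cons u us)
  let ?x = "\<lambda>i. word (Tensor [ract V (lact V (e \<otimes>\<^bsub>S\<^esub> a) u) (p i \<otimes>\<^bsub>S\<^esub> e)])"
  have "tcong S' V' (\<Sum>i<n. fmult S V (?x i) (cut (q i) (us @ [ract V v s, w] @ ws)))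
    (\<Sum>i<n. fmult S V (?x i) (cut (q i) (us @ [v, lact V s w] @ ws)))"
    using Cons by (intro tcong_sum C_mult tcong_refl Cons.IH) (auto intro!: cut_closed)
  then show ?case
    by (simp add: cut_Cons)
qed

text \<open>Makes the cutting map well defined on classes. Cutting a word starts with coefficient
  \<open>e\<close>, so the tensor relations are the case \<open>a = e\<close> of the preceding
  lemmas.\<close>

lemma cut_relations:
  assumes "r \<in> tensor_relations S V"
  shows "lin cut_word r \<in> tensor_null S' V'"
  using assms
proof cases
  case (scalar_add s t)
  then show ?thesis
    using C.relation_Scalar_add[of "e \<otimes>\<^bsub>S\<^esub> s \<otimes>\<^bsub>S\<^esub> e" "e \<otimes>\<^bsub>S\<^esub> t \<otimes>\<^bsub>S\<^esub> e"]
    by (simp add: S.A_l_distr S.A_r_distr)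
next
  case (scalar_smult s c)
  then show ?thesis
    using C.relation_Scalar_smult[of "e \<otimes>\<^bsub>S\<^esub> s \<otimes>\<^bsub>S\<^esub> e" c]
    by (simp add: S.smult_mult_left[symmetric] S.smult_mult_right[symmetric] lin_single)
next
  case (tensor_add us v w ws)
  then show ?thesis
    using cut_add[of e us v w ws] by (simp add: tcong_def)
next
  case (tensor_smult us v ws c)
  then show ?thesis
    using cut_smult[of e us v ws c] by (simp add: tcong_def lin_single)
next
  case (tensor_balanced us v s w ws)
  then show ?thesis
    using cut_balanced[of e us v s w ws] by (simp add: tcong_def)
qed

lemma cut_null:
  "f \<in> tensor_null S V \<Longrightarrow> lin cut_word f \<in> tensor_null S' V'"
  by (rule lin_null[OF _ tensor_null_subspace]) (auto simp: cut_relations)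

lemma finsum_expand_e:
  assumes "v \<in> carrier V" "x \<in> carrier S"
  shows "finsum V (\<lambda>i. ract V (ract V v (p i \<otimes>\<^bsub>S\<^esub> e)) (e \<otimes>\<^bsub>S\<^esub> q i \<otimes>\<^bsub>S\<^esub> x)) {..<n} = ract V v x"
  using finsum_expand_ract[OF assms] by simp

text \<open>For factors from \<open>eVe\<close> the insertions can be undone inside the corner: by
  induction the tail contributes \<open>e q_i e\<close>, which lies in \<open>eSe\<close> and may
  cross back, and then the sum over \<open>i\<close> restores 1.\<close>

lemma cut_corner:
  assumes "a \<in> carrier S" "set vs \<subseteq> carrier V'" "vs \<noteq> []"
  shows "tcong S' V' (cut a vs) (fmult S V (word (Scalar (e \<otimes>\<^bsub>S\<^esub> a \<otimes>\<^bsub>S\<^esub> e))) (word (Tensor vs)))"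
  using assms
proof (induction vs arbitrary: a)
  case (Cons v vs)
  then have v: "v \<in> carrier V" "lact V e v = v" "ract V v e = v"
    by (auto simp: V'_iff)
  have "lact V (e \<otimes>\<^bsub>S\<^esub> a \<otimes>\<^bsub>S\<^esub> e) v = lact V (e \<otimes>\<^bsub>S\<^esub> a) v"
    using v Cons.prems by (simp add: lact_mult)
  moreover have "ract V (lact V (e \<otimes>\<^bsub>S\<^esub> a) v) e = lact V (e \<otimes>\<^bsub>S\<^esub> a) v"
    using v Cons.prems by (simp add: lact_ract)
  ultimately have ev: "lact V (e \<otimes>\<^bsub>S\<^esub> a \<otimes>\<^bsub>S\<^esub> e) v = ract V (lact V (e \<otimes>\<^bsub>S\<^esub> a) v) e"
    by simp
  show ?case
  proof (cases "vs = []")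
    case True
    then show ?thesis by (simp add: ev)
  next
    case False
    have vs: "word (Tensor vs) \<in> fcarrier S' V'"
      using Cons.prems False by simp
    define x where "x i = ract V (lact V (e \<otimes>\<^bsub>S\<^esub> a) v) (p i \<otimes>\<^bsub>S\<^esub> e)" for i
    have x: "x i \<in> carrier V'" for i
      using Cons.prems v by (simp add: x_def)
    have xr: "ract V (x i) (e \<otimes>\<^bsub>S\<^esub> q i \<otimes>\<^bsub>S\<^esub> e) \<in> carrier V'" for i
      using x C.ract_closed[of "e \<otimes>\<^bsub>S\<^esub> q i \<otimes>\<^bsub>S\<^esub> e" "x i"] by simp
    have "cut a (v # vs) = (\<Sum>i<n. fmult S V (word (Tensor [x i])) (cut (q i) vs))"
      by (simp add: cut_Cons[OF False] x_def)
    also have "tcong S' V' \<dots> (\<Sum>i<n. fmult S V (word (Tensor [x i]))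
        (fmult S V (word (Scalar (e \<otimes>\<^bsub>S\<^esub> q i \<otimes>\<^bsub>S\<^esub> e))) (word (Tensor vs))))"
      using Cons False x by (intro tcong_sum C_mult tcong_refl Cons.IH) (auto intro!: cut_closed simp: V'_V subset_iff)
    also have "tcong S' V' \<dots> (\<Sum>i<n. fmult S V (fmult S V (word (Tensor [x i]))
        (word (Scalar (e \<otimes>\<^bsub>S\<^esub> q i \<otimes>\<^bsub>S\<^esub> e)))) (word (Tensor vs)))"
      using vs x by (intro tcong_sum tcong_sym[OF C_assoc]) auto
    also have "\<dots> = fmult S V (\<Sum>i<n. word (Tensor [ract V (x i) (e \<otimes>\<^bsub>S\<^esub> q i \<otimes>\<^bsub>S\<^esub> e)])) (word (Tensor vs))"
      unfolding fmult_sum_left by simp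
    also have "tcong S' V' \<dots> (fmult S V (word (Tensor [finsum V (\<lambda>i. ract V (x i) (e \<otimes>\<^bsub>S\<^esub> q i \<otimes>\<^bsub>S\<^esub> e)) {..<n}])) (word (Tensor vs)))"
    proof (intro C_mult tcong_refl tcong_sym[OF tcong_finsum_V'])
      \<comment> \<open>Evaluating the sum shows that the collected factor lies in
        \<open>eVe\<close>, as congruence of products over the corner demands.\<close>
      have "finsum V (\<lambda>i. ract V (x i) (e \<otimes>\<^bsub>S\<^esub> q i \<otimes>\<^bsub>S\<^esub> e)) {..<n} = ract V (lact V (e \<otimes>\<^bsub>S\<^esub> a) v) e"
        unfolding x_def using v Cons.prems by (intro finsum_expand_e) auto
      then show "word (Tensor [finsum V (\<lambda>i. ract V (x i) (e \<otimes>\<^bsub>S\<^esub> q i \<otimes>\<^bsub>S\<^esub> e)) {..<n}]) \<in> fcarrier S' V'"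
        using v Cons.prems by simp
    qed (use vs xr in auto)
    also have "finsum V (\<lambda>i. ract V (x i) (e \<otimes>\<^bsub>S\<^esub> q i \<otimes>\<^bsub>S\<^esub> e)) {..<n} = lact V (e \<otimes>\<^bsub>S\<^esub> a \<otimes>\<^bsub>S\<^esub> e) v"
      unfolding x_def ev using v Cons.prems by (intro finsum_expand_e) auto
    also have "fmult S V (word (Tensor [lact V (e \<otimes>\<^bsub>S\<^esub> a \<otimes>\<^bsub>S\<^esub> e) v])) (word (Tensor vs)) =
        fmult S V (word (Scalar (e \<otimes>\<^bsub>S\<^esub> a \<otimes>\<^bsub>S\<^esub> e))) (word (Tensor (v # vs)))"
      by simp
    finally show ?thesis .
  qed
qed simp

lemma tcong_finsum_V:
  assumes "\<And>i. i \<in> I \<Longrightarrow> g i \<in> carrier V"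
  shows "tcong S V (word (Tensor [finsum V g I])) (\<Sum>i\<in>I. word (Tensor [g i]))"
  using assms relation_Tensor_add[of "[]" _ _ "[]"]
  by (intro tcong_finsum[OF abelian_group_V]) (auto simp: tcong_def)

text \<open>Over \<open>S\<close> the coefficient \<open>e q_i\<close> of the tail may cross as it
  stands, so every insertion collapses and only the outer \<open>e a\<close> and \<open>e\<close>
  remain.\<close>

lemma cut_whole:
  assumes "a \<in> carrier S" "set vs \<subseteq> carrier V" "vs \<noteq> []"
  shows "tcong S V (cut a vs)
    (fmult S V (word (Scalar (e \<otimes>\<^bsub>S\<^esub> a))) (fmult S V (word (Tensor vs)) (word (Scalar e))))"
  using assms
proof (induction vs arbitrary: a)
  case (Cons v vs)
  show ?case
  proof (cases "vs = []")
    case True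
    then show ?thesis using Cons.prems by (simp add: lact_ract)
  next
    case False
    then obtain us z where snoc: "vs = us @ [z]"
      by (cases vs rule: rev_cases) auto
    \<comment> \<open>The closing \<open>e\<close> stays attached to the tail, where the induction
      hypothesis produces it.\<close>
    define W where "W = fmult S V (word (Tensor vs)) (word (Scalar e))"
    have W: "W \<in> fcarrier S V"
      using Cons.prems False by (simp add: W_def del: fmult_word)
    define x where "x i = ract V (lact V (e \<otimes>\<^bsub>S\<^esub> a) v) (p i \<otimes>\<^bsub>S\<^esub> e)" for i
    have x: "x i \<in> carrier V" for i
      using Cons.prems by (simp add: x_def)
    have "cut a (v # vs) = (\<Sum>i<n. fmult S V (word (Tensor [x i])) (cut (q i) vs))"
      by (simp add: cut_Cons[OF False] x_def)
    also have "tcong S V \<dots> (\<Sum>i<n. fmult S V (word (Tensor [x i]))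
        (fmult S V (word (Scalar (e \<otimes>\<^bsub>S\<^esub> q i))) W))"
      unfolding W_def
      using Cons False x by (intro tcong_sum tcong_mult tcong_refl Cons.IH) (auto intro!: corner_fcarrier cut_closed)
    also have "tcong S V \<dots> (\<Sum>i<n. fmult S V (fmult S V (word (Tensor [x i]))
        (word (Scalar (e \<otimes>\<^bsub>S\<^esub> q i)))) W)"
      using W x by (intro tcong_sum tcong_sym[OF fmult_assoc]) auto
    also have "\<dots> = fmult S V (\<Sum>i<n. word (Tensor [ract V (x i) (e \<otimes>\<^bsub>S\<^esub> q i)])) W"
      unfolding fmult_sum_left by simp
    also have "tcong S V \<dots> (fmult S V (word (Tensor [finsum V (\<lambda>i. ract V (x i) (e \<otimes>\<^bsub>S\<^esub> q i)) {..<n}])) W)"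
      using W x Cons.prems
      by (intro tcong_mult tcong_refl tcong_sym[OF tcong_finsum_V])
        (auto intro!: abelian_monoid.finsum_closed abelian_group.axioms(1)[OF abelian_group_V])
    \<comment> \<open>The expansion is used with \<open>x = 1\<close>: the closing \<open>e\<close>
      sits in \<open>W\<close>, so nothing else multiplies this factor from the right.\<close>
    also have "finsum V (\<lambda>i. ract V (x i) (e \<otimes>\<^bsub>S\<^esub> q i)) {..<n} = lact V (e \<otimes>\<^bsub>S\<^esub> a) v"
      using finsum_expand_e[of "lact V (e \<otimes>\<^bsub>S\<^esub> a) v" "\<one>\<^bsub>S\<^esub>"] Cons.prems by (simp add: x_def)
    also have "fmult S V (word (Tensor [lact V (e \<otimes>\<^bsub>S\<^esub> a) v])) W =
        fmult S V (word (Scalar (e \<otimes>\<^bsub>S\<^esub> a))) (fmult S V (word (Tensor (v # vs))) (word (Scalar e)))"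
      by (simp add: W_def snoc)
    finally show ?thesis .
  qed
qed simp

lemma cut_word_closed: "u \<in> tensor_words S V \<Longrightarrow> cut_word u \<in> fcarrier S' V'"
  by (cases rule: tensor_words_cases) (use cut_closed[OF e_closed] in auto)

lemma lin_cut_closed: "f \<in> fcarrier S V \<Longrightarrow> lin cut_word f \<in> fcarrier S' V'"
  by (rule fcarrier_lin[OF _ cut_word_closed])

text \<open>The initial coefficient \<open>e\<close> acts as the identity on corner words. Cutting
  is thus a left inverse of \<open>corner_map\<close>, the source of its injectivity.\<close>

lemma lin_cut_corner:
  assumes "f \<in> fcarrier S' V'" shows "tcong S' V' (lin cut_word f) f"
proof -
  have "f \<in> {f. lin cut_word f - f \<in> tensor_null S' V'}"
    using assms
  proof (rule fcarrier_induct)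
    show "free.subspace {f. lin cut_word f - f \<in> tensor_null S' V'}"
    proof (rule free.subspaceI)
      show "f + g \<in> {f. lin cut_word f - f \<in> tensor_null S' V'}"
        if "f \<in> {f. lin cut_word f - f \<in> tensor_null S' V'}" "g \<in> {f. lin cut_word f - f \<in> tensor_null S' V'}" for f g
        using that null_add[of "lin cut_word f - f" S' V' "lin cut_word g - g"] by (simp add: algebra_simps)
      show "free_scale c f \<in> {f. lin cut_word f - f \<in> tensor_null S' V'}"
        if "f \<in> {f. lin cut_word f - f \<in> tensor_null S' V'}" for c f
        using that null_scale[of "lin cut_word f - f" S' V' c] by (simp add: free.scale_right_diff_distrib)
    qed simp
    show "word u \<in> {f. lin cut_word f - f \<in> tensor_null S' V'}" if u: "u \<in> tensor_words S' V'" for u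
      using u
    proof (cases rule: C.tensor_words_cases)
      case (1 s)
      then show ?thesis by (simp add: S'_iff)
    next
      case (2 v vs)
      then show ?thesis
        using cut_corner[of e "v # vs"] by (simp add: tcong_def V'_iff)
    qed
  qed
  then show ?thesis by (simp add: tcong_def)
qed

text \<open>Cutting and then including into \<open>T\<close> is compression by \<open>e\<close>,
  hence the identity on \<open>eTe\<close>; this is the source of surjectivity.\<close>

lemma lin_cut_whole:
  assumes "f \<in> fcarrier S V"
  shows "tcong S V (lin cut_word f) (fmult S V (word (Scalar e)) (fmult S V f (word (Scalar e))))"
proof -
  let ?D = "\<lambda>f. lin cut_word f - fmult S V (word (Scalar e)) (fmult S V f (word (Scalar e)))"
  have "f \<in> {f. ?D f \<in> tensor_null S V}"
    using assms
  proof (rule fcarrier_induct)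
    show "free.subspace {f. ?D f \<in> tensor_null S V}"
    proof (rule free.subspaceI)
      show "f + g \<in> {f. ?D f \<in> tensor_null S V}"
        if "f \<in> {f. ?D f \<in> tensor_null S V}" "g \<in> {f. ?D f \<in> tensor_null S V}" for f g
        using that null_add[of "?D f" S V "?D g"] by (simp add: algebra_simps)
      show "free_scale c f \<in> {f. ?D f \<in> tensor_null S V}"
        if "f \<in> {f. ?D f \<in> tensor_null S V}" for c f
        using that null_scale[of "?D f" S V c] by (simp add: free.scale_right_diff_distrib)
    qed simp
    show "word u \<in> {f. ?D f \<in> tensor_null S V}" if u: "u \<in> tensor_words S V" for u
      using u
    proof (cases rule: tensor_words_cases)
      case (1 s)
      then show ?thesis by (simp add: S.A_m_assoc)
    next
      case (2 v vs)
      then show ?thesis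
        using cut_whole[of e "v # vs"] by (simp add: tcong_def)
    qed
  qed
  then show ?thesis by (simp add: tcong_def)
qed

section \<open>The isomorphism of the tensor algebra of the corner with \<open>eTe\<close>\<close>

lemma corner_map_class: "corner_map S V (tensor_class S' V' f) = tensor_class S V f"
proof -
  have "corner_map S V (tensor_class S' V' f) = (\<Union>g\<in>tensor_class S' V' f. tensor_class S V f)"
    unfolding corner_map_def
    by (intro SUP_cong refl) (simp add: tensor_class_eq_iff mem_tensor_class corner_tcong)
  then show ?thesis
    using tensor_class_self[of f S' V'] by auto
qed

abbreviation "T \<equiv> tensor_alg S V"
abbreviation "T' \<equiv> tensor_alg S' V'"
abbreviation "\<epsilon> \<equiv> tensor_scalar S V e"

lemma T_alg: "complex_alg T"
  by (rule tensor_alg_complex_alg)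

lemma T'_alg: "complex_alg T'"
  by (rule C.tensor_alg_complex_alg)

lemma eps_idem [simp]: "\<epsilon> \<otimes>\<^bsub>T\<^esub> \<epsilon> = \<epsilon>"
  by (simp add: tensor_scalar_mult)

lemma eps_fmult:
  assumes "f \<in> fcarrier S' V'"
  shows "fmult S V (word (Scalar e)) f = f" "fmult S V f (word (Scalar e)) = f"
  using C.fmult_one_left[OF assms] C.fmult_one_right[OF assms] by simp_all

text \<open>Corner elements congruent over \<open>S\<close> become congruent over the corner after
  cutting, and cutting fixes them up to congruence: this gives injectivity. If
  \<open>x = e x e\<close>, the cut of a representative of \<open>x\<close> is a preimage.\<close>

lemma corner_map_iso: "corner_map S V \<in> alg_iso T' (corner T \<epsilon>)"
proof -
  note c = corner_carrier_iff[OF T_alg tensor_scalar_closed[OF e_closed] eps_idem]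
  have cl: "corner_map S V x \<in> carrier (corner T \<epsilon>)" if x: "x \<in> carrier T'" for x
  proof -
    obtain f where f: "f \<in> fcarrier S' V'" "x = tensor_class S' V' f"
      using x by (rule C.tensor_alg_cases)
    then show ?thesis
      unfolding c by (simp add: corner_map_class corner_fcarrier tensor_scalar_def tensor_alg_mult eps_fmult)
  qed
  have "corner_map S V \<in> ring_hom T' (corner T \<epsilon>)"
  proof (rule ring_hom_memI)
    fix x y assume x: "x \<in> carrier T'" and y: "y \<in> carrier T'"
    obtain f where f: "f \<in> fcarrier S' V'" "x = tensor_class S' V' f"
      using x by (rule C.tensor_alg_cases)
    obtain g where g: "g \<in> fcarrier S' V'" "y = tensor_class S' V' g"
      using y by (rule C.tensor_alg_cases)
    show "corner_map S V (x \<otimes>\<^bsub>T'\<^esub> y) = corner_map S V x \<otimes>\<^bsub>corner T \<epsilon>\<^esub> corner_map S V y"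
      using f g by (simp add: C.tensor_alg_mult tensor_alg_mult corner_map_class corner_fcarrier)
    show "corner_map S V (x \<oplus>\<^bsub>T'\<^esub> y) = corner_map S V x \<oplus>\<^bsub>corner T \<epsilon>\<^esub> corner_map S V y"
      using f g by (simp add: tensor_alg_add corner_map_class)
  qed (simp add: cl, simp add: tensor_alg_one corner_map_class, simp add: tensor_scalar_def)
  moreover have "inj_on (corner_map S V) (carrier T')"
  proof (rule inj_onI)
    fix x y assume x: "x \<in> carrier T'" and y: "y \<in> carrier T'" and eq: "corner_map S V x = corner_map S V y"
    obtain f where f: "f \<in> fcarrier S' V'" "x = tensor_class S' V' f"
      using x by (rule C.tensor_alg_cases)
    obtain g where g: "g \<in> fcarrier S' V'" "y = tensor_class S' V' g"
      using y by (rule C.tensor_alg_cases)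
    have "tcong S V f g"
      using eq f g by (simp add: corner_map_class tensor_class_eq_iff)
    then have "tcong S' V' (lin cut_word f) (lin cut_word g)"
      using cut_null[of "f - g"] by (simp add: tcong_def)
    then have "tcong S' V' f g"
      using tcong_trans[OF tcong_sym[OF lin_cut_corner[OF f(1)]]] tcong_trans[OF _ lin_cut_corner[OF g(1)]] by blast
    then show "x = y"
      using f g by (simp add: tensor_class_eq_iff)
  qed
  moreover have "carrier (corner T \<epsilon>) \<subseteq> corner_map S V ` carrier T'"
  proof
    fix x assume x: "x \<in> carrier (corner T \<epsilon>)"
    then have x': "x \<in> carrier T" "\<epsilon> \<otimes>\<^bsub>T\<^esub> (x \<otimes>\<^bsub>T\<^esub> \<epsilon>) = x"
      by (auto simp: c)
    obtain f where f: "f \<in> fcarrier S V" "x = tensor_class S V f"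
      using x'(1) by (rule tensor_alg_cases)
    have "tensor_class S V (fmult S V (word (Scalar e)) (fmult S V f (word (Scalar e)))) = x"
      using x' f by (simp add: tensor_scalar_def tensor_alg_mult)
    then have "x = corner_map S V (tensor_class S' V' (lin cut_word f))"
      using lin_cut_whole[OF f(1)] by (simp add: corner_map_class flip: tensor_class_eq_iff)
    then show "x \<in> corner_map S V ` carrier T'"
      using lin_cut_closed[OF f(1)] by simp
  qed
  moreover have "corner_map S V (a \<odot>\<^bsub>T'\<^esub> x) = a \<odot>\<^bsub>corner T \<epsilon>\<^esub> corner_map S V x" if "x \<in> carrier T'" for a x
    using that by (auto elim!: C.tensor_alg_cases simp: tensor_alg_smult corner_map_class)
  ultimately show ?thesis
    unfolding alg_iso_def ring_iso_def using cl by (auto simp: bij_betw_def)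
qed

end

section \<open>Traces and contraction\<close>

definition linear_form :: "(complex, 'a, 'z) module_scheme \<Rightarrow> ('a \<Rightarrow> complex) \<Rightarrow> bool" where
  "linear_form M f \<longleftrightarrow>
     (\<forall>x\<in>carrier M. \<forall>y\<in>carrier M. f (x \<oplus>\<^bsub>M\<^esub> y) = f x + f y) \<and>
     (\<forall>c. \<forall>x\<in>carrier M. f (c \<odot>\<^bsub>M\<^esub> x) = c * f x)"

lemma linear_form_add: "linear_form M f \<Longrightarrow> x \<in> carrier M \<Longrightarrow> y \<in> carrier M \<Longrightarrow> f (x \<oplus>\<^bsub>M\<^esub> y) = f x + f y"
  and linear_form_smult: "linear_form M f \<Longrightarrow> x \<in> carrier M \<Longrightarrow> f (c \<odot>\<^bsub>M\<^esub> x) = c * f x"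
  by (auto simp: linear_form_def)

lemma dual_space_iff: "\<phi> \<in> dual_space V \<longleftrightarrow> linear_form V \<phi>"
  by (auto simp: dual_space_def linear_form_def)

lemma linear_form_finsum:
  assumes "abelian_group M" "linear_form M f" "\<And>i. i \<in> I \<Longrightarrow> g i \<in> carrier M"
  shows "f (finsum M g I) = (\<Sum>i\<in>I. f (g i))"
proof -
  interpret M: abelian_group M by fact
  have z: "f \<zero>\<^bsub>M\<^esub> = 0"
    using linear_form_add[OF assms(2), of "\<zero>\<^bsub>M\<^esub>" "\<zero>\<^bsub>M\<^esub>"] by simp
  show ?thesis
    using assms(3)
  proof (induction I rule: infinite_finite_induct)
    case (insert i I)
    then have "g \<in> I \<rightarrow> carrier M"
      by auto
    with insert show ?case
      using linear_form_add[OF assms(2)] by (simp add: M.finsum_insert M.finsum_closed)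
  qed (simp_all add: z M.finsum_infinite)
qed

text \<open>If the forms indexed by the smaller set do not suffice, some \<open>z\<close> in their
  common kernel has \<open>f z\<close> nonzero, hence \<open>g j z\<close> nonzero. Subtracting the
  multiple of \<open>g j\<close> that agrees with \<open>f\<close> at \<open>z\<close> leaves a form
  to which the induction hypothesis applies.\<close>

lemma linear_form_dependence:
  assumes M: "Module.module complex_ring M" and "finite I"
    and "\<And>i. i \<in> I \<Longrightarrow> linear_form M (g i)" "linear_form M f"
    and "\<And>x. x \<in> carrier M \<Longrightarrow> \<forall>i\<in>I. g i x = 0 \<Longrightarrow> f x = 0"
  shows "\<exists>c. \<forall>x\<in>carrier M. f x = (\<Sum>i\<in>I. c i * g i x)"
  using assms(2-)
proof (induction I arbitrary: f)
  case empty
  then show ?case by simp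
next
  case (insert j I)
  have mc: "a \<odot>\<^bsub>M\<^esub> x \<in> carrier M" if "x \<in> carrier M" for a x
    using module.smult_closed[OF M, of a x] that by simp
  have pc: "x \<oplus>\<^bsub>M\<^esub> y \<in> carrier M" if "x \<in> carrier M" "y \<in> carrier M" for x y
    using abelian_groupE(1)[OF module.axioms(2)[OF M]] that .
  show ?case
  proof (cases "\<forall>x\<in>carrier M. (\<forall>i\<in>I. g i x = 0) \<longrightarrow> f x = 0")
    case True
    with insert.IH[of f] insert.prems(1,2) obtain c where c: "\<forall>x\<in>carrier M. f x = (\<Sum>i\<in>I. c i * g i x)"
      by blast
    have "f x = (\<Sum>i\<in>insert j I. (c(j := 0)) i * g i x)" if "x \<in> carrier M" for x
    proof -
      have "(\<Sum>i\<in>I. (c(j := 0)) i * g i x) = (\<Sum>i\<in>I. c i * g i x)"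
        using insert.hyps by (intro sum.cong) auto
      then show ?thesis
        using c that insert.hyps by simp
    qed
    then show ?thesis by blast
  next
    case False
    then obtain z where z: "z \<in> carrier M" "\<forall>i\<in>I. g i z = 0" "f z \<noteq> 0"
      by auto
    then have gz: "g j z \<noteq> 0"
      using insert.prems(3)[of z] by auto
    define f' where "f' x = f x - f z / g j z * g j x" for x
    have gj: "linear_form M (g j)" using insert.prems by simp
    have "linear_form M f'"
      using insert.prems(2) gj by (auto simp: linear_form_def f'_def algebra_simps)
    moreover have "f' x = 0" if x: "x \<in> carrier M" "\<forall>i\<in>I. g i x = 0" for x
    proof -
      \<comment> \<open>Shifting \<open>x\<close> along \<open>z\<close> into the kernel of
        \<open>g j\<close> keeps the zeros of the other \<open>g i\<close>, and it does not change
        \<open>f'\<close>, which vanishes at \<open>z\<close>.\<close>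
      let ?y = "x \<oplus>\<^bsub>M\<^esub> ((- g j x / g j z) \<odot>\<^bsub>M\<^esub> z)"
      have y: "h ?y = h x + (- g j x / g j z) * h z" if "linear_form M h" for h
        using that x z by (simp add: linear_form_add linear_form_smult mc)
      have "\<forall>i\<in>insert j I. g i ?y = 0"
        using y[OF insert.prems(1)] x z gz by auto
      then have "f ?y = 0"
        using x z insert.prems(3)[of ?y] mc pc by blast
      then show ?thesis
        using y[OF insert.prems(2)] by (simp add: f'_def)
    qed
    ultimately obtain c where c: "\<forall>x\<in>carrier M. f' x = (\<Sum>i\<in>I. c i * g i x)"
      using insert.IH[of f'] insert.prems(1) by auto
    have "f x = (\<Sum>i\<in>insert j I. (c(j := f z / g j z)) i * g i x)" if "x \<in> carrier M" for x
    proof -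
      have "(\<Sum>i\<in>I. (c(j := f z / g j z)) i * g i x) = (\<Sum>i\<in>I. c i * g i x)"
        using insert.hyps by (intro sum.cong) auto
      moreover have "f x = f' x + f z / g j z * g j x"
        by (simp add: f'_def)
      ultimately show ?thesis
        using c that insert.hyps by simp
    qed
    then show ?thesis by blast
  qed
qed

lemma trace_separates:
  fixes S (structure)
  assumes "complex_alg S" and tr: "nondegenerate_trace S Tr"
    and x: "x \<in> carrier S" and y: "y \<in> carrier S"
    and eq: "\<And>r. r \<in> carrier S \<Longrightarrow> Tr (x \<otimes> r) = Tr (y \<otimes> r)"
  shows "x = y"
proof -
  interpret S: complex_alg S by fact
  have Tr: "linear_form S Tr"
    using tr by (auto simp: nondegenerate_trace_def linear_form_def)
  note E = abelian_groupE[OF S.abelian_group_A]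
  let ?z = "x \<oplus> (- 1) \<odot> y"
  have z: "?z \<in> carrier S" using x y E(1) by simp
  have "Tr (?z \<otimes> r) = 0" if r: "r \<in> carrier S" for r
  proof -
    have "Tr (?z \<otimes> r) = Tr (x \<otimes> r) + (- 1) * Tr (y \<otimes> r)"
      using x y r by (simp add: S.A_l_distr linear_form_add[OF Tr] linear_form_smult[OF Tr] flip: S.smult_mult_left)
    then show ?thesis using eq[OF r] by simp
  qed
  then have "?z = \<zero>"
    using tr z by (auto simp: nondegenerate_trace_def)
  moreover have "?z \<oplus> y = x"
  proof -
    have "(- 1) \<odot> y \<oplus> y = (- 1 + 1) \<odot> y"
      using y S.smult_l_distr[of "-1" 1 y] S.smult_one[of y] by simp
    then have "(- 1) \<odot> y \<oplus> y = \<zero>"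
      using y S.smult_l_null[of y] by simp
    then show ?thesis
      using x y by (simp add: E(3) E(4)[of x \<zero>] E(2,5))
  qed
  ultimately show ?thesis
    using y E(5) by simp
qed

text \<open>Nondegeneracy makes \<open>r |-> Tr(r _)\<close> injective. Surjectivity is obtained
  without counting dimensions, by matching \<open>f\<close> on a finite spanning set one element at
  a time.\<close>

lemma trace_representation:
  fixes S (structure)
  assumes "complex_alg S" "finite_dim S" and tr: "nondegenerate_trace S Tr" and f: "linear_form S f"
  shows "\<exists>r\<in>carrier S. \<forall>s\<in>carrier S. Tr (r \<otimes> s) = f s"
proof -
  interpret S: complex_alg S by fact
  have mod: "Module.module complex_ring S" by unfold_locales
  have Tr: "linear_form S Tr"
    using tr by (auto simp: nondegenerate_trace_def linear_form_def)
  have Trl: "linear_form S (\<lambda>s. Tr (r \<otimes> s))" if "r \<in> carrier S" for r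
    using that linear_form_add[OF Tr] linear_form_smult[OF Tr]
    by (simp add: linear_form_def S.A_r_distr flip: S.smult_mult_right)
  have Trr: "linear_form S (\<lambda>s. Tr (s \<otimes> r))" if "r \<in> carrier S" for r
    using that linear_form_add[OF Tr] linear_form_smult[OF Tr]
    by (simp add: linear_form_def S.A_l_distr flip: S.smult_mult_left)
  have nondeg: "x = y" if xy: "x \<in> carrier S" "y \<in> carrier S"
    and eq: "\<And>r. r \<in> carrier S \<Longrightarrow> Tr (r \<otimes> x) = Tr (r \<otimes> y)" for x y
    using xy
  proof (rule trace_separates[OF assms(1) tr])
    show "Tr (x \<otimes> r) = Tr (y \<otimes> r)" if "r \<in> carrier S" for r
      using tr xy eq[OF that] that by (auto simp: nondegenerate_trace_def)
  qed
  obtain B where B: "finite B" "B \<subseteq> carrier S"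
      "\<And>x. x \<in> carrier S \<Longrightarrow> \<exists>c. x = finsum S (\<lambda>b. c b \<odot> b) B"
    using assms(2) unfolding finite_dim_def by blast
  have "\<exists>r\<in>carrier S. \<forall>b\<in>B. Tr (r \<otimes> b) = f b"
    using B(1,2)
  proof (induction B)
    case empty
    then show ?case using S.A_one_closed by auto
  next
    case (insert b B)
    then obtain r where r: "r \<in> carrier S" "\<forall>b\<in>B. Tr (r \<otimes> b) = f b"
      by auto
    have b: "b \<in> carrier S" using insert by simp
    show ?case
    \<comment> \<open>Either some \<open>x\<close> orthogonal to the earlier elements detects
      \<open>b\<close> and serves to correct \<open>r\<close> at \<open>b\<close>, or the form
      \<open>Tr(_ b)\<close> is a combination of the earlier forms \<open>Tr(_ i)\<close>. In the
      second case nondegeneracy makes \<open>b\<close> the same combination of the earlier elements,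
      and the value at \<open>b\<close> is already right.\<close>
    proof (cases "\<forall>x\<in>carrier S. (\<forall>i\<in>B. Tr (x \<otimes> i) = 0) \<longrightarrow> Tr (x \<otimes> b) = 0")
      case False
      then obtain x where x: "x \<in> carrier S" "\<forall>i\<in>B. Tr (x \<otimes> i) = 0" "Tr (x \<otimes> b) \<noteq> 0"
        by auto
      let ?r = "r \<oplus> ((f b - Tr (r \<otimes> b)) / Tr (x \<otimes> b)) \<odot> x"
      have *: "Tr (?r \<otimes> s) = Tr (r \<otimes> s) + (f b - Tr (r \<otimes> b)) / Tr (x \<otimes> b) * Tr (x \<otimes> s)"
        if s: "s \<in> carrier S" for s
        using r x linear_form_add[OF Trr[OF s], of r] linear_form_smult[OF Trr[OF s], of x] by simp
      have "?r \<in> carrier S"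
        using r x abelian_groupE(1)[OF S.abelian_group_A] by simp
      moreover have "\<forall>i\<in>insert b B. Tr (?r \<otimes> i) = f i"
        using insert.prems r x * by auto
      ultimately show ?thesis by blast
    next
      case True
      then have "\<exists>c. \<forall>x\<in>carrier S. Tr (x \<otimes> b) = (\<Sum>i\<in>B. c i * Tr (x \<otimes> i))"
        using insert b by (intro linear_form_dependence[OF mod, of B "\<lambda>i x. Tr (x \<otimes> i)"] Trr) auto
      then obtain c where c: "\<forall>x\<in>carrier S. Tr (x \<otimes> b) = (\<Sum>i\<in>B. c i * Tr (x \<otimes> i))"
        by blast
      have sum: "h (finsum S (\<lambda>i. c i \<odot> i) B) = (\<Sum>i\<in>B. c i * h i)" if "linear_form S h" for h
        using that insert.prems
        by (subst linear_form_finsum[OF S.abelian_group_A]) (auto simp: linear_form_smult intro!: sum.cong)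
      have "(\<lambda>i. c i \<odot> i) \<in> B \<rightarrow> carrier S"
        using insert.prems by auto
      then have "b = finsum S (\<lambda>i. c i \<odot> i) B"
        using b c sum[OF Trl]
        by (intro nondeg) (auto intro!: abelian_monoid.finsum_closed abelian_group.axioms(1)[OF S.abelian_group_A])
      then have "f b = (\<Sum>i\<in>B. c i * f i)"
        using sum[OF f] by simp
      also have "\<dots> = Tr (r \<otimes> b)"
        using c r by simp
      finally show ?thesis using r by auto
    qed
  qed
  then obtain r where r: "r \<in> carrier S" "\<forall>b\<in>B. Tr (r \<otimes> b) = f b"
    by blast
  have "Tr (r \<otimes> s) = f s" if s: "s \<in> carrier S" for s
  proof -
    obtain c where c: "s = finsum S (\<lambda>b. c b \<odot> b) B"
      using B(3)[OF s] by blast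
    have sum: "h s = (\<Sum>i\<in>B. c i * h i)" if "linear_form S h" for h
      unfolding c using that B(2)
      by (subst linear_form_finsum[OF S.abelian_group_A]) (auto simp: linear_form_smult intro!: sum.cong)
    show ?thesis
      using r sum[OF f] sum[OF Trl[OF r(1)]] by simp
  qed
  then show ?thesis using r by blast
qed

section \<open>Brackets and contractions\<close>

lemma lin_lin: "lin \<phi> (lin \<psi> f) = lin (\<lambda>u. lin \<phi> (\<psi> u)) f"
  by (simp add: lin_def[of \<psi>] lin_def[of "\<lambda>u. lin \<phi> (\<psi> u)"])

lemma fmult_word_left: "fmult S V (word u) f = lin (\<lambda>w. word (word_mult S V u w)) f"
  and fmult_word_right: "fmult S V f (word u) = lin (\<lambda>w. word (word_mult S V w u)) f"
  by (simp_all add: fmult_lin)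

text \<open>Representability of linear forms is the axiom here, in place of finite dimension,
  because it passes directly to the corner by \<open>corner_representation\<close>.\<close>

locale traced_bimodule = complex_bimodule S V
  for S :: "(complex, 's) module" and V :: "('s, 'v) bimodule" +
  fixes Tr :: "'s \<Rightarrow> complex"
  assumes trace: "nondegenerate_trace S Tr"
    and representation: "linear_form S f \<Longrightarrow> \<exists>r\<in>carrier S. \<forall>s\<in>carrier S. Tr (r \<otimes>\<^bsub>S\<^esub> s) = f s"
begin

abbreviation "br \<equiv> bracket S Tr V"

lemmas separates = trace_separates[OF S.complex_alg_axioms trace]

lemma bracket_ex1:
  assumes "\<phi> \<in> dual_space V" "w \<in> carrier V"
  shows "\<exists>!r. r \<in> carrier S \<and> (\<forall>s\<in>carrier S. Tr (r \<otimes>\<^bsub>S\<^esub> s) = \<phi> (ract V w s))"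
proof -
  have "linear_form S (\<lambda>s. \<phi> (ract V w s))"
    using assms by (auto simp: linear_form_def dual_space_iff ract_add_scalar ract_smult_right)
  then obtain r where "r \<in> carrier S" "\<forall>s\<in>carrier S. Tr (r \<otimes>\<^bsub>S\<^esub> s) = \<phi> (ract V w s)"
    using representation by blast
  then show ?thesis
    using separates by (intro ex1I[of _ r]) auto
qed

lemma bracket_closed [simp]: "\<phi> \<in> dual_space V \<Longrightarrow> w \<in> carrier V \<Longrightarrow> br \<phi> w \<in> carrier S"
  and bracket_trace: "\<phi> \<in> dual_space V \<Longrightarrow> w \<in> carrier V \<Longrightarrow> s \<in> carrier S \<Longrightarrow>
    Tr (br \<phi> w \<otimes>\<^bsub>S\<^esub> s) = \<phi> (ract V w s)"
  using theI'[OF bracket_ex1[of \<phi> w]] by (auto simp: bracket_def)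

lemma bracket_eqI:
  assumes "\<phi> \<in> dual_space V" "w \<in> carrier V" "r \<in> carrier S"
    "\<And>s. s \<in> carrier S \<Longrightarrow> Tr (r \<otimes>\<^bsub>S\<^esub> s) = \<phi> (ract V w s)"
  shows "br \<phi> w = r"
  using assms by (intro separates) (auto simp: bracket_trace)

lemma Tr_form: "linear_form S Tr"
  using trace by (auto simp: nondegenerate_trace_def linear_form_def)

lemma S_add_closed [simp]: "x \<in> carrier S \<Longrightarrow> y \<in> carrier S \<Longrightarrow> x \<oplus>\<^bsub>S\<^esub> y \<in> carrier S"
  by (rule abelian_groupE(1)[OF S.abelian_group_A])

lemma bracket_add:
  assumes "\<phi> \<in> dual_space V" "v \<in> carrier V" "w \<in> carrier V"
  shows "br \<phi> (v \<oplus>\<^bsub>V\<^esub> w) = br \<phi> v \<oplus>\<^bsub>S\<^esub> br \<phi> w"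
  using assms by (intro bracket_eqI)
    (auto simp: S.A_l_distr linear_form_add[OF Tr_form] bracket_trace ract_add linear_form_add[of V \<phi>] dual_space_iff[symmetric]
      dest!: dual_space_iff[THEN iffD1, THEN linear_form_add])

lemma bracket_smult:
  assumes "\<phi> \<in> dual_space V" "v \<in> carrier V"
  shows "br \<phi> (c \<odot>\<^bsub>V\<^esub> v) = c \<odot>\<^bsub>S\<^esub> br \<phi> v"
  using assms by (intro bracket_eqI)
    (auto simp: linear_form_smult[OF Tr_form] bracket_trace ract_smult_left S.smult_mult_left[symmetric]
      linear_form_smult[of V \<phi>] dual_space_iff[THEN iffD1])

lemma bracket_ract:
  assumes "\<phi> \<in> dual_space V" "v \<in> carrier V" "t \<in> carrier S"
  shows "br \<phi> (ract V v t) = br \<phi> v \<otimes>\<^bsub>S\<^esub> t"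
  using assms by (intro bracket_eqI) (auto simp: S.A_m_assoc bracket_trace ract_mult)

text \<open>These functionals are \<open>\<phi> t\<close> and \<open>t \<phi>\<close> in the
  bimodule structure of the dual, where the two sides are interchanged.\<close>

lemma dual_lact: "\<phi> \<in> dual_space V \<Longrightarrow> t \<in> carrier S \<Longrightarrow> (\<lambda>v. \<phi> (lact V t v)) \<in> dual_space V"
  and dual_ract: "\<phi> \<in> dual_space V \<Longrightarrow> t \<in> carrier S \<Longrightarrow> (\<lambda>v. \<phi> (ract V v t)) \<in> dual_space V"
  by (auto simp: dual_space_iff linear_form_def lact_add ract_add lact_smult_right ract_smult_left)

lemma bracket_lact:
  assumes "\<phi> \<in> dual_space V" "v \<in> carrier V" "t \<in> carrier S"
  shows "br \<phi> (lact V t v) = br (\<lambda>v. \<phi> (lact V t v)) v"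
  using assms by (intro bracket_eqI) (auto simp: bracket_trace dual_lact lact_ract)

text \<open>The trace is cyclic, so \<open>t\<close> can be brought to the right of
  \<open>s\<close>, where it acts on \<open>v\<close>: the bracket is left linear in the
  functional.\<close>

lemma mult_bracket:
  assumes "\<phi> \<in> dual_space V" "v \<in> carrier V" "t \<in> carrier S"
  shows "br (\<lambda>v. \<phi> (ract V v t)) v = t \<otimes>\<^bsub>S\<^esub> br \<phi> v"
proof (rule bracket_eqI)
  fix s assume s: "s \<in> carrier S"
  have "Tr (t \<otimes>\<^bsub>S\<^esub> br \<phi> v \<otimes>\<^bsub>S\<^esub> s) = Tr (t \<otimes>\<^bsub>S\<^esub> (br \<phi> v \<otimes>\<^bsub>S\<^esub> s))"
    using assms s by (simp add: S.A_m_assoc)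
  also have "\<dots> = Tr (br \<phi> v \<otimes>\<^bsub>S\<^esub> s \<otimes>\<^bsub>S\<^esub> t)"
    using trace assms s by (auto simp: nondegenerate_trace_def)
  also have "\<dots> = \<phi> (ract V (ract V v s) t)"
    using assms s by (simp add: S.A_m_assoc bracket_trace ract_mult)
  finally show "Tr (t \<otimes>\<^bsub>S\<^esub> br \<phi> v \<otimes>\<^bsub>S\<^esub> s) = \<phi> (ract V (ract V v s) t)" .
qed (use assms in \<open>auto simp: dual_ract\<close>)

lemma contract_free_lin: "contract_free S Tr V \<phi> f = lin (contract_word S Tr V \<phi>) f"
  by (simp add: contract_free_def lin_def)

lemma contract_word_closed:
  assumes "\<phi> \<in> dual_space V" "u \<in> tensor_words S V"
  shows "contract_word S Tr V \<phi> u \<in> fcarrier S V"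
  using assms(2)
proof (cases rule: tensor_words_cases)
  case (2 v vs)
  then show ?thesis using assms(1) by (cases vs) auto
qed simp

lemma contract_free_closed:
  "\<phi> \<in> dual_space V \<Longrightarrow> f \<in> fcarrier S V \<Longrightarrow> contract_free S Tr V \<phi> f \<in> fcarrier S V"
  unfolding contract_free_lin by (rule fcarrier_lin[OF _ contract_word_closed])

text \<open>Contraction sees only the first two factors, so the cases are whether none, one or more
  factors precede the altered one. Balancing between the first two factors becomes an equality of
  words, since the bracket of \<open>v s\<close> is the bracket of \<open>v\<close> times
  \<open>s\<close>. Relations between scalars are sent to 0.\<close>

lemma contract_relations:
  assumes \<phi>: "\<phi> \<in> dual_space V" and "r \<in> tensor_relations S V"
  shows "contract_free S Tr V \<phi> r \<in> tensor_null S V"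
  using assms(2)
proof cases
  case (tensor_add us v w ws)
  show ?thesis
  proof (cases us)
    case Nil
    then show ?thesis
    proof (cases ws)
      case Nil
      then show ?thesis
        using \<open>us = []\<close> tensor_add \<phi> relation_Scalar_add[of "br \<phi> v" "br \<phi> w"]
        by (simp add: contract_free_lin bracket_add)
    next
      case (Cons x xs)
      then show ?thesis
        using Nil tensor_add \<phi> relation_Tensor_add[of "[]" "lact V (br \<phi> v) x" "lact V (br \<phi> w) x" xs]
        by (simp add: contract_free_lin bracket_add lact_add_scalar)
    qed
  next
    case (Cons u us')
    then show ?thesis
    proof (cases us')
      case Nil
      then show ?thesis
        using Cons tensor_add \<phi> relation_Tensor_add[of "[]" "lact V (br \<phi> u) v" "lact V (br \<phi> u) w" ws]
        by (simp add: contract_free_lin lact_add)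
    next
      case (Cons u' us'')
      then show ?thesis
        using \<open>us = u # us'\<close> tensor_add \<phi> relation_Tensor_add[of "lact V (br \<phi> u) u' # us''" v w ws]
        by (simp add: contract_free_lin)
    qed
  qed
next
  case (tensor_smult us v ws c)
  show ?thesis
  proof (cases us)
    case Nil
    then show ?thesis
    proof (cases ws)
      case Nil
      then show ?thesis
        using \<open>us = []\<close> tensor_smult \<phi> relation_Scalar_smult[of "br \<phi> v" c]
        by (simp add: contract_free_lin bracket_smult lin_single)
    next
      case (Cons x xs)
      then show ?thesis
        using Nil tensor_smult \<phi> relation_Tensor_smult[of "[]" "lact V (br \<phi> v) x" xs _ c]
        by (simp add: contract_free_lin bracket_smult lact_smult_left lin_single)
    qed
  next
    case (Cons u us')
    then show ?thesis
    proof (cases us')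
      case Nil
      then show ?thesis
        using Cons tensor_smult \<phi> relation_Tensor_smult[of "[]" "lact V (br \<phi> u) v" ws _ c]
        by (simp add: contract_free_lin lact_smult_right lin_single)
    next
      case (Cons u' us'')
      then show ?thesis
        using \<open>us = u # us'\<close> tensor_smult \<phi> relation_Tensor_smult[of "lact V (br \<phi> u) u' # us''" v ws _ c]
        by (simp add: contract_free_lin lin_single)
    qed
  qed
next
  case (tensor_balanced us v s w ws)
  show ?thesis
  proof (cases us)
    case Nil
    then show ?thesis
      using tensor_balanced \<phi> by (simp add: contract_free_lin bracket_ract lact_mult)
  next
    case (Cons u us')
    then show ?thesis
    proof (cases us')
      case Nil
      then show ?thesis
        using Cons tensor_balanced \<phi> relation_Tensor_balanced[of "[]" "lact V (br \<phi> u) v" s w ws]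
        by (simp add: contract_free_lin lact_ract)
    next
      case (Cons u' us'')
      then show ?thesis
        using \<open>us = u # us'\<close> tensor_balanced \<phi> relation_Tensor_balanced[of "lact V (br \<phi> u) u' # us''" v s w ws]
        by (simp add: contract_free_lin)
    qed
  qed
qed (simp_all add: contract_free_lin lin_single)

lemma contract_class:
  assumes "\<phi> \<in> dual_space V"
  shows "contract S Tr V \<phi> (tensor_class S V f) = tensor_class S V (contract_free S Tr V \<phi> f)"
proof -
  have "tcong S V (contract_free S Tr V \<phi> g) (contract_free S Tr V \<phi> f)" if "tcong S V g f" for g
    unfolding contract_free_lin using that contract_relations[OF assms]
    by (intro lin_tcong) (auto simp: contract_free_lin)
  then have "contract S Tr V \<phi> (tensor_class S V f) = (\<Union>g\<in>tensor_class S V f. tensor_class S V (contract_free S Tr V \<phi> f))"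
    unfolding contract_def
    by (intro SUP_cong refl) (simp add: tensor_class_eq_iff mem_tensor_class)
  then show ?thesis
    using tensor_class_self[of f S V] by auto
qed

lemma contract_closed [simp]:
  "\<phi> \<in> dual_space V \<Longrightarrow> x \<in> carrier (tensor_alg S V) \<Longrightarrow> contract S Tr V \<phi> x \<in> carrier (tensor_alg S V)"
  by (auto elim!: tensor_alg_cases simp: contract_class contract_free_closed)

lemma contract_add:
  "\<phi> \<in> dual_space V \<Longrightarrow> x \<in> carrier (tensor_alg S V) \<Longrightarrow> y \<in> carrier (tensor_alg S V) \<Longrightarrow>
    contract S Tr V \<phi> (x \<oplus>\<^bsub>tensor_alg S V\<^esub> y) =
      contract S Tr V \<phi> x \<oplus>\<^bsub>tensor_alg S V\<^esub> contract S Tr V \<phi> y"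
  by (elim tensor_alg_cases) (simp add: contract_class contract_free_lin tensor_alg_add)

lemma contract_mult_scalar:
  assumes \<phi>: "\<phi> \<in> dual_space V" and t: "t \<in> carrier S" and x: "x \<in> carrier (tensor_alg S V)"
  shows "contract S Tr V \<phi> (x \<otimes>\<^bsub>tensor_alg S V\<^esub> tensor_scalar S V t) =
    contract S Tr V \<phi> x \<otimes>\<^bsub>tensor_alg S V\<^esub> tensor_scalar S V t"
proof -
  obtain f where f: "f \<in> fcarrier S V" "x = tensor_class S V f"
    using x by (rule tensor_alg_cases)
  have "contract_word S Tr V \<phi> (word_mult S V u (Scalar t)) = fmult S V (contract_word S Tr V \<phi> u) (word (Scalar t))"
    if "u \<in> tensor_words S V" for u
    using that
  proof (cases rule: tensor_words_cases)
    case (2 v vs)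
    show ?thesis
    proof (cases vs)
      case Nil
      then show ?thesis using 2 \<phi> t by (simp add: bracket_ract)
    next
      case (Cons w ws)
      then show ?thesis using 2 \<phi> t by (cases ws) (simp_all add: lact_ract)
    qed
  qed simp
  then have "contract_free S Tr V \<phi> (fmult S V f (word (Scalar t))) = fmult S V (contract_free S Tr V \<phi> f) (word (Scalar t))"
    using f unfolding contract_free_lin fmult_word_right lin_lin
    by (intro lin_cong) (auto simp: fcarrier_def lin_word fmult_word_right)
  then show ?thesis
    using f \<phi> t by (simp add: tensor_scalar_def tensor_alg_mult contract_class contract_free_closed)
qed

text \<open>A scalar in front of \<open>x\<close> is absorbed by the functional. In iterated
  contractions the coefficient left by one contraction disappears in this way into the next.\<close>

lemma contract_scalar_mult:
  assumes \<phi>: "\<phi> \<in> dual_space V" and t: "t \<in> carrier S" and x: "x \<in> carrier (tensor_alg S V)"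
  shows "contract S Tr V \<phi> (tensor_scalar S V t \<otimes>\<^bsub>tensor_alg S V\<^esub> x) = contract S Tr V (\<lambda>v. \<phi> (lact V t v)) x"
proof -
  obtain f where f: "f \<in> fcarrier S V" "x = tensor_class S V f"
    using x by (rule tensor_alg_cases)
  have "contract_word S Tr V \<phi> (word_mult S V (Scalar t) u) = contract_word S Tr V (\<lambda>v. \<phi> (lact V t v)) u"
    if "u \<in> tensor_words S V" for u
    using that
  proof (cases rule: tensor_words_cases)
    case (2 v vs)
    then show ?thesis using \<phi> t by (cases vs) (simp_all add: bracket_lact)
  qed simp
  then have "contract_free S Tr V \<phi> (fmult S V (word (Scalar t)) f) = contract_free S Tr V (\<lambda>v. \<phi> (lact V t v)) f"
    using f unfolding contract_free_lin fmult_word_left lin_lin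
    by (intro lin_cong) (auto simp: fcarrier_def)
  then show ?thesis
    using f \<phi> t by (simp add: tensor_scalar_def tensor_alg_mult contract_class dual_lact)
qed

text \<open>By \<open>mult_bracket\<close> at the first factor. It turns the multiple of a
  contraction by \<open>e q_i\<close> into a contraction with a functional adapted to the
  corner.\<close>

lemma scalar_mult_contract:
  assumes \<phi>: "\<phi> \<in> dual_space V" and t: "t \<in> carrier S" and x: "x \<in> carrier (tensor_alg S V)"
  shows "tensor_scalar S V t \<otimes>\<^bsub>tensor_alg S V\<^esub> contract S Tr V \<phi> x = contract S Tr V (\<lambda>v. \<phi> (ract V v t)) x"
proof -
  obtain f where f: "f \<in> fcarrier S V" "x = tensor_class S V f"
    using x by (rule tensor_alg_cases)
  have "fmult S V (word (Scalar t)) (contract_word S Tr V \<phi> u) = contract_word S Tr V (\<lambda>v. \<phi> (ract V v t)) u"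
    if "u \<in> tensor_words S V" for u
    using that
  proof (cases rule: tensor_words_cases)
    case (2 v vs)
    then show ?thesis using \<phi> t by (cases vs) (simp_all add: mult_bracket lact_mult)
  qed simp
  then have "fmult S V (word (Scalar t)) (contract_free S Tr V \<phi> f) = contract_free S Tr V (\<lambda>v. \<phi> (ract V v t)) f"
    using f unfolding contract_free_lin fmult_word_left lin_lin
    by (intro lin_cong) (auto simp: fcarrier_def)
  then show ?thesis
    using f \<phi> t by (simp add: tensor_scalar_def tensor_alg_mult contract_class contract_free_closed dual_ract)
qed

end

section \<open>Quotients and corners\<close>

lemma alg_isoD:
  assumes "h \<in> alg_iso A B"
  shows "h \<in> ring_hom A B" "bij_betw h (carrier A) (carrier B)"
    "x \<in> carrier A \<Longrightarrow> h x \<in> carrier B"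
    "x \<in> carrier A \<Longrightarrow> y \<in> carrier A \<Longrightarrow> h (x \<oplus>\<^bsub>A\<^esub> y) = h x \<oplus>\<^bsub>B\<^esub> h y"
    "x \<in> carrier A \<Longrightarrow> y \<in> carrier A \<Longrightarrow> h (x \<otimes>\<^bsub>A\<^esub> y) = h x \<otimes>\<^bsub>B\<^esub> h y"
    "h \<one>\<^bsub>A\<^esub> = \<one>\<^bsub>B\<^esub>"
    "x \<in> carrier A \<Longrightarrow> h (c \<odot>\<^bsub>A\<^esub> x) = c \<odot>\<^bsub>B\<^esub> h x"
  using assms by (auto simp: alg_iso_def ring_iso_def ring_hom_def)

lemma alg_isoI:
  assumes "\<And>x. x \<in> carrier A \<Longrightarrow> h x \<in> carrier B"
    "\<And>x y. x \<in> carrier A \<Longrightarrow> y \<in> carrier A \<Longrightarrow> h (x \<oplus>\<^bsub>A\<^esub> y) = h x \<oplus>\<^bsub>B\<^esub> h y"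
    "\<And>x y. x \<in> carrier A \<Longrightarrow> y \<in> carrier A \<Longrightarrow> h (x \<otimes>\<^bsub>A\<^esub> y) = h x \<otimes>\<^bsub>B\<^esub> h y"
    "h \<one>\<^bsub>A\<^esub> = \<one>\<^bsub>B\<^esub>"
    "\<And>c x. x \<in> carrier A \<Longrightarrow> h (c \<odot>\<^bsub>A\<^esub> x) = c \<odot>\<^bsub>B\<^esub> h x"
    "inj_on h (carrier A)" "\<And>y. y \<in> carrier B \<Longrightarrow> \<exists>x\<in>carrier A. y = h x"
  shows "h \<in> alg_iso A B"
proof -
  have "h ` carrier A = carrier B"
    using assms(1,7) by blast
  then show ?thesis
    using assms by (auto simp: alg_iso_def ring_iso_def ring_hom_def bij_betw_def)
qed

locale alg_ideal = complex_alg A + I: ideal I A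
  for A :: "(complex, 'a) module" (structure) and I :: "'a set"
begin

abbreviation "Q \<equiv> quot_alg A I"

lemma quot_carrier: "carrier Q = (\<lambda>x. I +> x) ` carrier A"
  by (auto simp: quot_alg_def FactRing_def A_RCOSETS_def RCOSETS_def a_r_coset_def)

lemma quot_mult: "x \<in> carrier A \<Longrightarrow> y \<in> carrier A \<Longrightarrow> (I +> x) \<otimes>\<^bsub>Q\<^esub> (I +> y) = I +> (x \<otimes> y)"
  by (simp add: quot_alg_def FactRing_def I.rcoset_mult_add)

lemma quot_add: "x \<in> carrier A \<Longrightarrow> y \<in> carrier A \<Longrightarrow> (I +> x) \<oplus>\<^bsub>Q\<^esub> (I +> y) = I +> (x \<oplus> y)"
  by (simp add: quot_alg_def FactRing_def I.a_rcos_sum)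

lemma quot_one: "\<one>\<^bsub>Q\<^esub> = I +> \<one>" and quot_zero: "\<zero>\<^bsub>Q\<^esub> = I"
  by (simp_all add: quot_alg_def FactRing_def)

lemma quot_coset_eq:
  "x \<in> carrier A \<Longrightarrow> y \<in> carrier A \<Longrightarrow> I +> x = I +> y \<longleftrightarrow> x \<ominus> y \<in> I"
  using ring.quotient_eq_iff_same_a_r_cos[OF ring_A I.is_ideal] by blast

lemma mem_coset: "x \<in> carrier A \<Longrightarrow> y \<in> I +> x \<Longrightarrow> y \<in> carrier A \<and> I +> y = I +> x"
proof -
  assume x: "x \<in> carrier A" and "y \<in> I +> x"
  then obtain h where h: "h \<in> I" "y = h \<oplus> x"
    by (auto simp: a_r_coset_def r_coset_def)
  then have "h \<in> carrier A" "y \<in> carrier A"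
    using x I.Icarr abelian_groupE(1)[OF abelian_group_A] by auto
  moreover have "y \<ominus> x = h"
    using x h I.Icarr abelian_group.a_inv_closed[OF abelian_group_A x]
    by (simp add: a_minus_def abelian_groupE(3)[OF abelian_group_A] abelian_group.r_neg[OF abelian_group_A]
      abelian_groupE(4)[OF abelian_group_A, of _ \<zero>] abelian_groupE(2,5)[OF abelian_group_A])
  ultimately show "y \<in> carrier A \<and> I +> y = I +> x"
    using x h by (simp add: quot_coset_eq)
qed

lemma coset_self: "x \<in> carrier A \<Longrightarrow> x \<in> I +> x"
  by (rule I.a_rcos_self)

lemma smult_diff: "x \<in> carrier A \<Longrightarrow> y \<in> carrier A \<Longrightarrow> c \<odot> (x \<ominus> y) = c \<odot> x \<ominus> c \<odot> y"
proof -
  assume xy: "x \<in> carrier A" "y \<in> carrier A"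
  interpret R: ring A by (rule ring_A)
  have "(c \<odot> \<one>) \<otimes> (x \<ominus> y) = (c \<odot> \<one>) \<otimes> x \<ominus> (c \<odot> \<one>) \<otimes> y"
    using xy smult_carrier[OF A_one_closed, of c] by (simp add: a_minus_def A_r_distr ring.r_minus[OF ring_A]
      abelian_group.a_inv_closed[OF abelian_group_A])
  moreover have "x \<ominus> y \<in> carrier A"
    using xy by (simp add: abelian_group.minus_closed[OF abelian_group_A])
  ultimately show ?thesis
    using xy by (simp flip: smult_eq_mult_left)
qed

text \<open>A ring ideal absorbs complex scalars because they act as multiplication by
  \<open>c 1\<close>.\<close>

lemma I_smult: "x \<in> I \<Longrightarrow> c \<odot> x \<in> I"
  using smult_eq_mult_left[of x c] I.I_l_closed[of x "c \<odot> \<one>"] I.Icarr by simp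

lemma quot_smult: "x \<in> carrier A \<Longrightarrow> c \<odot>\<^bsub>Q\<^esub> (I +> x) = I +> (c \<odot> x)"
proof -
  assume x: "x \<in> carrier A"
  have "I +> (c \<odot> y) = I +> (c \<odot> x)" if y: "y \<in> I +> x" for y
  proof -
    have "y \<in> carrier A" "y \<ominus> x \<in> I"
      using mem_coset[OF x y] quot_coset_eq[of y x] x by auto
    then show ?thesis
      using x I_smult[of "y \<ominus> x" c] by (simp add: quot_coset_eq smult_diff)
  qed
  then have "(\<Union>y\<in>I +> x. I +> (c \<odot> y)) = (\<Union>y\<in>I +> x. I +> (c \<odot> x))"
    by (intro SUP_cong refl)
  then show ?thesis
    using coset_self[OF x] by (auto simp: quot_alg_def)
qed

lemma coset_closed [simp]: "x \<in> carrier A \<Longrightarrow> I +> x \<in> carrier Q"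
  by (auto simp: quot_carrier)

lemma quot_complex_alg: "complex_alg Q"
proof -
  have R: "ring (A Quot I)" by (rule I.quotient_is_ring)
  note ab = ring.is_abelian_group[OF R] and mo = ring.is_monoid[OF R]
  have eq: "carrier Q = carrier (A Quot I)" "mult Q = mult (A Quot I)" "one Q = one (A Quot I)"
    "zero Q = zero (A Quot I)" "add Q = add (A Quot I)"
    by (simp_all add: quot_alg_def)
  have abQ: "abelian_group Q"
    by (rule abelian_groupI; unfold eq)
      (use abelian_groupE[OF ab] in \<open>auto\<close>)
  moreover have "Group.monoid Q"
    by (rule monoidI; unfold eq)
      (use monoid.m_closed[OF mo] monoid.m_assoc[OF mo] monoid.one_closed[OF mo] monoid.l_one[OF mo] monoid.r_one[OF mo] in auto)
  ultimately have "ring Q"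
    by (rule ringI; unfold quot_carrier) (auto simp: quot_add quot_mult A_l_distr A_r_distr abelian_groupE(1)[OF abelian_group_A])
  moreover have "Module.module complex_ring Q"
    by (rule moduleI[OF cring_complex_ring abQ]; unfold quot_carrier)
      (use smult_l_distr smult_r_distr smult_assoc1 smult_one in
        \<open>auto simp: quot_add quot_smult abelian_groupE(1)[OF abelian_group_A]\<close>)
  moreover have "complex_alg_axioms Q"
    by unfold_locales (auto simp: quot_carrier quot_smult quot_mult smult_mult_left[symmetric] smult_mult_right[symmetric])
  ultimately show ?thesis
    by (simp add: complex_alg_def)
qed

end

section \<open>Ideals and quotients under a corner isomorphism\<close>

lemma finsum_closed_under:
  assumes "abelian_group G" "H \<subseteq> carrier G" "\<zero>\<^bsub>G\<^esub> \<in> H"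
    "\<And>x y. x \<in> H \<Longrightarrow> y \<in> H \<Longrightarrow> x \<oplus>\<^bsub>G\<^esub> y \<in> H" "\<And>i. i \<in> J \<Longrightarrow> g i \<in> H"
  shows "finsum G g J \<in> H"
proof -
  interpret G: abelian_group G by fact
  show ?thesis
    using assms(5)
  proof (induction J rule: infinite_finite_induct)
    case (insert i J)
    then have "g \<in> J \<rightarrow> carrier G" "g i \<in> carrier G"
      using assms(2) by auto
    with insert show ?case
      using assms(4) by (simp add: G.finsum_insert)
  qed (simp_all add: assms(3) G.finsum_infinite)
qed

text \<open>Abstracts the relation between an algebra and its corner up to isomorphism; it is
  instantiated with tensor algebras and again with their quotients.\<close>

locale corner_iso = T: complex_alg T + T': complex_alg T'
  for T :: "(complex, 'a) module" and T' :: "(complex, 'b) module" +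
  fixes \<epsilon> :: 'a and \<iota> :: "'b \<Rightarrow> 'a"
  assumes eps [simp]: "\<epsilon> \<in> carrier T" "\<epsilon> \<otimes>\<^bsub>T\<^esub> \<epsilon> = \<epsilon>" and iso: "\<iota> \<in> alg_iso T' (corner T \<epsilon>)"
begin

lemmas iota = alg_isoD[OF iso, simplified]

lemma corner_iff: "x \<in> carrier (corner T \<epsilon>) \<longleftrightarrow> x \<in> carrier T \<and> \<epsilon> \<otimes>\<^bsub>T\<^esub> x = x \<and> x \<otimes>\<^bsub>T\<^esub> \<epsilon> = x"
  by (rule corner_carrier_iff[OF T.complex_alg_axioms eps])

lemma iota_closed [simp]: "x \<in> carrier T' \<Longrightarrow> \<iota> x \<in> carrier T"
  and iota_eps: "x \<in> carrier T' \<Longrightarrow> \<epsilon> \<otimes>\<^bsub>T\<^esub> \<iota> x = \<iota> x" "x \<in> carrier T' \<Longrightarrow> \<iota> x \<otimes>\<^bsub>T\<^esub> \<epsilon> = \<iota> x"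
  using iota(3) corner_iff by blast+

lemma iota_inj: "x \<in> carrier T' \<Longrightarrow> y \<in> carrier T' \<Longrightarrow> \<iota> x = \<iota> y \<Longrightarrow> x = y"
  using iota(2) by (auto simp: bij_betw_def inj_on_def)

lemma iota_surj: "x \<in> carrier (corner T \<epsilon>) \<Longrightarrow> \<exists>y\<in>carrier T'. x = \<iota> y"
  using iota(2) by (auto simp: bij_betw_def)

lemma iota_zero: "\<iota> \<zero>\<^bsub>T'\<^esub> = \<zero>\<^bsub>T\<^esub>"
  using iota(4)[of "\<zero>\<^bsub>T'\<^esub>" "\<zero>\<^bsub>T'\<^esub>"] abelian_groupE(2,5)[OF T'.abelian_group_A]
  by (intro abelian_group.add_eq_zeroD[OF T.abelian_group_A]) auto

lemma iota_uminus: "x \<in> carrier T' \<Longrightarrow> \<iota> (\<ominus>\<^bsub>T'\<^esub> x) = \<ominus>\<^bsub>T\<^esub> \<iota> x"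
  using iota(4)[of "\<ominus>\<^bsub>T'\<^esub> x" x] abelian_group.a_inv_closed[OF T'.abelian_group_A, of x]
    abelian_group.l_neg[OF T'.abelian_group_A, of x] iota_zero
    abelian_group.minus_equality[OF T.abelian_group_A, of "\<iota> (\<ominus>\<^bsub>T'\<^esub> x)" "\<iota> x"] by simp

lemma iota_minus: "x \<in> carrier T' \<Longrightarrow> y \<in> carrier T' \<Longrightarrow> \<iota> (x \<ominus>\<^bsub>T'\<^esub> y) = \<iota> x \<ominus>\<^bsub>T\<^esub> \<iota> y"
  using iota(4)[of x "\<ominus>\<^bsub>T'\<^esub> y"] abelian_group.a_inv_closed[OF T'.abelian_group_A, of y] iota_uminus[of y]
  by (simp add: a_minus_def)

text \<open>As \<open>I'\<close> is the preimage of \<open>I\<close>, the induced map is well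
  defined and injective at once. A class \<open>X\<close> in the corner equals \<open>E X E\<close>
  for the class \<open>E\<close> of \<open>\<epsilon>\<close>, so it has a representative
  \<open>\<epsilon> x \<epsilon>\<close>, which lies in the image of \<open>\<iota>\<close>. The
  value of \<open>h\<close> on cosets is recorded for the final theorem.\<close>

lemma quotient_corner_iso:
  assumes I: "ideal I T" and I': "ideal I' T'"
    and corr: "\<And>x. x \<in> carrier T' \<Longrightarrow> x \<in> I' \<longleftrightarrow> \<iota> x \<in> I"
  shows "\<exists>h\<in>alg_iso (quot_alg T' I') (corner (quot_alg T I) (I +>\<^bsub>T\<^esub> \<epsilon>)).
    \<forall>x\<in>carrier T'. h (I' +>\<^bsub>T'\<^esub> x) = I +>\<^bsub>T\<^esub> \<iota> x"
proof -
  interpret I: alg_ideal T I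
    using I T.complex_alg_axioms by (simp add: alg_ideal_def)
  interpret I': alg_ideal T' I'
    using I' T'.complex_alg_axioms by (simp add: alg_ideal_def)
  have eq: "I' +>\<^bsub>T'\<^esub> x = I' +>\<^bsub>T'\<^esub> y \<longleftrightarrow> I +>\<^bsub>T\<^esub> \<iota> x = I +>\<^bsub>T\<^esub> \<iota> y" if "x \<in> carrier T'" "y \<in> carrier T'" for x y
    using that corr[of "x \<ominus>\<^bsub>T'\<^esub> y"] abelian_group.minus_closed[OF T'.abelian_group_A]
    by (simp add: I.quot_coset_eq I'.quot_coset_eq iota_minus)
  define h where "h X = (\<Union>x\<in>X. I +>\<^bsub>T\<^esub> \<iota> x)" for X
  have h: "h (I' +>\<^bsub>T'\<^esub> x) = I +>\<^bsub>T\<^esub> \<iota> x" if x: "x \<in> carrier T'" for x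
  proof -
    have "h (I' +>\<^bsub>T'\<^esub> x) = (\<Union>y\<in>I' +>\<^bsub>T'\<^esub> x. I +>\<^bsub>T\<^esub> \<iota> x)"
      unfolding h_def using I'.mem_coset[OF x] x eq by (intro SUP_cong refl) blast
    then show ?thesis using I'.coset_self[OF x] by auto
  qed
  let ?E = "I +>\<^bsub>T\<^esub> \<epsilon>"
  have "h \<in> alg_iso (quot_alg T' I') (corner (quot_alg T I) ?E)"
  proof (rule alg_isoI)
    have Ec: "X \<in> carrier (corner (quot_alg T I) ?E) \<longleftrightarrow>
        X \<in> carrier (quot_alg T I) \<and> ?E \<otimes>\<^bsub>quot_alg T I\<^esub> X = X \<and> X \<otimes>\<^bsub>quot_alg T I\<^esub> ?E = X" for X
      by (rule corner_carrier_iff[OF I.quot_complex_alg]) (simp_all add: I.quot_mult)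
    show "h X \<in> carrier (corner (quot_alg T I) ?E)" if "X \<in> carrier (quot_alg T' I')" for X
      using that unfolding I'.quot_carrier by (auto simp: h Ec I.quot_mult iota_eps)
    show "\<exists>Y\<in>carrier (quot_alg T' I'). X = h Y" if X: "X \<in> carrier (corner (quot_alg T I) ?E)" for X
    proof -
      obtain x where x: "x \<in> carrier T" "X = I +>\<^bsub>T\<^esub> x"
        using X by (auto simp: Ec I.quot_carrier)
      have "X = ?E \<otimes>\<^bsub>quot_alg T I\<^esub> X \<otimes>\<^bsub>quot_alg T I\<^esub> ?E"
        using X by (simp add: Ec)
      also have "\<dots> = I +>\<^bsub>T\<^esub> (\<epsilon> \<otimes>\<^bsub>T\<^esub> x \<otimes>\<^bsub>T\<^esub> \<epsilon>)"
        using x by (simp add: I.quot_mult)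
      finally have X': "X = I +>\<^bsub>T\<^esub> (\<epsilon> \<otimes>\<^bsub>T\<^esub> x \<otimes>\<^bsub>T\<^esub> \<epsilon>)" .
      obtain y where "y \<in> carrier T'" "\<epsilon> \<otimes>\<^bsub>T\<^esub> x \<otimes>\<^bsub>T\<^esub> \<epsilon> = \<iota> y"
        using iota_surj[OF corner_mem] x by blast
      then show ?thesis
        using X' by (intro bexI[of _ "I' +>\<^bsub>T'\<^esub> y"]) (simp_all add: h)
    qed
    show "inj_on h (carrier (quot_alg T' I'))"
      by (auto simp: inj_on_def I'.quot_carrier h eq)
  qed (auto simp: I'.quot_carrier h I'.quot_add I.quot_add I'.quot_mult I.quot_mult I'.quot_smult I.quot_smult
      I'.quot_one I.quot_one iota abelian_groupE(1)[OF T'.abelian_group_A])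
  then show ?thesis using h by blast
qed

text \<open>In one direction, the preimage of the ideal generated by \<open>M\<close> is an ideal
  containing \<open>M'\<close>. In the other, \<open>\<epsilon> a m b \<epsilon>\<close> is the sum
  over \<open>i\<close> and \<open>j\<close> of \<open>(\<epsilon> a P_i \<epsilon>)(\<epsilon> Q_i
  m P_j \<epsilon>)(\<epsilon> Q_j b \<epsilon>)\<close>, and the middle factors are compressions of
  elements of \<open>M\<close>, because \<open>M\<close> absorbs \<open>Q_i\<close> on the left and
  \<open>P_j\<close> on the right.\<close>

lemma ideal_correspondence:
  assumes M: "M \<subseteq> carrier T" and M': "M' \<subseteq> carrier T'"
    and image: "\<iota> ` M' = (\<lambda>m. \<epsilon> \<otimes>\<^bsub>T\<^esub> m \<otimes>\<^bsub>T\<^esub> \<epsilon>) ` M"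
    and P: "\<And>i. i < n \<Longrightarrow> P i \<in> carrier T" and Q: "\<And>i. i < n \<Longrightarrow> Q i \<in> carrier T"
    and full: "finsum T (\<lambda>i. P i \<otimes>\<^bsub>T\<^esub> \<epsilon> \<otimes>\<^bsub>T\<^esub> Q i) {..<n::nat} = \<one>\<^bsub>T\<^esub>"
    and MQ: "\<And>i m. i < n \<Longrightarrow> m \<in> M \<Longrightarrow> Q i \<otimes>\<^bsub>T\<^esub> m \<in> M"
    and MP: "\<And>i m. i < n \<Longrightarrow> m \<in> M \<Longrightarrow> m \<otimes>\<^bsub>T\<^esub> P i \<in> M"
    and x: "x \<in> carrier T'"
  shows "x \<in> Idl\<^bsub>T'\<^esub> M' \<longleftrightarrow> \<iota> x \<in> Idl\<^bsub>T\<^esub> M"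
proof
  interpret R: ring T by (rule T.ring_A)
  interpret R': ring T' by (rule T'.ring_A)
  interpret I: ideal "Idl\<^bsub>T\<^esub> M" T by (rule ring.genideal_ideal[OF T.ring_A M])
  interpret I': ideal "Idl\<^bsub>T'\<^esub> M'" T' by (rule ring.genideal_ideal[OF T'.ring_A M'])
  have MI: "M \<subseteq> Idl\<^bsub>T\<^esub> M" by (rule ring.genideal_self[OF T.ring_A M])
  have MI': "M' \<subseteq> Idl\<^bsub>T'\<^esub> M'" by (rule ring.genideal_self[OF T'.ring_A M'])
  {
    let ?J = "{x \<in> carrier T'. \<iota> x \<in> Idl\<^bsub>T\<^esub> M}"
    have "ideal ?J T'"
    proof (rule idealI[OF T'.ring_A])
      show "subgroup ?J (add_monoid T')"
      proof (rule subgroup.intro)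
        show "inv\<^bsub>add_monoid T'\<^esub> y \<in> ?J" if "y \<in> ?J" for y
          using that iota_uminus abelian_group.a_inv_closed[OF T'.abelian_group_A]
          by (simp flip: a_inv_def)
      qed (auto simp: iota iota_zero abelian_groupE(1,2)[OF T'.abelian_group_A])
    qed (auto simp: iota I.I_l_closed I.I_r_closed)
    moreover have "M' \<subseteq> ?J"
    proof
      fix m' assume m': "m' \<in> M'"
      then obtain m where m: "m \<in> M" "\<iota> m' = \<epsilon> \<otimes>\<^bsub>T\<^esub> m \<otimes>\<^bsub>T\<^esub> \<epsilon>"
        using image by blast
      then show "m' \<in> ?J"
        using m' M' MI I.I_r_closed[OF I.I_l_closed[of m \<epsilon>], of \<epsilon>] by auto
    qed
    ultimately have "Idl\<^bsub>T'\<^esub> M' \<subseteq> ?J"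
      by (rule ring.genideal_minimal[OF T'.ring_A])
    then show "\<iota> x \<in> Idl\<^bsub>T\<^esub> M" if "x \<in> Idl\<^bsub>T'\<^esub> M'"
      using that by blast
  }
  {
    let ?L = "\<iota> ` (Idl\<^bsub>T'\<^esub> M')"
    have L0: "\<zero>\<^bsub>T\<^esub> \<in> ?L"
      using imageI[OF additive_subgroup.zero_closed[OF I'.is_additive_subgroup], of \<iota>] by (simp add: iota_zero)
    have Ladd: "y \<oplus>\<^bsub>T\<^esub> z \<in> ?L" if "y \<in> ?L" "z \<in> ?L" for y z
    proof -
      obtain a b where ab: "a \<in> Idl\<^bsub>T'\<^esub> M'" "b \<in> Idl\<^bsub>T'\<^esub> M'" "y = \<iota> a" "z = \<iota> b"
        using \<open>y \<in> ?L\<close> \<open>z \<in> ?L\<close> by blast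
      then have "\<iota> (a \<oplus>\<^bsub>T'\<^esub> b) = y \<oplus>\<^bsub>T\<^esub> z"
        by (simp add: iota I'.Icarr)
      then show ?thesis
        using imageI[OF additive_subgroup.a_closed[OF I'.is_additive_subgroup ab(1,2)], of \<iota>] by simp
    qed
    have Lmult: "\<iota> a \<otimes>\<^bsub>T\<^esub> y \<otimes>\<^bsub>T\<^esub> \<iota> b \<in> ?L" if ab: "y \<in> ?L" "a \<in> carrier T'" "b \<in> carrier T'" for y a b
    proof -
      obtain z where z: "z \<in> Idl\<^bsub>T'\<^esub> M'" "y = \<iota> z"
        using ab by blast
      then have "\<iota> (a \<otimes>\<^bsub>T'\<^esub> z \<otimes>\<^bsub>T'\<^esub> b) = \<iota> a \<otimes>\<^bsub>T\<^esub> y \<otimes>\<^bsub>T\<^esub> \<iota> b"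
        using ab I'.Icarr by (simp add: iota)
      moreover have "a \<otimes>\<^bsub>T'\<^esub> z \<otimes>\<^bsub>T'\<^esub> b \<in> Idl\<^bsub>T'\<^esub> M'"
        using z ab by (intro I'.I_l_closed I'.I_r_closed)
      ultimately show ?thesis by (metis imageI[of _ _ \<iota>])
    qed
    have Lsub: "?L \<subseteq> carrier T"
      using I'.Icarr by auto
    let ?f = "\<lambda>a y b. \<epsilon> \<otimes>\<^bsub>T\<^esub> a \<otimes>\<^bsub>T\<^esub> y \<otimes>\<^bsub>T\<^esub> b \<otimes>\<^bsub>T\<^esub> \<epsilon>"
    \<comment> \<open>Quantifying over both multipliers makes absorption mere reassociation. Once
      the ideal \<open>?K\<close> contains \<open>M\<close> it contains the generated ideal, and
      \<open>a = b = 1\<close> gives the claim for \<open>\<iota> x\<close>.\<close>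
    let ?K = "{y \<in> carrier T. \<forall>a\<in>carrier T. \<forall>b\<in>carrier T. ?f a y b \<in> ?L}"
    have "ideal ?K T"
    proof (rule idealI[OF T.ring_A])
      show "subgroup ?K (add_monoid T)"
      proof (rule subgroup.intro)
        show "inv\<^bsub>add_monoid T\<^esub> y \<in> ?K" if y: "y \<in> ?K" for y
        proof -
          have "?f a (\<ominus>\<^bsub>T\<^esub> y) b = ?f (\<ominus>\<^bsub>T\<^esub> a) y b" if "a \<in> carrier T" "b \<in> carrier T" for a b
            using that y abelian_group.a_inv_closed[OF T.abelian_group_A]
            by (simp add: ring.l_minus[OF T.ring_A] ring.r_minus[OF T.ring_A])
          then show ?thesis
            using y abelian_group.a_inv_closed[OF T.abelian_group_A] by (simp flip: a_inv_def)
        qed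
        show "y \<otimes>\<^bsub>add_monoid T\<^esub> z \<in> ?K" if "y \<in> ?K" "z \<in> ?K" for y z
          using that Ladd by (simp add: T.A_l_distr T.A_r_distr abelian_groupE(1)[OF T.abelian_group_A])
        show "\<one>\<^bsub>add_monoid T\<^esub> \<in> ?K"
          using L0 abelian_groupE(2)[OF T.abelian_group_A]
          by (simp add: semiring.l_null[OF T.semiring_A] semiring.r_null[OF T.semiring_A])
      qed auto
    next
      fix y z assume y: "y \<in> ?K" and z: "z \<in> carrier T"
      have "?f a (z \<otimes>\<^bsub>T\<^esub> y) b = ?f (a \<otimes>\<^bsub>T\<^esub> z) y b" "?f a (y \<otimes>\<^bsub>T\<^esub> z) b = ?f a y (z \<otimes>\<^bsub>T\<^esub> b)"
        if "a \<in> carrier T" "b \<in> carrier T" for a b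
        using that y z by (simp_all add: T.A_m_assoc)
      then show "z \<otimes>\<^bsub>T\<^esub> y \<in> ?K" "y \<otimes>\<^bsub>T\<^esub> z \<in> ?K"
        using y z by auto
    qed
    moreover have "M \<subseteq> ?K"
    proof
      fix m assume m: "m \<in> M"
      then have mT: "m \<in> carrier T" using M by auto
      let ?e = "\<lambda>i. P i \<otimes>\<^bsub>T\<^esub> \<epsilon> \<otimes>\<^bsub>T\<^esub> Q i"
      have "?f a m b \<in> ?L" if a: "a \<in> carrier T" and b: "b \<in> carrier T" for a b
      proof -
        have piece: "?f a (?e i \<otimes>\<^bsub>T\<^esub> m \<otimes>\<^bsub>T\<^esub> ?e j) b \<in> ?L" if i: "i < n" and j: "j < n" for i j
        proof -
          have "Q i \<otimes>\<^bsub>T\<^esub> m \<otimes>\<^bsub>T\<^esub> P j \<in> M"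
            using m i j MQ MP by blast
          then have "\<epsilon> \<otimes>\<^bsub>T\<^esub> (Q i \<otimes>\<^bsub>T\<^esub> m \<otimes>\<^bsub>T\<^esub> P j) \<otimes>\<^bsub>T\<^esub> \<epsilon> \<in> ?L"
            using image MI' by blast
          moreover obtain u where "u \<in> carrier T'" "\<epsilon> \<otimes>\<^bsub>T\<^esub> (a \<otimes>\<^bsub>T\<^esub> P i) \<otimes>\<^bsub>T\<^esub> \<epsilon> = \<iota> u"
            using iota_surj[OF corner_mem, of "a \<otimes>\<^bsub>T\<^esub> P i"] a P[OF i] by auto
          moreover obtain v where "v \<in> carrier T'" "\<epsilon> \<otimes>\<^bsub>T\<^esub> (Q j \<otimes>\<^bsub>T\<^esub> b) \<otimes>\<^bsub>T\<^esub> \<epsilon> = \<iota> v"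
            using iota_surj[OF corner_mem, of "Q j \<otimes>\<^bsub>T\<^esub> b"] b Q[OF j] by auto
          ultimately have "(\<epsilon> \<otimes>\<^bsub>T\<^esub> (a \<otimes>\<^bsub>T\<^esub> P i) \<otimes>\<^bsub>T\<^esub> \<epsilon>) \<otimes>\<^bsub>T\<^esub> (\<epsilon> \<otimes>\<^bsub>T\<^esub> (Q i \<otimes>\<^bsub>T\<^esub> m \<otimes>\<^bsub>T\<^esub> P j) \<otimes>\<^bsub>T\<^esub> \<epsilon>) \<otimes>\<^bsub>T\<^esub>
              (\<epsilon> \<otimes>\<^bsub>T\<^esub> (Q j \<otimes>\<^bsub>T\<^esub> b) \<otimes>\<^bsub>T\<^esub> \<epsilon>) \<in> ?L"
            using Lmult by auto
          moreover have ee: "\<epsilon> \<otimes>\<^bsub>T\<^esub> (\<epsilon> \<otimes>\<^bsub>T\<^esub> z) = \<epsilon> \<otimes>\<^bsub>T\<^esub> z" if "z \<in> carrier T" for z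
            using that by (simp flip: T.A_m_assoc)
          ultimately show ?thesis
            using a b mT P[OF i] Q[OF i] P[OF j] Q[OF j] by (simp add: T.A_m_assoc)
        qed
        have e: "?e i \<in> carrier T" if "i < n" for i
          using P[OF that] Q[OF that] by simp
        \<comment> \<open>The two copies of 1 are summed up separately, first the one to the right
          of \<open>m\<close>, then the one to its left.\<close>
        have half: "?f a (?e i \<otimes>\<^bsub>T\<^esub> m) b \<in> ?L" if i: "i < n" for i
        proof -
          have "?f a (?e i \<otimes>\<^bsub>T\<^esub> m \<otimes>\<^bsub>T\<^esub> finsum T ?e {..<n}) b =
              finsum T (\<lambda>j. ?f a (?e i \<otimes>\<^bsub>T\<^esub> m \<otimes>\<^bsub>T\<^esub> ?e j) b) {..<n}"
            using a b mT e[OF i] e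
            by (intro finsum_additive[OF T.abelian_group_A T.abelian_group_A])
              (auto simp: T.A_l_distr T.A_r_distr abelian_groupE(1)[OF T.abelian_group_A])
          also have "\<dots> \<in> ?L"
            using piece[OF i] by (intro finsum_closed_under[OF T.abelian_group_A Lsub L0 Ladd]) auto
          finally show ?thesis
            using e[OF i] mT by (simp add: full)
        qed
        have "?f a (finsum T ?e {..<n} \<otimes>\<^bsub>T\<^esub> m) b = finsum T (\<lambda>i. ?f a (?e i \<otimes>\<^bsub>T\<^esub> m) b) {..<n}"
          using a b mT e
          by (intro finsum_additive[OF T.abelian_group_A T.abelian_group_A])
            (auto simp: T.A_l_distr T.A_r_distr abelian_groupE(1)[OF T.abelian_group_A])
        also have "\<dots> \<in> ?L"
          using half by (intro finsum_closed_under[OF T.abelian_group_A Lsub L0 Ladd]) auto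
        finally show ?thesis
          using mT by (simp add: full)
      qed
      then show "m \<in> ?K" using mT by blast
    qed
    ultimately have "Idl\<^bsub>T\<^esub> M \<subseteq> ?K"
      by (rule ring.genideal_minimal[OF T.ring_A])
    moreover assume "\<iota> x \<in> Idl\<^bsub>T\<^esub> M"
    ultimately have "?f \<one>\<^bsub>T\<^esub> (\<iota> x) \<one>\<^bsub>T\<^esub> \<in> ?L"
      using T.A_one_closed by blast
    then obtain y where "y \<in> Idl\<^bsub>T'\<^esub> M'" "\<iota> x = \<iota> y"
      using x by (auto simp: iota_eps)
    then show "x \<in> Idl\<^bsub>T'\<^esub> M'"
      using iota_inj[OF x, of y] I'.Icarr by auto
  }
qed

end

section \<open>Morita equivalence\<close>

text \<open>The record \<open>linear_cat\<close> is bare data; these are the laws under which an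
  equivalence can be built from a single functor.\<close>

locale linear_category =
  fixes C :: "('o, 'f) linear_cat"
  assumes id: "X \<in> Ob C \<Longrightarrow> Idn C X \<in> Hom C X X"
    and comp: "\<lbrakk>X \<in> Ob C; Y \<in> Ob C; Z \<in> Ob C; f \<in> Hom C X Y; g \<in> Hom C Y Z\<rbrakk> \<Longrightarrow> Comp C X Y Z g f \<in> Hom C X Z"
    and id_left: "\<lbrakk>X \<in> Ob C; Y \<in> Ob C; f \<in> Hom C X Y\<rbrakk> \<Longrightarrow> Comp C X Y Y (Idn C Y) f = f"
    and id_right: "\<lbrakk>X \<in> Ob C; Y \<in> Ob C; f \<in> Hom C X Y\<rbrakk> \<Longrightarrow> Comp C X X Y f (Idn C X) = f"
    and assoc: "\<lbrakk>X \<in> Ob C; Y \<in> Ob C; Z \<in> Ob C; W \<in> Ob C; f \<in> Hom C X Y; g \<in> Hom C Y Z; h \<in> Hom C Z W\<rbrakk> \<Longrightarrow>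
      Comp C X Y W (Comp C Y Z W h g) f = Comp C X Z W h (Comp C X Y Z g f)"
    and add: "\<lbrakk>X \<in> Ob C; Y \<in> Ob C; f \<in> Hom C X Y; g \<in> Hom C X Y\<rbrakk> \<Longrightarrow> Hom_add C X Y f g \<in> Hom C X Y"
    and scale: "\<lbrakk>X \<in> Ob C; Y \<in> Ob C; f \<in> Hom C X Y\<rbrakk> \<Longrightarrow> Hom_scale C X Y c f \<in> Hom C X Y"
    and comp_add_left: "\<lbrakk>X \<in> Ob C; Y \<in> Ob C; Z \<in> Ob C; f \<in> Hom C X Y; g \<in> Hom C Y Z; h \<in> Hom C Y Z\<rbrakk> \<Longrightarrow>
      Comp C X Y Z (Hom_add C Y Z g h) f = Hom_add C X Z (Comp C X Y Z g f) (Comp C X Y Z h f)"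
    and comp_add_right: "\<lbrakk>X \<in> Ob C; Y \<in> Ob C; Z \<in> Ob C; f \<in> Hom C X Y; g \<in> Hom C X Y; h \<in> Hom C Y Z\<rbrakk> \<Longrightarrow>
      Comp C X Y Z h (Hom_add C X Y f g) = Hom_add C X Z (Comp C X Y Z h f) (Comp C X Y Z h g)"
    and comp_scale_left: "\<lbrakk>X \<in> Ob C; Y \<in> Ob C; Z \<in> Ob C; f \<in> Hom C X Y; g \<in> Hom C Y Z\<rbrakk> \<Longrightarrow>
      Comp C X Y Z (Hom_scale C Y Z c g) f = Hom_scale C X Z c (Comp C X Y Z g f)"
    and comp_scale_right: "\<lbrakk>X \<in> Ob C; Y \<in> Ob C; Z \<in> Ob C; f \<in> Hom C X Y; g \<in> Hom C Y Z\<rbrakk> \<Longrightarrow>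
      Comp C X Y Z g (Hom_scale C X Y c f) = Hom_scale C X Z c (Comp C X Y Z g f)"

text \<open>Each \<open>N\<close> gets a chosen preimage \<open>G N\<close> with an isomorphism
  \<open>\<alpha> N\<close> and its inverse \<open>\<beta> N\<close>. Identities in \<open>C\<close>
  are verified after applying the faithful \<open>F'\<close>, where they become computations with
  these isomorphisms.\<close>

lemma equivalent_catsI:
  fixes C :: "('o, 'f) linear_cat" and D :: "('p, 'g) linear_cat"
  assumes "linear_category C" "linear_category D" and F: "linear_functor C D F F'"
    and ff: "\<And>X Y. X \<in> Ob C \<Longrightarrow> Y \<in> Ob C \<Longrightarrow> bij_betw (F' X Y) (Hom C X Y) (Hom D (F X) (F Y))"
    and es: "\<And>N. N \<in> Ob D \<Longrightarrow> \<exists>X\<in>Ob C. \<exists>a. cat_iso D (F X) N a"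
  shows "equivalent_cats C D"
proof -
  interpret C: linear_category C by fact
  interpret D: linear_category D by fact
  have FO: "F X \<in> Ob D" if "X \<in> Ob C" for X
    using F that by (auto simp: linear_functor_def)
  have FH: "F' X Y f \<in> Hom D (F X) (F Y)" if "X \<in> Ob C" "Y \<in> Ob C" "f \<in> Hom C X Y" for X Y f
    using F that by (auto simp: linear_functor_def)
  have Fid: "F' X X (Idn C X) = Idn D (F X)" if "X \<in> Ob C" for X
    using F that by (auto simp: linear_functor_def)
  have Fcomp: "F' X Z (Comp C X Y Z g f) = Comp D (F X) (F Y) (F Z) (F' Y Z g) (F' X Y f)"
    if "X \<in> Ob C" "Y \<in> Ob C" "Z \<in> Ob C" "f \<in> Hom C X Y" "g \<in> Hom C Y Z" for X Y Z f g
    using F that by (auto simp: linear_functor_def)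
  have Fadd: "F' X Y (Hom_add C X Y f g) = Hom_add D (F X) (F Y) (F' X Y f) (F' X Y g)"
    if "X \<in> Ob C" "Y \<in> Ob C" "f \<in> Hom C X Y" "g \<in> Hom C X Y" for X Y f g
    using F that by (auto simp: linear_functor_def)
  have Fscale: "F' X Y (Hom_scale C X Y c f) = Hom_scale D (F X) (F Y) c (F' X Y f)"
    if "X \<in> Ob C" "Y \<in> Ob C" "f \<in> Hom C X Y" for X Y f c
    using F that by (auto simp: linear_functor_def)
  have inj: "f = g" if "X \<in> Ob C" "Y \<in> Ob C" "f \<in> Hom C X Y" "g \<in> Hom C X Y" "F' X Y f = F' X Y g" for X Y f g
    using ff[of X Y] that by (auto simp: bij_betw_def inj_on_def)
  define lift where "lift X Y = inv_into (Hom C X Y) (F' X Y)" for X Y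
  have lift: "lift X Y g \<in> Hom C X Y" "F' X Y (lift X Y g) = g"
    if "X \<in> Ob C" "Y \<in> Ob C" "g \<in> Hom D (F X) (F Y)" for X Y g
    using ff[of X Y] that by (auto simp: bij_betw_def lift_def inv_into_into f_inv_into_f)
  have "\<forall>N. \<exists>X a b. N \<in> Ob D \<longrightarrow> X \<in> Ob C \<and> a \<in> Hom D (F X) N \<and> b \<in> Hom D N (F X) \<and>
      Comp D (F X) N (F X) b a = Idn D (F X) \<and> Comp D N (F X) N a b = Idn D N"
    using es unfolding cat_iso_def by blast
  then obtain G \<alpha> \<beta> where G: "\<And>N. N \<in> Ob D \<Longrightarrow> G N \<in> Ob C \<and> \<alpha> N \<in> Hom D (F (G N)) N \<and> \<beta> N \<in> Hom D N (F (G N)) \<and>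
      Comp D (F (G N)) N (F (G N)) (\<beta> N) (\<alpha> N) = Idn D (F (G N)) \<and> Comp D N (F (G N)) N (\<alpha> N) (\<beta> N) = Idn D N"
    by metis
  have GO: "G N \<in> Ob C" "F (G N) \<in> Ob D" and \<alpha>: "\<alpha> N \<in> Hom D (F (G N)) N" and \<beta>: "\<beta> N \<in> Hom D N (F (G N))"
    and \<beta>\<alpha>: "Comp D (F (G N)) N (F (G N)) (\<beta> N) (\<alpha> N) = Idn D (F (G N))"
    and \<alpha>\<beta>: "Comp D N (F (G N)) N (\<alpha> N) (\<beta> N) = Idn D N" if "N \<in> Ob D" for N
    using G[OF that] FO by auto
  \<comment> \<open>The transport of \<open>g\<close> along the chosen isomorphisms,
    \<open>\<beta> L\<close> after \<open>g\<close> after \<open>\<alpha> N\<close>. Its unique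
    preimage under \<open>F'\<close> is the value of the quasi-inverse on \<open>g\<close>.\<close>
  define conj where "conj N L g = Comp D (F (G N)) N (F (G L)) (Comp D N L (F (G L)) (\<beta> L) g) (\<alpha> N)" for N L g
  have conj: "conj N L g \<in> Hom D (F (G N)) (F (G L))" if "N \<in> Ob D" "L \<in> Ob D" "g \<in> Hom D N L" for N L g
    unfolding conj_def using that GO \<alpha> \<beta> by (intro D.comp) auto
  define G' where "G' N L g = lift (G N) (G L) (conj N L g)" for N L g
  have G': "G' N L g \<in> Hom C (G N) (G L)" "F' (G N) (G L) (G' N L g) = conj N L g"
    if "N \<in> Ob D" "L \<in> Ob D" "g \<in> Hom D N L" for N L g
    unfolding G'_def using lift conj that GO by auto
  have conj_id: "conj N N (Idn D N) = Idn D (F (G N))" if "N \<in> Ob D" for N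
    unfolding conj_def using that GO \<alpha> \<beta> \<beta>\<alpha> by (simp add: D.id_right)
  have \<alpha>_conj: "Comp D (F (G N)) (F (G L)) L (\<alpha> L) (conj N L g) = Comp D (F (G N)) N L g (\<alpha> N)"
    if NL: "N \<in> Ob D" "L \<in> Ob D" "g \<in> Hom D N L" for N L g
  proof -
    have "Comp D (F (G N)) (F (G L)) L (\<alpha> L) (conj N L g) =
        Comp D (F (G N)) N L (Comp D N (F (G L)) L (\<alpha> L) (Comp D N L (F (G L)) (\<beta> L) g)) (\<alpha> N)"
      unfolding conj_def using NL GO \<alpha> \<beta> by (subst D.assoc) (auto intro: D.comp)
    also have "Comp D N (F (G L)) L (\<alpha> L) (Comp D N L (F (G L)) (\<beta> L) g) = g"
      using NL GO \<alpha> \<beta> \<alpha>\<beta> by (subst D.assoc[symmetric]) (auto simp: D.id_left)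
    finally show ?thesis .
  qed
  have conj_comp: "conj N K (Comp D N L K g f) = Comp D (F (G N)) (F (G L)) (F (G K)) (conj L K g) (conj N L f)"
    if NL: "N \<in> Ob D" "L \<in> Ob D" "K \<in> Ob D" "f \<in> Hom D N L" "g \<in> Hom D L K" for N L K f g
  proof -
    have "Comp D (F (G N)) (F (G L)) (F (G K)) (conj L K g) (conj N L f) =
        Comp D (F (G N)) L (F (G K)) (Comp D L K (F (G K)) (\<beta> K) g) (Comp D (F (G N)) (F (G L)) L (\<alpha> L) (conj N L f))"
      unfolding conj_def[of L K] using NL GO \<alpha> \<beta> conj by (intro D.assoc) (auto intro: D.comp)
    also have "\<dots> = Comp D (F (G N)) L (F (G K)) (Comp D L K (F (G K)) (\<beta> K) g) (Comp D (F (G N)) N L f (\<alpha> N))"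
      using NL by (simp add: \<alpha>_conj)
    also have "\<dots> = Comp D (F (G N)) N (F (G K)) (Comp D N L (F (G K)) (Comp D L K (F (G K)) (\<beta> K) g) f) (\<alpha> N)"
      using NL GO \<alpha> \<beta> by (intro D.assoc[symmetric]) (auto intro: D.comp)
    also have "\<dots> = conj N K (Comp D N L K g f)"
      unfolding conj_def using NL GO \<alpha> \<beta> by (simp add: D.assoc)
    finally show ?thesis by simp
  qed
  have G_functor: "linear_functor D C G G'"
    unfolding linear_functor_def
  proof (intro conjI ballI allI)
    fix N L f g c assume NL: "N \<in> Ob D" "L \<in> Ob D" "f \<in> Hom D N L"
    show "G' N L (Hom_add D N L f g) = Hom_add C (G N) (G L) (G' N L f) (G' N L g)" if "g \<in> Hom D N L"
    proof (rule inj)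
      show "F' (G N) (G L) (G' N L (Hom_add D N L f g)) = F' (G N) (G L) (Hom_add C (G N) (G L) (G' N L f) (G' N L g))"
        using NL that GO G' \<alpha> \<beta>
        by (simp add: Fadd D.add conj_def D.comp_add_left D.comp_add_right D.comp)
    qed (use NL that GO G' D.add C.add in auto)
    show "G' N L (Hom_scale D N L c f) = Hom_scale C (G N) (G L) c (G' N L f)"
    proof (rule inj)
      show "F' (G N) (G L) (G' N L (Hom_scale D N L c f)) = F' (G N) (G L) (Hom_scale C (G N) (G L) c (G' N L f))"
        using NL GO G' \<alpha> \<beta>
        by (simp add: Fscale D.scale conj_def D.comp_scale_left D.comp_scale_right D.comp)
    qed (use NL GO G' D.scale C.scale in auto)
  next
    fix N assume "N \<in> Ob D"
    then show "G' N N (Idn D N) = Idn C (G N)"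
      using GO G' C.id D.id Fid conj_id by (intro inj) auto
  next
    fix N L K f g assume NL: "N \<in> Ob D" "L \<in> Ob D" "K \<in> Ob D" "f \<in> Hom D N L" "g \<in> Hom D L K"
    show "G' N K (Comp D N L K g f) = Comp C (G N) (G L) (G K) (G' L K g) (G' N L f)"
    proof (rule inj)
      show "F' (G N) (G K) (G' N K (Comp D N L K g f)) = F' (G N) (G K) (Comp C (G N) (G L) (G K) (G' L K g) (G' N L f))"
        using NL GO G' by (simp add: Fcomp D.comp conj_comp)
    qed (use NL GO G' D.comp C.comp in auto)
  qed (use GO G' in auto)
  have \<epsilon>: "natural_iso D D (\<lambda>X. F (G X)) (\<lambda>X Y f. F' (G X) (G Y) (G' X Y f)) (\<lambda>X. X) (\<lambda>X Y f. f) \<alpha>"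
    unfolding natural_iso_def cat_iso_def
  proof (intro conjI ballI)
    show "\<exists>b\<in>Hom D N (F (G N)). Comp D (F (G N)) N (F (G N)) b (\<alpha> N) = Idn D (F (G N)) \<and>
        Comp D N (F (G N)) N (\<alpha> N) b = Idn D N" if "N \<in> Ob D" for N
      using \<beta>[OF that] \<alpha>\<beta>[OF that] \<beta>\<alpha>[OF that] by blast
  qed (simp_all add: \<alpha> G' \<alpha>_conj)
  \<comment> \<open>The unit at \<open>X\<close> lifts \<open>\<beta> (F X)\<close> and its inverse
    lifts \<open>\<alpha> (F X)\<close>; the counit is \<open>\<alpha>\<close> itself.\<close>
  define \<eta> where "\<eta> X = lift X (G (F X)) (\<beta> (F X))" for X
  define \<theta> where "\<theta> X = lift (G (F X)) X (\<alpha> (F X))" for X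
  have \<eta>: "\<eta> X \<in> Hom C X (G (F X))" "F' X (G (F X)) (\<eta> X) = \<beta> (F X)" if "X \<in> Ob C" for X
    unfolding \<eta>_def using lift that FO GO \<beta> by auto
  have \<theta>: "\<theta> X \<in> Hom C (G (F X)) X" "F' (G (F X)) X (\<theta> X) = \<alpha> (F X)" if "X \<in> Ob C" for X
    unfolding \<theta>_def using lift that FO GO \<alpha> by auto
  have iso: "cat_iso C X (G (F X)) (\<eta> X)" if X: "X \<in> Ob C" for X
    unfolding cat_iso_def
  proof (intro conjI bexI[of _ "\<theta> X"])
    show "Comp C X (G (F X)) X (\<theta> X) (\<eta> X) = Idn C X"
      using X FO GO \<eta> \<theta> \<alpha>\<beta> by (intro inj[OF X X]) (auto simp: Fcomp Fid C.comp C.id)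
    show "Comp C (G (F X)) X (G (F X)) (\<eta> X) (\<theta> X) = Idn C (G (F X))"
      using X FO GO \<eta> \<theta> \<beta>\<alpha> by (intro inj[of "G (F X)" "G (F X)"]) (auto simp: Fcomp Fid C.comp C.id)
  qed (use X \<eta> \<theta> in auto)
  have "natural_iso C C (\<lambda>X. X) (\<lambda>X Y f. f) (\<lambda>X. G (F X)) (\<lambda>X Y f. G' (F X) (F Y) (F' X Y f)) \<eta>"
    unfolding natural_iso_def
  proof (intro conjI ballI iso)
    fix X Y f assume XY: "X \<in> Ob C" "Y \<in> Ob C" "f \<in> Hom C X Y"
    note O = FO[OF XY(1)] FO[OF XY(2)] GO(1)[OF FO[OF XY(1)]] GO(1)[OF FO[OF XY(2)]]
      GO(2)[OF FO[OF XY(1)]] GO(2)[OF FO[OF XY(2)]]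
    have f: "F' X Y f \<in> Hom D (F X) (F Y)" using XY FH by auto
    have "Comp D (F X) (F (G (F X))) (F (G (F Y))) (conj (F X) (F Y) (F' X Y f)) (\<beta> (F X)) =
        Comp D (F X) (F X) (F (G (F Y))) (Comp D (F X) (F Y) (F (G (F Y))) (\<beta> (F Y)) (F' X Y f))
          (Comp D (F X) (F (G (F X))) (F X) (\<alpha> (F X)) (\<beta> (F X)))"
      unfolding conj_def using O f \<alpha> \<beta> by (intro D.assoc) (auto intro: D.comp)
    also have "\<dots> = Comp D (F X) (F Y) (F (G (F Y))) (\<beta> (F Y)) (F' X Y f)"
      using O f \<alpha>\<beta> \<beta> by (simp add: D.id_right D.comp)
    finally show "Comp C X (G (F X)) (G (F Y)) (G' (F X) (F Y) (F' X Y f)) (\<eta> X) =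
        Comp C X Y (G (F Y)) (\<eta> Y) f"
      using XY O f \<eta> G' by (intro inj[of X "G (F Y)"]) (auto simp: Fcomp C.comp)
  qed
  then show ?thesis
    unfolding equivalent_cats_def using F G_functor \<epsilon> by blast
qed

section \<open>Categories of left modules\<close>

lemma (in abelian_group) add_exchange:
  "x \<in> carrier G \<Longrightarrow> y \<in> carrier G \<Longrightarrow> z \<in> carrier G \<Longrightarrow> w \<in> carrier G \<Longrightarrow>
    x \<oplus> y \<oplus> (z \<oplus> w) = x \<oplus> z \<oplus> (y \<oplus> w)"
  by (simp add: a_ac)

lemma left_module_facts:
  assumes "left_module A M"
  shows "ring A" "abelian_group M"
    "a \<in> carrier A \<Longrightarrow> x \<in> carrier M \<Longrightarrow> a \<odot>\<^bsub>M\<^esub> x \<in> carrier M"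
    "a \<in> carrier A \<Longrightarrow> b \<in> carrier A \<Longrightarrow> x \<in> carrier M \<Longrightarrow>
      (a \<oplus>\<^bsub>A\<^esub> b) \<odot>\<^bsub>M\<^esub> x = a \<odot>\<^bsub>M\<^esub> x \<oplus>\<^bsub>M\<^esub> b \<odot>\<^bsub>M\<^esub> x"
    "a \<in> carrier A \<Longrightarrow> x \<in> carrier M \<Longrightarrow> y \<in> carrier M \<Longrightarrow>
      a \<odot>\<^bsub>M\<^esub> (x \<oplus>\<^bsub>M\<^esub> y) = a \<odot>\<^bsub>M\<^esub> x \<oplus>\<^bsub>M\<^esub> a \<odot>\<^bsub>M\<^esub> y"
    "a \<in> carrier A \<Longrightarrow> b \<in> carrier A \<Longrightarrow> x \<in> carrier M \<Longrightarrow>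
      (a \<otimes>\<^bsub>A\<^esub> b) \<odot>\<^bsub>M\<^esub> x = a \<odot>\<^bsub>M\<^esub> (b \<odot>\<^bsub>M\<^esub> x)"
    "x \<in> carrier M \<Longrightarrow> \<one>\<^bsub>A\<^esub> \<odot>\<^bsub>M\<^esub> x = x"
    "x \<in> carrier M \<Longrightarrow> y \<in> carrier M \<Longrightarrow> x \<oplus>\<^bsub>M\<^esub> y \<in> carrier M"
    "\<zero>\<^bsub>M\<^esub> \<in> carrier M"
    "x \<in> carrier M \<Longrightarrow> \<zero>\<^bsub>M\<^esub> \<oplus>\<^bsub>M\<^esub> x = x"
    "x \<in> carrier M \<Longrightarrow> y \<in> carrier M \<Longrightarrow> z \<in> carrier M \<Longrightarrow> x \<oplus>\<^bsub>M\<^esub> y \<oplus>\<^bsub>M\<^esub> z = x \<oplus>\<^bsub>M\<^esub> (y \<oplus>\<^bsub>M\<^esub> z)"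
    "x \<in> carrier M \<Longrightarrow> y \<in> carrier M \<Longrightarrow> x \<oplus>\<^bsub>M\<^esub> y = y \<oplus>\<^bsub>M\<^esub> x"
    "a \<in> carrier A \<Longrightarrow> a \<odot>\<^bsub>M\<^esub> \<zero>\<^bsub>M\<^esub> = \<zero>\<^bsub>M\<^esub>"
proof -
  interpret left_module A M by fact
  show "ring A" "abelian_group M" by unfold_locales
  note E = abelian_groupE[OF \<open>abelian_group M\<close>]
  show r: "a \<in> carrier A \<Longrightarrow> x \<in> carrier M \<Longrightarrow> y \<in> carrier M \<Longrightarrow>
      a \<odot>\<^bsub>M\<^esub> (x \<oplus>\<^bsub>M\<^esub> y) = a \<odot>\<^bsub>M\<^esub> x \<oplus>\<^bsub>M\<^esub> a \<odot>\<^bsub>M\<^esub> y" for a x y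
    by (rule smult_r_distr)
  show "a \<in> carrier A \<Longrightarrow> a \<odot>\<^bsub>M\<^esub> \<zero>\<^bsub>M\<^esub> = \<zero>\<^bsub>M\<^esub>"
    using r[of a "\<zero>\<^bsub>M\<^esub>" "\<zero>\<^bsub>M\<^esub>"] E(2,5) smult_closed[of a "\<zero>\<^bsub>M\<^esub>"]
    by (intro abelian_group.add_eq_zeroD[OF \<open>abelian_group M\<close>]) auto
  show "x \<in> carrier M \<Longrightarrow> y \<in> carrier M \<Longrightarrow> x \<oplus>\<^bsub>M\<^esub> y = y \<oplus>\<^bsub>M\<^esub> x"
    by (rule E(4))
  show "x \<in> carrier M \<Longrightarrow> y \<in> carrier M \<Longrightarrow> z \<in> carrier M \<Longrightarrow> x \<oplus>\<^bsub>M\<^esub> y \<oplus>\<^bsub>M\<^esub> z = x \<oplus>\<^bsub>M\<^esub> (y \<oplus>\<^bsub>M\<^esub> z)"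
    by (rule E(3))
  show "x \<in> carrier M \<Longrightarrow> y \<in> carrier M \<Longrightarrow> x \<oplus>\<^bsub>M\<^esub> y \<in> carrier M"
    "\<zero>\<^bsub>M\<^esub> \<in> carrier M" "x \<in> carrier M \<Longrightarrow> \<zero>\<^bsub>M\<^esub> \<oplus>\<^bsub>M\<^esub> x = x"
    by (rule E(1,2,5); assumption)+
qed (use left_module.smult_closed[OF assms] left_module.smult_l_distr[OF assms]
    left_module.smult_assoc[OF assms] left_module.smult_one[OF assms] in auto)

lemma module_homsD:
  assumes "f \<in> module_homs A M N"
  shows "x \<in> carrier M \<Longrightarrow> f x \<in> carrier N" "f \<in> extensional (carrier M)"
    "x \<in> carrier M \<Longrightarrow> y \<in> carrier M \<Longrightarrow> f (x \<oplus>\<^bsub>M\<^esub> y) = f x \<oplus>\<^bsub>N\<^esub> f y"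
    "a \<in> carrier A \<Longrightarrow> x \<in> carrier M \<Longrightarrow> f (a \<odot>\<^bsub>M\<^esub> x) = a \<odot>\<^bsub>N\<^esub> f x"
  using assms by (auto simp: module_homs_def PiE_def)

lemma module_homsI:
  assumes "\<And>x. x \<in> carrier M \<Longrightarrow> f x \<in> carrier N" "f \<in> extensional (carrier M)"
    "\<And>x y. x \<in> carrier M \<Longrightarrow> y \<in> carrier M \<Longrightarrow> f (x \<oplus>\<^bsub>M\<^esub> y) = f x \<oplus>\<^bsub>N\<^esub> f y"
    "\<And>a x. a \<in> carrier A \<Longrightarrow> x \<in> carrier M \<Longrightarrow> f (a \<odot>\<^bsub>M\<^esub> x) = a \<odot>\<^bsub>N\<^esub> f x"
  shows "f \<in> module_homs A M N"
  using assms by (auto simp: module_homs_def PiE_def)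

lemma module_cat_simps [simp]:
  "Ob (module_cat u A) = {M. left_module A M}" "Hom (module_cat u A) = module_homs A"
  "Idn (module_cat u A) M = (\<lambda>x\<in>carrier M. x)"
  "Comp (module_cat u A) L M N g f = compose (carrier L) g f"
  "Hom_add (module_cat u A) M N f g = (\<lambda>x\<in>carrier M. f x \<oplus>\<^bsub>N\<^esub> g x)"
  "Hom_scale (module_cat u A) M N c f = (\<lambda>x\<in>carrier M. (c \<odot>\<^bsub>A\<^esub> \<one>\<^bsub>A\<^esub>) \<odot>\<^bsub>N\<^esub> f x)"
  by (simp_all add: module_cat_def)

lemma linear_category_module_cat:
  assumes "complex_alg A"
  shows "linear_category (module_cat u A)"
proof -
  interpret A: complex_alg A by fact
  show ?thesis
  proof (unfold_locales; simp)
    fix X assume X: "left_module A X"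
    show "(\<lambda>x\<in>carrier X. x) \<in> module_homs A X X"
      using left_module_facts[OF X] by (intro module_homsI) auto
  next
    fix X Y Z f g assume X: "left_module A X" "left_module A Y" "left_module A Z" "f \<in> module_homs A X Y" "g \<in> module_homs A Y Z"
    show "compose (carrier X) g f \<in> module_homs A X Z"
      using left_module_facts[OF X(1)] module_homsD[OF X(4)] module_homsD[OF X(5)]
      by (intro module_homsI) (auto simp: compose_def)
  next
    fix X Y f g assume X: "left_module A X" "left_module A Y" "f \<in> module_homs A X Y" "g \<in> module_homs A X Y"
    note lX = left_module_facts[OF X(1)] and lY = left_module_facts[OF X(2)]
    note f = module_homsD[OF X(3)] and g = module_homsD[OF X(4)]
    show "(\<lambda>x\<in>carrier X. f x \<oplus>\<^bsub>Y\<^esub> g x) \<in> module_homs A X Y"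
    proof (rule module_homsI)
      fix x y assume xy: "x \<in> carrier X" "y \<in> carrier X"
      have "f x \<oplus>\<^bsub>Y\<^esub> f y \<oplus>\<^bsub>Y\<^esub> (g x \<oplus>\<^bsub>Y\<^esub> g y) = f x \<oplus>\<^bsub>Y\<^esub> g x \<oplus>\<^bsub>Y\<^esub> (f y \<oplus>\<^bsub>Y\<^esub> g y)"
        using xy f(1) g(1) by (intro abelian_group.add_exchange[OF lY(2)])
      then show "(\<lambda>x\<in>carrier X. f x \<oplus>\<^bsub>Y\<^esub> g x) (x \<oplus>\<^bsub>X\<^esub> y) =
          (\<lambda>x\<in>carrier X. f x \<oplus>\<^bsub>Y\<^esub> g x) x \<oplus>\<^bsub>Y\<^esub> (\<lambda>x\<in>carrier X. f x \<oplus>\<^bsub>Y\<^esub> g x) y"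
        using xy lX(8) f(3) g(3) by simp
    qed (use lX(3) lY(5,8) f g in auto)
  next
    fix X Y f c assume X: "left_module A X" "left_module A Y" "f \<in> module_homs A X Y"
    note lX = left_module_facts[OF X(1)] and lY = left_module_facts[OF X(2)]
    note f = module_homsD[OF X(3)]
    have c: "c \<odot>\<^bsub>A\<^esub> \<one>\<^bsub>A\<^esub> \<in> carrier A" by simp
    show "(\<lambda>x\<in>carrier X. (c \<odot>\<^bsub>A\<^esub> \<one>\<^bsub>A\<^esub>) \<odot>\<^bsub>Y\<^esub> f x) \<in> module_homs A X Y"
    proof (rule module_homsI)
      fix a x assume ax: "a \<in> carrier A" "x \<in> carrier X"
      \<comment> \<open>The element \<open>c 1\<close> is central, so a scaled homomorphism is still
        linear over \<open>A\<close>.\<close>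
      have "(c \<odot>\<^bsub>A\<^esub> \<one>\<^bsub>A\<^esub>) \<odot>\<^bsub>Y\<^esub> (a \<odot>\<^bsub>Y\<^esub> f x) = a \<odot>\<^bsub>Y\<^esub> ((c \<odot>\<^bsub>A\<^esub> \<one>\<^bsub>A\<^esub>) \<odot>\<^bsub>Y\<^esub> f x)"
        using ax f(1) c by (simp flip: lY(6) A.smult_eq_mult_left A.smult_eq_mult_right)
      then show "(\<lambda>x\<in>carrier X. (c \<odot>\<^bsub>A\<^esub> \<one>\<^bsub>A\<^esub>) \<odot>\<^bsub>Y\<^esub> f x) (a \<odot>\<^bsub>X\<^esub> x) =
          a \<odot>\<^bsub>Y\<^esub> (\<lambda>x\<in>carrier X. (c \<odot>\<^bsub>A\<^esub> \<one>\<^bsub>A\<^esub>) \<odot>\<^bsub>Y\<^esub> f x) x"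
        using ax lX(3) f(4) by simp
    qed (use lX(8) lY(3,5) f c in auto)
  next
    fix X Y f assume X: "left_module A X" "left_module A Y" "f \<in> module_homs A X Y"
    show "compose (carrier X) (\<lambda>x\<in>carrier Y. x) f = f" "compose (carrier X) f (\<lambda>x\<in>carrier X. x) = f"
      using module_homsD[OF X(3)] by (auto intro!: extensionalityI[where A = "carrier X"] simp: compose_def)
  next
    fix X Y Z W f g h assume f: "f \<in> module_homs A X Y" and g: "g \<in> module_homs A Y Z" and h: "h \<in> module_homs A Z W"
    show "compose (carrier X) (compose (carrier Y) h g) f = compose (carrier X) h (compose (carrier X) g f)"
      using module_homsD(1)[OF f] by (auto intro!: extensionalityI[where A = "carrier X"] simp: compose_def)
  next
    fix X Y Z f g h assume f: "f \<in> module_homs A X Y"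
    show "compose (carrier X) (\<lambda>x\<in>carrier Y. g x \<oplus>\<^bsub>Z\<^esub> h x) f =
        (\<lambda>x\<in>carrier X. compose (carrier X) g f x \<oplus>\<^bsub>Z\<^esub> compose (carrier X) h f x)"
      using module_homsD(1)[OF f] by (auto intro!: extensionalityI[where A = "carrier X"] simp: compose_def)
  next
    fix X Y Z f g h assume f: "f \<in> module_homs A X Y" and g: "g \<in> module_homs A X Y" and h: "h \<in> module_homs A Y Z"
    show "compose (carrier X) h (\<lambda>x\<in>carrier X. f x \<oplus>\<^bsub>Y\<^esub> g x) =
        (\<lambda>x\<in>carrier X. compose (carrier X) h f x \<oplus>\<^bsub>Z\<^esub> compose (carrier X) h g x)"
      using module_homsD(1)[OF f] module_homsD(1)[OF g] module_homsD(3)[OF h] by (auto intro!: extensionalityI[where A = "carrier X"] simp: compose_def)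
  next
    fix X Y Z f g c assume f: "f \<in> module_homs A X Y"
    show "compose (carrier X) (\<lambda>x\<in>carrier Y. (c \<odot>\<^bsub>A\<^esub> \<one>\<^bsub>A\<^esub>) \<odot>\<^bsub>Z\<^esub> g x) f =
        (\<lambda>x\<in>carrier X. (c \<odot>\<^bsub>A\<^esub> \<one>\<^bsub>A\<^esub>) \<odot>\<^bsub>Z\<^esub> compose (carrier X) g f x)"
      using module_homsD(1)[OF f] by (auto intro!: extensionalityI[where A = "carrier X"] simp: compose_def)
  next
    fix X Y Z f g c assume f: "f \<in> module_homs A X Y" and g: "g \<in> module_homs A Y Z"
    show "compose (carrier X) g (\<lambda>x\<in>carrier X. (c \<odot>\<^bsub>A\<^esub> \<one>\<^bsub>A\<^esub>) \<odot>\<^bsub>Y\<^esub> f x) =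
        (\<lambda>x\<in>carrier X. (c \<odot>\<^bsub>A\<^esub> \<one>\<^bsub>A\<^esub>) \<odot>\<^bsub>Z\<^esub> compose (carrier X) g f x)"
      using module_homsD(1)[OF f] module_homsD(4)[OF g] by (auto intro!: extensionalityI[where A = "carrier X"] simp: compose_def)
  qed
qed

lemma cat_iso_module_catI:
  assumes M: "left_module A M" and N: "left_module A N"
    and f: "f \<in> module_homs A M N" and bij: "bij_betw f (carrier M) (carrier N)"
  shows "cat_iso (module_cat u A) M N f"
proof -
  note lM = left_module_facts[OF M] and lN = left_module_facts[OF N] and fh = module_homsD[OF f]
  define g where "g = (\<lambda>y\<in>carrier N. inv_into (carrier M) f y)"
  have g: "g y \<in> carrier M" "f (g y) = y" if "y \<in> carrier N" for y
    using bij that by (auto simp: g_def bij_betw_def inv_into_into f_inv_into_f)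
  have gf: "g (f x) = x" if "x \<in> carrier M" for x
    using bij that fh(1) by (auto simp: g_def bij_betw_def)
  have "g \<in> module_homs A N M"
  proof (rule module_homsI)
    fix x y assume "x \<in> carrier N" "y \<in> carrier N"
    then show "g (x \<oplus>\<^bsub>N\<^esub> y) = g x \<oplus>\<^bsub>M\<^esub> g y"
      using gf[of "g x \<oplus>\<^bsub>M\<^esub> g y"] g lM(8) fh(3) by simp
  next
    fix a y assume "a \<in> carrier A" "y \<in> carrier N"
    then show "g (a \<odot>\<^bsub>N\<^esub> y) = a \<odot>\<^bsub>M\<^esub> g y"
      using gf[of "a \<odot>\<^bsub>M\<^esub> g y"] g lM(3) fh(4) by simp
  qed (use g in \<open>auto simp: g_def\<close>)
  then show ?thesis
    unfolding cat_iso_def using f g gf fh(1)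
    by (auto simp: compose_def intro!: bexI[of _ g] restrict_ext)
qed

text \<open>Induction from the equipotency of \<open>X \<times> X\<close> with \<open>X\<close> for
  infinite \<open>X\<close>: the last value of a function is paired with the code of its restriction
  to the earlier indices.\<close>

lemma PiE_embedding:
  fixes X :: "'m set"
  assumes "infinite X"
  shows "\<exists>j :: (nat \<Rightarrow> 'm) \<Rightarrow> 'm. inj_on j ({..<n} \<rightarrow>\<^sub>E X) \<and> j ` ({..<n} \<rightarrow>\<^sub>E X) \<subseteq> X"
proof (induction n)
  case 0
  obtain x where "x \<in> X" using assms by fastforce
  then show ?case by (intro exI[of _ "\<lambda>_. x"]) auto
next
  case (Suc n)
  then obtain j :: "(nat \<Rightarrow> 'm) \<Rightarrow> 'm" where j: "inj_on j ({..<n} \<rightarrow>\<^sub>E X)" "j ` ({..<n} \<rightarrow>\<^sub>E X) \<subseteq> X"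
    by blast
  obtain p where p: "bij_betw p (X \<times> X) X"
    using card_of_Times_same_infinite[OF assms] card_of_ordIso[of "X \<times> X" X] by auto
  let ?k = "\<lambda>f. p (f n, j (restrict f {..<n}))"
  have r: "restrict f {..<n} \<in> {..<n} \<rightarrow>\<^sub>E X" "f n \<in> X" if "f \<in> {..<Suc n} \<rightarrow>\<^sub>E X" for f
    using PiE_mem[OF that] by (simp_all add: restrict_PiE_iff)
  have "inj_on ?k ({..<Suc n} \<rightarrow>\<^sub>E X)"
  proof (rule inj_onI)
    fix f g assume f: "f \<in> {..<Suc n} \<rightarrow>\<^sub>E X" and g: "g \<in> {..<Suc n} \<rightarrow>\<^sub>E X" and "?k f = ?k g"
    then have "(f n, j (restrict f {..<n})) = (g n, j (restrict g {..<n}))"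
      using p r[OF f] r[OF g] j(2) by (intro inj_onD[OF bij_betw_imp_inj_on[OF p]]) auto
    then have eq: "f n = g n" "restrict f {..<n} = restrict g {..<n}"
      using inj_onD[OF j(1)] r[OF f] r[OF g] by auto
    show "f = g"
    proof (rule PiE_ext[OF f g])
      fix i assume "i \<in> {..<Suc n}"
      then show "f i = g i"
        using eq(1) fun_cong[OF eq(2), of i] by (cases "i = n") auto
    qed
  qed
  moreover have "?k ` ({..<Suc n} \<rightarrow>\<^sub>E X) \<subseteq> X"
  proof (rule image_subsetI)
    fix f assume f: "f \<in> {..<Suc n} \<rightarrow>\<^sub>E X"
    have "(f n, j (restrict f {..<n})) \<in> X \<times> X"
      using r(2)[OF f] subsetD[OF j(2) imageI[OF r(1)[OF f]]] by simp
    then show "?k f \<in> X"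
      by (rule bij_betw_apply[OF p])
  qed
  ultimately have "inj_on ?k ({..<Suc n} \<rightarrow>\<^sub>E X) \<and> ?k ` ({..<Suc n} \<rightarrow>\<^sub>E X) \<subseteq> X" ..
  then show ?case by (rule exI[where x = ?k])
qed

section \<open>Modules over a full corner\<close>

lemma (in abelian_group) add_right_eqD: "x \<in> carrier G \<Longrightarrow> y \<in> carrier G \<Longrightarrow> x \<oplus> y = y \<Longrightarrow> x = \<zero>"
  using add.r_cancel_one by auto

locale full_idempotent = corner_iso A B \<epsilon> \<iota>
  for A :: "(complex, 'a) module" and B :: "(complex, 'b) module" and \<epsilon> \<iota> +
  fixes n :: nat and P Q :: "nat \<Rightarrow> 'a"
  assumes P [simp]: "P i \<in> carrier A" and Q [simp]: "Q i \<in> carrier A"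
    and full: "finsum A (\<lambda>i. P i \<otimes>\<^bsub>A\<^esub> \<epsilon> \<otimes>\<^bsub>A\<^esub> Q i) {..<n} = \<one>\<^bsub>A\<^esub>"
begin

definition corner_mod :: "('a, 'm) module \<Rightarrow> ('b, 'm) module" where
  "corner_mod M = \<lparr>carrier = {x \<in> carrier M. \<epsilon> \<odot>\<^bsub>M\<^esub> x = x}, mult = mult M, one = one M,
     zero = zero M, add = add M, smult = (\<lambda>b. smult M (\<iota> b))\<rparr>"

lemma corner_mod_simps [simp]:
  "carrier (corner_mod M) = {x \<in> carrier M. \<epsilon> \<odot>\<^bsub>M\<^esub> x = x}"
  "zero (corner_mod M) = zero M" "add (corner_mod M) = add M"
  "smult (corner_mod M) = (\<lambda>b. smult M (\<iota> b))"
  by (simp_all add: corner_mod_def)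

lemma corner_left_module:
  assumes M: "left_module A M"
  shows "left_module B (corner_mod M)"
proof -
  note lM = left_module_facts[OF M]
  have ab: "abelian_group (corner_mod M)"
  proof (rule abelian_groupI)
    show "\<exists>y\<in>carrier (corner_mod M). y \<oplus>\<^bsub>corner_mod M\<^esub> x = \<zero>\<^bsub>corner_mod M\<^esub>"
      if "x \<in> carrier (corner_mod M)" for x
    proof -
      have x: "x \<in> carrier M" "\<epsilon> \<odot>\<^bsub>M\<^esub> x = x" using that by auto
      obtain y where y: "y \<in> carrier M" "y \<oplus>\<^bsub>M\<^esub> x = \<zero>\<^bsub>M\<^esub>"
        using abelian_groupE(6)[OF lM(2) x(1)] by blast
      \<comment> \<open>Applying \<open>\<epsilon>\<close> to a negative of \<open>x\<close> gives a
        negative that visibly lies in the corner module.\<close>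
      have "\<epsilon> \<odot>\<^bsub>M\<^esub> y \<oplus>\<^bsub>M\<^esub> x = \<epsilon> \<odot>\<^bsub>M\<^esub> (y \<oplus>\<^bsub>M\<^esub> x)"
        using lM(5)[OF eps(1) y(1) x(1)] x(2) by simp
      then have "\<epsilon> \<odot>\<^bsub>M\<^esub> y \<oplus>\<^bsub>M\<^esub> x = \<zero>\<^bsub>M\<^esub>"
        using y by (simp add: lM(13))
      moreover have "\<epsilon> \<odot>\<^bsub>M\<^esub> (\<epsilon> \<odot>\<^bsub>M\<^esub> y) = \<epsilon> \<odot>\<^bsub>M\<^esub> y"
        using y by (simp flip: lM(6))
      ultimately show ?thesis
        using y by (intro bexI[of _ "\<epsilon> \<odot>\<^bsub>M\<^esub> y"]) (auto simp: lM(3))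
    qed
  qed (auto simp: lM(5,8,9,10,11,13) intro: lM(12))
  have "\<epsilon> \<odot>\<^bsub>M\<^esub> (\<iota> b \<odot>\<^bsub>M\<^esub> x) = \<iota> b \<odot>\<^bsub>M\<^esub> x" if "b \<in> carrier B" "x \<in> carrier M" for b x
    using that lM(6)[of \<epsilon> "\<iota> b" x] by (simp add: iota_eps)
  then have "left_module_axioms B (corner_mod M)"
    by (intro left_module_axioms.intro) (auto simp: lM(3-6) iota)
  then show ?thesis
    using ab T'.ring_A by (simp add: left_module_def)
qed

text \<open>The decomposition of 1 applied to \<open>x\<close> shows that
  \<open>\<epsilon> M\<close> generates \<open>M\<close>. Both faithfulness and the formula for
  extending homomorphisms come from it.\<close>

lemma expand:
  assumes M: "left_module A M" and x: "x \<in> carrier M"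
  shows "finsum M (\<lambda>i. P i \<odot>\<^bsub>M\<^esub> ((\<epsilon> \<otimes>\<^bsub>A\<^esub> Q i) \<odot>\<^bsub>M\<^esub> x)) {..<n} = x"
proof -
  note lM = left_module_facts[OF M]
  have "x = finsum A (\<lambda>i. P i \<otimes>\<^bsub>A\<^esub> \<epsilon> \<otimes>\<^bsub>A\<^esub> Q i) {..<n} \<odot>\<^bsub>M\<^esub> x"
    using x by (simp add: full lM(7))
  also have "\<dots> = finsum M (\<lambda>i. (P i \<otimes>\<^bsub>A\<^esub> \<epsilon> \<otimes>\<^bsub>A\<^esub> Q i) \<odot>\<^bsub>M\<^esub> x) {..<n}"
    using x by (intro finsum_additive[OF T.abelian_group_A lM(2)]) (auto simp: lM(3,4))
  also have "(\<lambda>i. (P i \<otimes>\<^bsub>A\<^esub> \<epsilon> \<otimes>\<^bsub>A\<^esub> Q i) \<odot>\<^bsub>M\<^esub> x) = (\<lambda>i. P i \<odot>\<^bsub>M\<^esub> ((\<epsilon> \<otimes>\<^bsub>A\<^esub> Q i) \<odot>\<^bsub>M\<^esub> x))"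
    using x by (simp add: T.A_m_assoc lM(6))
  finally show ?thesis by simp
qed

lemma eQ_closed:
  assumes M: "left_module A M" and x: "x \<in> carrier M"
  shows "(\<epsilon> \<otimes>\<^bsub>A\<^esub> Q i) \<odot>\<^bsub>M\<^esub> x \<in> carrier (corner_mod M)"
  using x left_module_facts(3,6)[OF M] by (auto simp flip: T.A_m_assoc) (metis T.A_m_closed Q T.A_m_assoc eps)

lemma restrict_hom:
  assumes M: "left_module A M" and N: "left_module A N" and f: "f \<in> module_homs A M N"
  shows "restrict f (carrier (corner_mod M)) \<in> module_homs B (corner_mod M) (corner_mod N)"
proof -
  note lM = left_module_facts[OF M] and fh = module_homsD[OF f]
  have "\<epsilon> \<odot>\<^bsub>N\<^esub> f x = f x" if "x \<in> carrier M" "\<epsilon> \<odot>\<^bsub>M\<^esub> x = x" for x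
    using fh(4)[of \<epsilon> x] that by simp
  moreover have "\<epsilon> \<odot>\<^bsub>M\<^esub> (\<iota> b \<odot>\<^bsub>M\<^esub> x) = \<iota> b \<odot>\<^bsub>M\<^esub> x" if "b \<in> carrier B" "x \<in> carrier M" for b x
    using that lM(6)[of \<epsilon> "\<iota> b" x] by (simp add: iota_eps)
  ultimately show ?thesis
    by (intro module_homsI) (auto simp: fh lM(3,5,8))
qed

lemma restrict_inj:
  assumes M: "left_module A M" and N: "left_module A N"
    and f: "f \<in> module_homs A M N" and g: "g \<in> module_homs A M N"
    and eq: "restrict f (carrier (corner_mod M)) = restrict g (carrier (corner_mod M))"
  shows "f = g"
proof (rule extensionalityI)
  note lM = left_module_facts[OF M] and lN = left_module_facts[OF N]
  have *: "h x = finsum N (\<lambda>i. P i \<odot>\<^bsub>N\<^esub> h ((\<epsilon> \<otimes>\<^bsub>A\<^esub> Q i) \<odot>\<^bsub>M\<^esub> x)) {..<n}"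
    if h: "h \<in> module_homs A M N" and x: "x \<in> carrier M" for h x
  proof -
    note hh = module_homsD[OF h]
    have "h x = h (finsum M (\<lambda>i. P i \<odot>\<^bsub>M\<^esub> ((\<epsilon> \<otimes>\<^bsub>A\<^esub> Q i) \<odot>\<^bsub>M\<^esub> x)) {..<n})"
      by (simp add: expand[OF M x])
    also have "\<dots> = finsum N (\<lambda>i. h (P i \<odot>\<^bsub>M\<^esub> ((\<epsilon> \<otimes>\<^bsub>A\<^esub> Q i) \<odot>\<^bsub>M\<^esub> x))) {..<n}"
      using hh lM(3) x by (intro finsum_additive[OF lM(2) lN(2)]) auto
    finally show ?thesis
      using hh(4) lM(3) x by simp
  qed
  fix x assume x: "x \<in> carrier M"
  have "f y = g y" if "y \<in> carrier (corner_mod M)" for y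
    using fun_cong[OF eq, of y] that by auto
  then show "f x = g x"
    using *[OF f x] *[OF g x] eQ_closed[OF M x] by auto
qed (use module_homsD(2) f g in auto)

text \<open>By \<open>expand\<close> the extension has to be the sum of the
  \<open>P_i g(\<epsilon> Q_i x)\<close>. For linearity over \<open>A\<close>,
  \<open>\<epsilon> Q_i a x\<close> is the sum over \<open>j\<close> of
  \<open>(\<epsilon> Q_i a P_j \<epsilon>)(\<epsilon> Q_j x)\<close>; the coefficients come from
  \<open>B\<close>, so \<open>g\<close> passes them, and summing over \<open>i\<close> gives
  \<open>a f(x)\<close>.\<close>

lemma restrict_surj:
  assumes M: "left_module A M" and N: "left_module A N"
    and g: "g \<in> module_homs B (corner_mod M) (corner_mod N)"
  shows "\<exists>f\<in>module_homs A M N. g = restrict f (carrier (corner_mod M))"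
proof -
  note lM = left_module_facts[OF M] and lN = left_module_facts[OF N] and gh = module_homsD[OF g]
  have gN: "g x \<in> carrier N" "\<epsilon> \<odot>\<^bsub>N\<^esub> g x = g x" if "x \<in> carrier (corner_mod M)" for x
    using gh(1)[OF that] by auto
  have eQ: "(\<epsilon> \<otimes>\<^bsub>A\<^esub> Q i) \<odot>\<^bsub>M\<^esub> x \<in> carrier (corner_mod M)" if "x \<in> carrier M" for i x
    using eQ_closed[OF M that] .
  define f where "f = (\<lambda>x\<in>carrier M. finsum N (\<lambda>i. P i \<odot>\<^bsub>N\<^esub> g ((\<epsilon> \<otimes>\<^bsub>A\<^esub> Q i) \<odot>\<^bsub>M\<^esub> x)) {..<n})"
  have summand: "P i \<odot>\<^bsub>N\<^esub> g ((\<epsilon> \<otimes>\<^bsub>A\<^esub> Q i) \<odot>\<^bsub>M\<^esub> x) \<in> carrier N" if "x \<in> carrier M" for i x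
    using lN(3) gN(1)[OF eQ[OF that]] by simp
  have fin: "finsum N h {..<n} \<in> carrier N" if "\<And>i. h i \<in> carrier N" for h
    using that by (intro abelian_monoid.finsum_closed abelian_group.axioms(1)[OF lN(2)]) auto
  have f_closed: "f x \<in> carrier N" if "x \<in> carrier M" for x
    using fin[OF summand[OF that]] that by (simp add: f_def)
  have smult_finsum: "a \<odot>\<^bsub>N\<^esub> finsum N h {..<n} = finsum N (\<lambda>i. a \<odot>\<^bsub>N\<^esub> h i) {..<n}"
    if "a \<in> carrier A" "\<And>i. h i \<in> carrier N" for a h
    using that lN(3,5) by (intro finsum_additive[OF lN(2) lN(2)]) auto
  have collect: "finsum N (\<lambda>i. (P i \<otimes>\<^bsub>A\<^esub> \<epsilon> \<otimes>\<^bsub>A\<^esub> Q i) \<odot>\<^bsub>N\<^esub> y) {..<n} = y" if "y \<in> carrier N" for y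
  proof -
    have "(\<lambda>i. (P i \<otimes>\<^bsub>A\<^esub> \<epsilon> \<otimes>\<^bsub>A\<^esub> Q i) \<odot>\<^bsub>N\<^esub> y) = (\<lambda>i. P i \<odot>\<^bsub>N\<^esub> ((\<epsilon> \<otimes>\<^bsub>A\<^esub> Q i) \<odot>\<^bsub>N\<^esub> y))"
      using that by (simp add: T.A_m_assoc lN(6))
    then show ?thesis using expand[OF N that] by simp
  qed
  have f_hom: "f \<in> module_homs A M N"
  proof (rule module_homsI)
    fix x y assume xy: "x \<in> carrier M" "y \<in> carrier M"
    have "f (x \<oplus>\<^bsub>M\<^esub> y) = finsum N (\<lambda>i. P i \<odot>\<^bsub>N\<^esub> g ((\<epsilon> \<otimes>\<^bsub>A\<^esub> Q i) \<odot>\<^bsub>M\<^esub> x) \<oplus>\<^bsub>N\<^esub>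
        P i \<odot>\<^bsub>N\<^esub> g ((\<epsilon> \<otimes>\<^bsub>A\<^esub> Q i) \<odot>\<^bsub>M\<^esub> y)) {..<n}"
      using xy gh(3)[OF eQ[OF xy(1)] eQ[OF xy(2)]] gN(1)[OF eQ[OF xy(1)]] gN(1)[OF eQ[OF xy(2)]]
      by (simp add: f_def lM(5,8) lN(5))
    also have "\<dots> = f x \<oplus>\<^bsub>N\<^esub> f y"
      using xy summand by (subst abelian_monoid.finsum_addf[OF abelian_group.axioms(1)[OF lN(2)]]) (auto simp: f_def)
    finally show "f (x \<oplus>\<^bsub>M\<^esub> y) = f x \<oplus>\<^bsub>N\<^esub> f y" .
  next
    fix a x assume a: "a \<in> carrier A" and x: "x \<in> carrier M"
    let ?g = "\<lambda>j. g ((\<epsilon> \<otimes>\<^bsub>A\<^esub> Q j) \<odot>\<^bsub>M\<^esub> x)"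
    have gj: "?g j \<in> carrier N" "\<epsilon> \<odot>\<^bsub>N\<^esub> ?g j = ?g j" for j
      using gN[OF eQ[OF x]] by auto
    have "P i \<odot>\<^bsub>N\<^esub> g ((\<epsilon> \<otimes>\<^bsub>A\<^esub> Q i) \<odot>\<^bsub>M\<^esub> (a \<odot>\<^bsub>M\<^esub> x)) = (P i \<otimes>\<^bsub>A\<^esub> \<epsilon> \<otimes>\<^bsub>A\<^esub> Q i) \<odot>\<^bsub>N\<^esub> (a \<odot>\<^bsub>N\<^esub> f x)" for i
    proof -
      have "\<exists>b\<in>carrier B. \<epsilon> \<otimes>\<^bsub>A\<^esub> (Q i \<otimes>\<^bsub>A\<^esub> a \<otimes>\<^bsub>A\<^esub> P j) \<otimes>\<^bsub>A\<^esub> \<epsilon> = \<iota> b" for j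
        using a by (intro iota_surj corner_mem) auto
      then obtain b where b: "\<And>j. b j \<in> carrier B" "\<And>j. \<epsilon> \<otimes>\<^bsub>A\<^esub> (Q i \<otimes>\<^bsub>A\<^esub> a \<otimes>\<^bsub>A\<^esub> P j) \<otimes>\<^bsub>A\<^esub> \<epsilon> = \<iota> (b j)"
        by metis
      have ee: "\<epsilon> \<otimes>\<^bsub>A\<^esub> (\<epsilon> \<otimes>\<^bsub>A\<^esub> z) = \<epsilon> \<otimes>\<^bsub>A\<^esub> z" if "z \<in> carrier A" for z
        using that by (simp flip: T.A_m_assoc)
      have bQ: "(\<epsilon> \<otimes>\<^bsub>A\<^esub> Q i) \<odot>\<^bsub>M\<^esub> (a \<odot>\<^bsub>M\<^esub> (P j \<odot>\<^bsub>M\<^esub> ((\<epsilon> \<otimes>\<^bsub>A\<^esub> Q j) \<odot>\<^bsub>M\<^esub> x))) =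
          \<iota> (b j) \<odot>\<^bsub>M\<^esub> ((\<epsilon> \<otimes>\<^bsub>A\<^esub> Q j) \<odot>\<^bsub>M\<^esub> x)" for j
        using a x by (simp add: b(2)[symmetric] ee T.A_m_assoc lM(3) flip: lM(6))
      have "(\<epsilon> \<otimes>\<^bsub>A\<^esub> Q i) \<odot>\<^bsub>M\<^esub> (a \<odot>\<^bsub>M\<^esub> x) =
          (\<epsilon> \<otimes>\<^bsub>A\<^esub> Q i) \<odot>\<^bsub>M\<^esub> (a \<odot>\<^bsub>M\<^esub> finsum M (\<lambda>j. P j \<odot>\<^bsub>M\<^esub> ((\<epsilon> \<otimes>\<^bsub>A\<^esub> Q j) \<odot>\<^bsub>M\<^esub> x)) {..<n})"
        by (simp add: expand[OF M x])
      also have "\<dots> = finsum M (\<lambda>j. \<iota> (b j) \<odot>\<^bsub>M\<^esub> ((\<epsilon> \<otimes>\<^bsub>A\<^esub> Q j) \<odot>\<^bsub>M\<^esub> x)) {..<n}"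
        unfolding bQ[symmetric] using a x lM(3,5,8)
        by (intro finsum_additive[OF lM(2) lM(2), where f = "\<lambda>y. (\<epsilon> \<otimes>\<^bsub>A\<^esub> Q i) \<odot>\<^bsub>M\<^esub> (a \<odot>\<^bsub>M\<^esub> y)"]) auto
      \<comment> \<open>The sum is read inside \<open>\<epsilon> M\<close>, the domain of
        \<open>g\<close>, so that additivity of \<open>g\<close> applies.\<close>
      also have "\<dots> = finsum (corner_mod M) (\<lambda>j. \<iota> (b j) \<odot>\<^bsub>M\<^esub> ((\<epsilon> \<otimes>\<^bsub>A\<^esub> Q j) \<odot>\<^bsub>M\<^esub> x)) {..<n}"
        using left_module_facts(3)[OF corner_left_module[OF M] b(1) eQ[OF x]]
        by (intro finsum_additive[where f = "\<lambda>y. y" and G = "corner_mod M" and H = M, symmetric]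
            left_module_facts(2)[OF corner_left_module[OF M]] lM(2)) auto
      finally have "g ((\<epsilon> \<otimes>\<^bsub>A\<^esub> Q i) \<odot>\<^bsub>M\<^esub> (a \<odot>\<^bsub>M\<^esub> x)) =
          g (finsum (corner_mod M) (\<lambda>j. \<iota> (b j) \<odot>\<^bsub>M\<^esub> ((\<epsilon> \<otimes>\<^bsub>A\<^esub> Q j) \<odot>\<^bsub>M\<^esub> x)) {..<n})"
        by simp
      also have "\<dots> = finsum N (\<lambda>j. g (\<iota> (b j) \<odot>\<^bsub>M\<^esub> ((\<epsilon> \<otimes>\<^bsub>A\<^esub> Q j) \<odot>\<^bsub>M\<^esub> x))) {..<n}"
        using left_module_facts(3)[OF corner_left_module[OF M] b(1) eQ[OF x]] gN(1) gh(3)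
        by (intro finsum_additive[OF left_module_facts(2)[OF corner_left_module[OF M]] lN(2)]) auto
      also have "(\<lambda>j. g (\<iota> (b j) \<odot>\<^bsub>M\<^esub> ((\<epsilon> \<otimes>\<^bsub>A\<^esub> Q j) \<odot>\<^bsub>M\<^esub> x))) = (\<lambda>j. (\<epsilon> \<otimes>\<^bsub>A\<^esub> Q i) \<odot>\<^bsub>N\<^esub> (a \<odot>\<^bsub>N\<^esub> (P j \<odot>\<^bsub>N\<^esub> ?g j)))"
      proof
        fix j
        have "g (\<iota> (b j) \<odot>\<^bsub>M\<^esub> ((\<epsilon> \<otimes>\<^bsub>A\<^esub> Q j) \<odot>\<^bsub>M\<^esub> x)) = \<iota> (b j) \<odot>\<^bsub>N\<^esub> ?g j"
          using gh(4)[OF b(1) eQ[OF x]] by simp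
        also have "\<dots> = ((\<epsilon> \<otimes>\<^bsub>A\<^esub> Q i \<otimes>\<^bsub>A\<^esub> a \<otimes>\<^bsub>A\<^esub> P j) \<otimes>\<^bsub>A\<^esub> \<epsilon>) \<odot>\<^bsub>N\<^esub> ?g j"
          using a by (simp add: b(2)[symmetric] T.A_m_assoc)
        also have "\<dots> = (\<epsilon> \<otimes>\<^bsub>A\<^esub> Q i \<otimes>\<^bsub>A\<^esub> a \<otimes>\<^bsub>A\<^esub> P j) \<odot>\<^bsub>N\<^esub> ?g j"
          using a gj[of j] lN(6)[of "\<epsilon> \<otimes>\<^bsub>A\<^esub> Q i \<otimes>\<^bsub>A\<^esub> a \<otimes>\<^bsub>A\<^esub> P j" \<epsilon> "?g j"] by simp
        also have "\<dots> = (\<epsilon> \<otimes>\<^bsub>A\<^esub> Q i) \<odot>\<^bsub>N\<^esub> (a \<odot>\<^bsub>N\<^esub> (P j \<odot>\<^bsub>N\<^esub> ?g j))"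
          using a gj(1)[of j] by (simp add: lN(3,6))
        finally show "g (\<iota> (b j) \<odot>\<^bsub>M\<^esub> ((\<epsilon> \<otimes>\<^bsub>A\<^esub> Q j) \<odot>\<^bsub>M\<^esub> x)) = (\<epsilon> \<otimes>\<^bsub>A\<^esub> Q i) \<odot>\<^bsub>N\<^esub> (a \<odot>\<^bsub>N\<^esub> (P j \<odot>\<^bsub>N\<^esub> ?g j))" .
      qed
      also have "finsum N (\<lambda>j. (\<epsilon> \<otimes>\<^bsub>A\<^esub> Q i) \<odot>\<^bsub>N\<^esub> (a \<odot>\<^bsub>N\<^esub> (P j \<odot>\<^bsub>N\<^esub> ?g j))) {..<n} = (\<epsilon> \<otimes>\<^bsub>A\<^esub> Q i) \<odot>\<^bsub>N\<^esub> (a \<odot>\<^bsub>N\<^esub> f x)"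
        using a x summand lN(3) by (simp add: f_def smult_finsum)
      finally show ?thesis
        using a f_closed[OF x] by (simp add: T.A_m_assoc lN(3,6))
    qed
    then have "f (a \<odot>\<^bsub>M\<^esub> x) = finsum N (\<lambda>i. (P i \<otimes>\<^bsub>A\<^esub> \<epsilon> \<otimes>\<^bsub>A\<^esub> Q i) \<odot>\<^bsub>N\<^esub> (a \<odot>\<^bsub>N\<^esub> f x)) {..<n}"
      using a x lM(3) by (simp add: f_def)
    then show "f (a \<odot>\<^bsub>M\<^esub> x) = a \<odot>\<^bsub>N\<^esub> f x"
      using a f_closed[OF x] by (simp add: collect lN(3))
  qed (use f_closed in \<open>auto simp: f_def\<close>)
  have "g x = f x" if x: "x \<in> carrier (corner_mod M)" for x
  proof -
    have xM: "x \<in> carrier M" "\<epsilon> \<odot>\<^bsub>M\<^esub> x = x" using x by auto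
    \<comment> \<open>On an element fixed by \<open>\<epsilon>\<close>,
      \<open>\<epsilon> Q_i x = (\<epsilon> Q_i \<epsilon>) x\<close> is a multiple of
      \<open>x\<close> by an element of \<open>B\<close>, and \<open>g\<close> passes it.\<close>
    have "P i \<odot>\<^bsub>N\<^esub> g ((\<epsilon> \<otimes>\<^bsub>A\<^esub> Q i) \<odot>\<^bsub>M\<^esub> x) = (P i \<otimes>\<^bsub>A\<^esub> \<epsilon> \<otimes>\<^bsub>A\<^esub> Q i) \<odot>\<^bsub>N\<^esub> g x" for i
    proof -
      obtain b where b: "b \<in> carrier B" "\<epsilon> \<otimes>\<^bsub>A\<^esub> Q i \<otimes>\<^bsub>A\<^esub> \<epsilon> = \<iota> b"
        using iota_surj[OF corner_mem, of "Q i"] by auto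
      have "(\<epsilon> \<otimes>\<^bsub>A\<^esub> Q i) \<odot>\<^bsub>M\<^esub> x = \<iota> b \<odot>\<^bsub>M\<^esub> x"
        using xM lM(6)[of "\<epsilon> \<otimes>\<^bsub>A\<^esub> Q i" \<epsilon> x] by (simp add: b(2))
      then have "g ((\<epsilon> \<otimes>\<^bsub>A\<^esub> Q i) \<odot>\<^bsub>M\<^esub> x) = (\<epsilon> \<otimes>\<^bsub>A\<^esub> Q i \<otimes>\<^bsub>A\<^esub> \<epsilon>) \<odot>\<^bsub>N\<^esub> g x"
        using gh(4)[OF b(1) x] by (simp add: b(2))
      also have "\<dots> = (\<epsilon> \<otimes>\<^bsub>A\<^esub> Q i) \<odot>\<^bsub>N\<^esub> g x"
        using gN[OF x] lN(6)[of "\<epsilon> \<otimes>\<^bsub>A\<^esub> Q i" \<epsilon> "g x"] by simp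
      finally show ?thesis
        using gN[OF x] by (simp add: T.A_m_assoc lN(6))
    qed
    then show ?thesis
      using xM gN[OF x] collect[of "g x"] by (simp add: f_def)
  qed
  then have "g = restrict f (carrier (corner_mod M))"
    using gh(2) by (intro extensionalityI[where A = "carrier (corner_mod M)"]) auto
  then show ?thesis using f_hom by blast
qed

text \<open>
  A quasi-inverse on objects is \<open>N \<mapsto> Hom\<^sub>B(\<epsilon>A, N)\<close>. A homomorphism is determined by its values at
  the elements \<open>\<epsilon> Q\<^sub>i\<close>, so this module embeds into \<open>N\<^sup>n\<close>, which embeds into the universe
  containing \<open>N\<close> because a nonzero complex vector space is infinite.
\<close>

definition row_space :: "'a set" where
  "row_space = {y \<in> carrier A. \<epsilon> \<otimes>\<^bsub>A\<^esub> y = y}"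

definition coind :: "('b, 'm) module \<Rightarrow> ('a \<Rightarrow> 'm) set" where
  "coind N = {\<phi> \<in> row_space \<rightarrow>\<^sub>E carrier N.
     (\<forall>y\<in>row_space. \<forall>z\<in>row_space. \<phi> (y \<oplus>\<^bsub>A\<^esub> z) = \<phi> y \<oplus>\<^bsub>N\<^esub> \<phi> z) \<and>
     (\<forall>b\<in>carrier B. \<forall>y\<in>row_space. \<phi> (\<iota> b \<otimes>\<^bsub>A\<^esub> y) = b \<odot>\<^bsub>N\<^esub> \<phi> y)}"

lemma row_closed:
  "y \<in> row_space \<Longrightarrow> y \<in> carrier A"
  "y \<in> row_space \<Longrightarrow> z \<in> row_space \<Longrightarrow> y \<oplus>\<^bsub>A\<^esub> z \<in> row_space"
  "y \<in> row_space \<Longrightarrow> a \<in> carrier A \<Longrightarrow> y \<otimes>\<^bsub>A\<^esub> a \<in> row_space"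
  "b \<in> carrier B \<Longrightarrow> y \<in> row_space \<Longrightarrow> \<iota> b \<otimes>\<^bsub>A\<^esub> y \<in> row_space"
  "\<epsilon> \<in> row_space" "b \<in> carrier B \<Longrightarrow> \<iota> b \<in> row_space" "\<epsilon> \<otimes>\<^bsub>A\<^esub> Q i \<in> row_space"
  by (auto simp: row_space_def T.A_r_distr abelian_groupE(1)[OF T.abelian_group_A] iota_eps
      simp flip: T.A_m_assoc)

text \<open>Since \<open>y = \<epsilon> y\<close>, the product lies in the corner. This is how
  elements of \<open>\<epsilon> A\<close> yield coefficients in \<open>B\<close>.\<close>

lemma row_eps_iota:
  assumes "y \<in> row_space" "a \<in> carrier A"
  shows "\<exists>b\<in>carrier B. y \<otimes>\<^bsub>A\<^esub> a \<otimes>\<^bsub>A\<^esub> \<epsilon> = \<iota> b"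
proof -
  have "y \<otimes>\<^bsub>A\<^esub> a \<otimes>\<^bsub>A\<^esub> \<epsilon> = \<epsilon> \<otimes>\<^bsub>A\<^esub> (y \<otimes>\<^bsub>A\<^esub> a) \<otimes>\<^bsub>A\<^esub> \<epsilon>"
    using assms by (auto simp: row_space_def simp flip: T.A_m_assoc)
  then show ?thesis
    using iota_surj[OF corner_mem, of "y \<otimes>\<^bsub>A\<^esub> a"] assms row_closed(1) by auto
qed

lemma coindD:
  assumes "\<phi> \<in> coind N"
  shows "y \<in> row_space \<Longrightarrow> \<phi> y \<in> carrier N" "\<phi> \<in> extensional row_space"
    "y \<in> row_space \<Longrightarrow> z \<in> row_space \<Longrightarrow> \<phi> (y \<oplus>\<^bsub>A\<^esub> z) = \<phi> y \<oplus>\<^bsub>N\<^esub> \<phi> z"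
    "b \<in> carrier B \<Longrightarrow> y \<in> row_space \<Longrightarrow> \<phi> (\<iota> b \<otimes>\<^bsub>A\<^esub> y) = b \<odot>\<^bsub>N\<^esub> \<phi> y"
  using assms by (auto simp: coind_def PiE_def)

lemma coindI:
  assumes "\<And>y. y \<in> row_space \<Longrightarrow> \<phi> y \<in> carrier N" "\<phi> \<in> extensional row_space"
    "\<And>y z. y \<in> row_space \<Longrightarrow> z \<in> row_space \<Longrightarrow> \<phi> (y \<oplus>\<^bsub>A\<^esub> z) = \<phi> y \<oplus>\<^bsub>N\<^esub> \<phi> z"
    "\<And>b y. b \<in> carrier B \<Longrightarrow> y \<in> row_space \<Longrightarrow> \<phi> (\<iota> b \<otimes>\<^bsub>A\<^esub> y) = b \<odot>\<^bsub>N\<^esub> \<phi> y"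
  shows "\<phi> \<in> coind N"
  using assms by (auto simp: coind_def PiE_def)

text \<open>\<open>y\<close> is the sum of the \<open>(y P_i \<epsilon>)(\<epsilon> Q_i)\<close>, so
  the elements \<open>\<epsilon> Q_i\<close> generate \<open>\<epsilon> A\<close> over
  \<open>B\<close>.\<close>

lemma coind_eqI:
  assumes N: "left_module B N" and \<phi>: "\<phi> \<in> coind N" and \<psi>: "\<psi> \<in> coind N"
    and eq: "\<And>i. i < n \<Longrightarrow> \<phi> (\<epsilon> \<otimes>\<^bsub>A\<^esub> Q i) = \<psi> (\<epsilon> \<otimes>\<^bsub>A\<^esub> Q i)"
  shows "\<phi> = \<psi>"
proof (rule extensionalityI)
  fix y assume y: "y \<in> row_space"
  note lN = left_module_facts[OF N] and h = coindD[OF \<phi>] and k = coindD[OF \<psi>]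
  \<comment> \<open>The equalizer of the two maps is closed under sums, so it suffices to place each
    summand of \<open>y\<close> in it.\<close>
  let ?H = "{z \<in> row_space. \<phi> z = \<psi> z}"
  have "\<zero>\<^bsub>A\<^esub> \<in> row_space"
    using abelian_groupE(2)[OF T.abelian_group_A] semiring.r_null[OF T.semiring_A] by (simp add: row_space_def)
  have "\<chi> \<zero>\<^bsub>A\<^esub> = \<zero>\<^bsub>N\<^esub>" if "\<chi> \<in> coind N" for \<chi>
    using coindD(1,3)[OF that, of "\<zero>\<^bsub>A\<^esub>"] coindD(3)[OF that, of "\<zero>\<^bsub>A\<^esub>" "\<zero>\<^bsub>A\<^esub>"] \<open>\<zero>\<^bsub>A\<^esub> \<in> row_space\<close>
      abelian_groupE(2,5)[OF T.abelian_group_A]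
    by (intro abelian_group.add_eq_zeroD[OF lN(2)]) auto
  from this[OF \<phi>] this[OF \<psi>] have "\<zero>\<^bsub>A\<^esub> \<in> ?H"
    using \<open>\<zero>\<^bsub>A\<^esub> \<in> row_space\<close> by simp
  moreover have "y \<otimes>\<^bsub>A\<^esub> (P i \<otimes>\<^bsub>A\<^esub> \<epsilon> \<otimes>\<^bsub>A\<^esub> Q i) \<in> ?H" if "i < n" for i
  proof -
    obtain b where b: "b \<in> carrier B" "y \<otimes>\<^bsub>A\<^esub> P i \<otimes>\<^bsub>A\<^esub> \<epsilon> = \<iota> b"
      using row_eps_iota[OF y P] by blast
    have "y \<otimes>\<^bsub>A\<^esub> (P i \<otimes>\<^bsub>A\<^esub> \<epsilon> \<otimes>\<^bsub>A\<^esub> Q i) = (y \<otimes>\<^bsub>A\<^esub> P i \<otimes>\<^bsub>A\<^esub> \<epsilon>) \<otimes>\<^bsub>A\<^esub> (\<epsilon> \<otimes>\<^bsub>A\<^esub> Q i)"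
    proof -
      have "\<epsilon> \<otimes>\<^bsub>A\<^esub> (\<epsilon> \<otimes>\<^bsub>A\<^esub> Q i) = \<epsilon> \<otimes>\<^bsub>A\<^esub> Q i" by (simp flip: T.A_m_assoc)
      then show ?thesis using row_closed(1)[OF y] by (simp add: T.A_m_assoc)
    qed
    then have "y \<otimes>\<^bsub>A\<^esub> (P i \<otimes>\<^bsub>A\<^esub> \<epsilon> \<otimes>\<^bsub>A\<^esub> Q i) = \<iota> b \<otimes>\<^bsub>A\<^esub> (\<epsilon> \<otimes>\<^bsub>A\<^esub> Q i)"
      by (simp add: b(2))
    then show ?thesis
      using b(1) row_closed(4,7) h(4) k(4) eq[OF that] by simp
  qed
  ultimately have "finsum A (\<lambda>i. y \<otimes>\<^bsub>A\<^esub> (P i \<otimes>\<^bsub>A\<^esub> \<epsilon> \<otimes>\<^bsub>A\<^esub> Q i)) {..<n} \<in> ?H"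
    using row_closed(1,2) h(3) k(3)
    by (intro finsum_closed_under[OF T.abelian_group_A]) auto
  moreover have "y \<otimes>\<^bsub>A\<^esub> finsum A (\<lambda>i. P i \<otimes>\<^bsub>A\<^esub> \<epsilon> \<otimes>\<^bsub>A\<^esub> Q i) {..<n} = finsum A (\<lambda>i. y \<otimes>\<^bsub>A\<^esub> (P i \<otimes>\<^bsub>A\<^esub> \<epsilon> \<otimes>\<^bsub>A\<^esub> Q i)) {..<n}"
    using row_closed(1)[OF y]
    by (intro finsum_additive[OF T.abelian_group_A T.abelian_group_A]) (auto simp: T.A_r_distr)
  ultimately show "\<phi> y = \<psi> y"
    using row_closed(1)[OF y] by (simp add: full)
qed (use coindD(2) \<phi> \<psi> in auto)

text \<open>The complex numbers inject by \<open>c |-> c x\<close>: a coincidence for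
  \<open>c \<noteq> d\<close> would give \<open>(c - d) x = 0\<close>, and division by
  \<open>c - d\<close> would give \<open>x = 0\<close>.\<close>

lemma infinite_left_module:
  assumes N: "left_module B N" and x: "x \<in> carrier N" "x \<noteq> \<zero>\<^bsub>N\<^esub>"
  shows "infinite (carrier N)"
proof
  note lN = left_module_facts[OF N]
  assume fin: "finite (carrier N)"
  have c: "c \<odot>\<^bsub>B\<^esub> \<one>\<^bsub>B\<^esub> \<in> carrier B" for c by simp
  have mul: "(c * d) \<odot>\<^bsub>B\<^esub> \<one>\<^bsub>B\<^esub> = (c \<odot>\<^bsub>B\<^esub> \<one>\<^bsub>B\<^esub>) \<otimes>\<^bsub>B\<^esub> (d \<odot>\<^bsub>B\<^esub> \<one>\<^bsub>B\<^esub>)" for c d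
    using T'.smult_assoc1[of c d "\<one>\<^bsub>B\<^esub>"] T'.smult_eq_mult_left[of "d \<odot>\<^bsub>B\<^esub> \<one>\<^bsub>B\<^esub>" c] by simp
  have "inj (\<lambda>c. (c \<odot>\<^bsub>B\<^esub> \<one>\<^bsub>B\<^esub>) \<odot>\<^bsub>N\<^esub> x)"
  proof (rule injI, rule ccontr)
    fix c d :: complex
    assume eq: "(c \<odot>\<^bsub>B\<^esub> \<one>\<^bsub>B\<^esub>) \<odot>\<^bsub>N\<^esub> x = (d \<odot>\<^bsub>B\<^esub> \<one>\<^bsub>B\<^esub>) \<odot>\<^bsub>N\<^esub> x" and "c \<noteq> d"
    have "((c - d) \<odot>\<^bsub>B\<^esub> \<one>\<^bsub>B\<^esub>) \<odot>\<^bsub>N\<^esub> x \<oplus>\<^bsub>N\<^esub> (d \<odot>\<^bsub>B\<^esub> \<one>\<^bsub>B\<^esub>) \<odot>\<^bsub>N\<^esub> x = ((c - d + d) \<odot>\<^bsub>B\<^esub> \<one>\<^bsub>B\<^esub>) \<odot>\<^bsub>N\<^esub> x"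
      using x c T'.smult_l_distr[of "c - d" d "\<one>\<^bsub>B\<^esub>"] by (simp add: lN(4))
    then have "((c - d) \<odot>\<^bsub>B\<^esub> \<one>\<^bsub>B\<^esub>) \<odot>\<^bsub>N\<^esub> x \<oplus>\<^bsub>N\<^esub> (d \<odot>\<^bsub>B\<^esub> \<one>\<^bsub>B\<^esub>) \<odot>\<^bsub>N\<^esub> x = (d \<odot>\<^bsub>B\<^esub> \<one>\<^bsub>B\<^esub>) \<odot>\<^bsub>N\<^esub> x"
      using eq by simp
    then have "((c - d) \<odot>\<^bsub>B\<^esub> \<one>\<^bsub>B\<^esub>) \<odot>\<^bsub>N\<^esub> x = \<zero>\<^bsub>N\<^esub>"
      by (rule abelian_group.add_right_eqD[OF lN(2) lN(3)[OF c x(1)] lN(3)[OF c x(1)]])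
    then have "((1 / (c - d)) \<odot>\<^bsub>B\<^esub> \<one>\<^bsub>B\<^esub>) \<odot>\<^bsub>N\<^esub> (((c - d) \<odot>\<^bsub>B\<^esub> \<one>\<^bsub>B\<^esub>) \<odot>\<^bsub>N\<^esub> x) = \<zero>\<^bsub>N\<^esub>"
      using c by (simp add: lN(13))
    then have "((1 / (c - d) * (c - d)) \<odot>\<^bsub>B\<^esub> \<one>\<^bsub>B\<^esub>) \<odot>\<^bsub>N\<^esub> x = \<zero>\<^bsub>N\<^esub>"
      using x c by (simp only: mul lN(6))
    then show False
      using \<open>c \<noteq> d\<close> x T'.smult_one[of "\<one>\<^bsub>B\<^esub>"] by (simp add: lN(7))
  qed
  moreover have "range (\<lambda>c. (c \<odot>\<^bsub>B\<^esub> \<one>\<^bsub>B\<^esub>) \<odot>\<^bsub>N\<^esub> x) \<subseteq> carrier N"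
    using x c lN(3) by blast
  ultimately have "finite (UNIV :: complex set)"
    using finite_subset[OF _ fin] finite_imageD by blast
  then show False
    using infinite_UNIV_char_0 by blast
qed

lemma coind_embedding:
  fixes N :: "('b, 'm) module"
  assumes N: "left_module B N"
  shows "\<exists>j :: ('a \<Rightarrow> 'm) \<Rightarrow> 'm. inj_on j (coind N)"
proof -
  note lN = left_module_facts[OF N]
  let ?v = "\<lambda>\<phi>. \<lambda>i\<in>{..<n}. \<phi> (\<epsilon> \<otimes>\<^bsub>A\<^esub> Q i)"
  have v: "?v \<phi> \<in> {..<n} \<rightarrow>\<^sub>E carrier N" if "\<phi> \<in> coind N" for \<phi>
    using coindD(1)[OF that row_closed(7)] by auto
  have v_inj: "inj_on ?v (coind N)"
  proof (rule inj_onI)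
    fix \<phi> \<psi> assume \<phi>: "\<phi> \<in> coind N" and \<psi>: "\<psi> \<in> coind N" and eq: "?v \<phi> = ?v \<psi>"
    show "\<phi> = \<psi>"
    proof (rule coind_eqI[OF N \<phi> \<psi>])
      fix i assume "i < n"
      then show "\<phi> (\<epsilon> \<otimes>\<^bsub>A\<^esub> Q i) = \<psi> (\<epsilon> \<otimes>\<^bsub>A\<^esub> Q i)"
        using fun_cong[OF eq, of i] by simp
    qed
  qed
  have "\<exists>k :: (nat \<Rightarrow> 'm) \<Rightarrow> 'm. inj_on k ({..<n} \<rightarrow>\<^sub>E carrier N)"
  proof (cases "carrier N = {\<zero>\<^bsub>N\<^esub>}")
    case True
    \<comment> \<open>The zero module is finite, hence outside the scope of
      \<open>PiE_embedding\<close>, but then the function space is a single point.\<close>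
    have "inj_on (\<lambda>_ :: nat \<Rightarrow> 'm. \<zero>\<^bsub>N\<^esub>) ({..<n} \<rightarrow>\<^sub>E carrier N)"
      unfolding True by (auto simp: inj_on_def intro!: PiE_ext[of _ "{..<n}" "\<lambda>_. {\<zero>\<^bsub>N\<^esub>}"])
    then show ?thesis by blast
  next
    case False
    then obtain x where "x \<in> carrier N" "x \<noteq> \<zero>\<^bsub>N\<^esub>" using lN(9) by blast
    then have "infinite (carrier N)" by (rule infinite_left_module[OF N])
    then show ?thesis using PiE_embedding by blast
  qed
  then obtain k :: "(nat \<Rightarrow> 'm) \<Rightarrow> 'm" where "inj_on k ({..<n} \<rightarrow>\<^sub>E carrier N)" by blast
  then have "inj_on (k \<circ> ?v) (coind N)"
    by (intro comp_inj_on[OF v_inj] inj_on_subset[OF _ image_subsetI[OF v]])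
  then show ?thesis by blast
qed

text \<open>The structure of \<open>Hom_B(\<epsilon> A, N)\<close> transported along
  \<open>j\<close> into the type of \<open>N\<close>. Right multiplication on
  \<open>\<epsilon> A\<close> becomes a left action of \<open>A\<close> on homomorphisms.\<close>

definition coind_mod :: "('b, 'm) module \<Rightarrow> (('a \<Rightarrow> 'm) \<Rightarrow> 'm) \<Rightarrow> ('a, 'm) module" where
  "coind_mod N j = (let k = inv_into (coind N) j in
     \<lparr>carrier = j ` coind N, mult = undefined, one = undefined,
      zero = j (\<lambda>y\<in>row_space. \<zero>\<^bsub>N\<^esub>),
      add = (\<lambda>u v. j (\<lambda>y\<in>row_space. k u y \<oplus>\<^bsub>N\<^esub> k v y)),
      smult = (\<lambda>a u. j (\<lambda>y\<in>row_space. k u (y \<otimes>\<^bsub>A\<^esub> a)))\<rparr>)"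

context
  fixes N :: "('b, 'm) module" and j :: "('a \<Rightarrow> 'm) \<Rightarrow> 'm"
  assumes N: "left_module B N" and j: "inj_on j (coind N)"
begin

lemmas lN = left_module_facts[OF N]

lemma coind_add: "\<phi> \<in> coind N \<Longrightarrow> \<psi> \<in> coind N \<Longrightarrow> (\<lambda>y\<in>row_space. \<phi> y \<oplus>\<^bsub>N\<^esub> \<psi> y) \<in> coind N"
  by (rule coindI)
    (auto simp: coindD lN(5,8) row_closed intro!: abelian_group.add_exchange[OF lN(2)])

lemma coind_zero: "(\<lambda>y\<in>row_space. \<zero>\<^bsub>N\<^esub>) \<in> coind N"
  by (rule coindI) (auto simp: lN(9,10,13) row_closed)

lemma coind_act: "\<phi> \<in> coind N \<Longrightarrow> a \<in> carrier A \<Longrightarrow> (\<lambda>y\<in>row_space. \<phi> (y \<otimes>\<^bsub>A\<^esub> a)) \<in> coind N"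
  by (rule coindI) (auto simp: coindD row_closed T.A_l_distr T.A_m_assoc)

lemma coind_mod_simps:
  "carrier (coind_mod N j) = j ` coind N"
  "zero (coind_mod N j) = j (\<lambda>y\<in>row_space. \<zero>\<^bsub>N\<^esub>)"
  "\<phi> \<in> coind N \<Longrightarrow> \<psi> \<in> coind N \<Longrightarrow> add (coind_mod N j) (j \<phi>) (j \<psi>) = j (\<lambda>y\<in>row_space. \<phi> y \<oplus>\<^bsub>N\<^esub> \<psi> y)"
  "\<phi> \<in> coind N \<Longrightarrow> smult (coind_mod N j) a (j \<phi>) = j (\<lambda>y\<in>row_space. \<phi> (y \<otimes>\<^bsub>A\<^esub> a))"
  using j by (simp_all add: coind_mod_def Let_def)

lemma coind_left_module: "left_module A (coind_mod N j)"
proof -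
  let ?M = "coind_mod N j"
  have ab: "abelian_group ?M"
  proof (rule abelian_groupI)
    show "\<exists>v\<in>carrier ?M. v \<oplus>\<^bsub>?M\<^esub> u = \<zero>\<^bsub>?M\<^esub>" if "u \<in> carrier ?M" for u
    proof -
      obtain \<phi> where \<phi>: "\<phi> \<in> coind N" "u = j \<phi>"
        using \<open>u \<in> carrier ?M\<close> by (auto simp: coind_mod_simps)
      \<comment> \<open>The negative of \<open>\<phi>\<close> is its image under the action of
        \<open>- 1\<close>, which stays in \<open>coind N\<close> by
        \<open>coind_act\<close>.\<close>
      have m: "\<ominus>\<^bsub>A\<^esub> \<one>\<^bsub>A\<^esub> \<in> carrier A"
        by (rule abelian_group.a_inv_closed[OF T.abelian_group_A T.A_one_closed])
      have "\<phi> (y \<otimes>\<^bsub>A\<^esub> (\<ominus>\<^bsub>A\<^esub> \<one>\<^bsub>A\<^esub>)) \<oplus>\<^bsub>N\<^esub> \<phi> y = \<zero>\<^bsub>N\<^esub>" if y: "y \<in> row_space" for y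
      proof -
        have z: "\<zero>\<^bsub>A\<^esub> \<in> row_space"
          using semiring.r_null[OF T.semiring_A] abelian_groupE(2)[OF T.abelian_group_A] by (simp add: row_space_def)
        have "\<phi> \<zero>\<^bsub>A\<^esub> = \<zero>\<^bsub>N\<^esub>"
          using coindD(1)[OF \<phi>(1) z] coindD(3)[OF \<phi>(1) z z] abelian_groupE(2,5)[OF T.abelian_group_A]
          by (intro abelian_group.add_eq_zeroD[OF lN(2)]) auto
        moreover have "y \<otimes>\<^bsub>A\<^esub> (\<ominus>\<^bsub>A\<^esub> \<one>\<^bsub>A\<^esub>) \<oplus>\<^bsub>A\<^esub> y = \<zero>\<^bsub>A\<^esub>"
          using row_closed(1)[OF y] by (simp add: ring.r_minus[OF T.ring_A] abelian_group.l_neg[OF T.abelian_group_A])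
        ultimately show ?thesis
          using coindD(3)[OF \<phi>(1) row_closed(3)[OF y m] y] by simp
      qed
      then have "(\<lambda>y\<in>row_space. (\<lambda>y\<in>row_space. \<phi> (y \<otimes>\<^bsub>A\<^esub> (\<ominus>\<^bsub>A\<^esub> \<one>\<^bsub>A\<^esub>))) y \<oplus>\<^bsub>N\<^esub> \<phi> y) = (\<lambda>y\<in>row_space. \<zero>\<^bsub>N\<^esub>)"
        by (intro restrict_ext) simp
      then show ?thesis
        using \<phi> coind_act[OF \<phi>(1) m]
        by (intro bexI[of _ "j (\<lambda>y\<in>row_space. \<phi> (y \<otimes>\<^bsub>A\<^esub> (\<ominus>\<^bsub>A\<^esub> \<one>\<^bsub>A\<^esub>)))"]) (auto simp: coind_mod_simps)
    qed
    show "\<zero>\<^bsub>?M\<^esub> \<oplus>\<^bsub>?M\<^esub> u = u" if "u \<in> carrier ?M" for u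
    proof -
      obtain \<phi> where \<phi>: "\<phi> \<in> coind N" "u = j \<phi>"
        using \<open>u \<in> carrier ?M\<close> by (auto simp: coind_mod_simps)
      have "(\<lambda>y\<in>row_space. (\<lambda>y\<in>row_space. \<zero>\<^bsub>N\<^esub>) y \<oplus>\<^bsub>N\<^esub> \<phi> y) = \<phi>"
        using coindD[OF \<phi>(1)] by (intro extensionalityI[where A = row_space]) (auto simp: lN(10))
      then show ?thesis
        using \<phi> coind_zero by (simp add: coind_mod_simps)
    qed
  qed (auto simp: coind_mod_simps coind_add coind_zero coindD lN(11) intro!: arg_cong[where f = j] restrict_ext lN(12))
  have "left_module_axioms A ?M"
  proof (rule left_module_axioms.intro)
    show "\<one>\<^bsub>A\<^esub> \<odot>\<^bsub>?M\<^esub> u = u" if "u \<in> carrier ?M" for u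
    proof -
      obtain \<phi> where \<phi>: "\<phi> \<in> coind N" "u = j \<phi>"
        using \<open>u \<in> carrier ?M\<close> by (auto simp: coind_mod_simps)
      have "(\<lambda>y\<in>row_space. \<phi> (y \<otimes>\<^bsub>A\<^esub> \<one>\<^bsub>A\<^esub>)) = \<phi>"
        using coindD(2)[OF \<phi>(1)] by (intro extensionalityI[where A = row_space]) (auto simp: row_closed)
      then show ?thesis
        using \<phi> by (simp add: coind_mod_simps)
    qed
  qed (auto simp: coind_mod_simps coind_add coind_act coindD row_closed T.A_r_distr T.A_m_assoc
      intro!: arg_cong[where f = j] restrict_ext)
  then show ?thesis
    using ab T.ring_A by (simp add: left_module_def)
qed

text \<open>The isomorphism is evaluation at \<open>\<epsilon>\<close>. A homomorphism fixed by
  \<open>\<epsilon>\<close> satisfies \<open>\<phi>(y) = \<phi>(y \<epsilon>)\<close>, and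
  \<open>y \<epsilon>\<close> is some \<open>\<iota> b\<close>, so
  \<open>\<phi>(y) = b \<phi>(\<epsilon>)\<close>: the value at \<open>\<epsilon>\<close> determines
  \<open>\<phi>\<close> and can be prescribed.\<close>

lemma coind_counit: "\<exists>a. cat_iso (module_cat TYPE('m) B) (corner_mod (coind_mod N j)) N a"
proof -
  let ?M = "coind_mod N j"
  let ?k = "inv_into (coind N) j"
  let ?X = "carrier (corner_mod ?M)"
  have Xe: "\<exists>\<phi>\<in>coind N. u = j \<phi> \<and> (\<forall>y\<in>row_space. \<phi> (y \<otimes>\<^bsub>A\<^esub> \<epsilon>) = \<phi> y)" if u: "u \<in> ?X" for u
  proof -
    obtain \<phi> where \<phi>: "\<phi> \<in> coind N" "u = j \<phi>" "j (\<lambda>y\<in>row_space. \<phi> (y \<otimes>\<^bsub>A\<^esub> \<epsilon>)) = j \<phi>"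
      using u by (auto simp: coind_mod_simps)
    have eq: "(\<lambda>y\<in>row_space. \<phi> (y \<otimes>\<^bsub>A\<^esub> \<epsilon>)) = \<phi>"
      using \<phi>(3) inj_on_eq_iff[OF j coind_act[OF \<phi>(1) eps(1)] \<phi>(1)] by simp
    have "\<phi> (y \<otimes>\<^bsub>A\<^esub> \<epsilon>) = \<phi> y" if "y \<in> row_space" for y
      using fun_cong[OF eq, of y] that by simp
    then show ?thesis using \<phi> by blast
  qed
  define a where "a = (\<lambda>u\<in>?X. ?k u \<epsilon>)"
  have a: "a (j \<phi>) = \<phi> \<epsilon>" if "\<phi> \<in> coind N" "j \<phi> \<in> ?X" for \<phi>
    using that j by (simp add: a_def)
  note lX = left_module_facts[OF corner_left_module[OF coind_left_module]]
  have hom: "a \<in> module_homs B (corner_mod ?M) N"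
  proof (rule module_homsI)
    show "a u \<in> carrier N" if "u \<in> ?X" for u
      using Xe[OF that] that a coindD(1) row_closed(5) by auto
    show "a (u \<oplus>\<^bsub>corner_mod ?M\<^esub> v) = a u \<oplus>\<^bsub>N\<^esub> a v" if u: "u \<in> ?X" and v: "v \<in> ?X" for u v
    proof -
      obtain \<phi> \<psi> where \<phi>: "\<phi> \<in> coind N" "u = j \<phi>" and \<psi>: "\<psi> \<in> coind N" "v = j \<psi>"
        using Xe[OF u] Xe[OF v] by blast
      have "u \<oplus>\<^bsub>corner_mod ?M\<^esub> v = j (\<lambda>y\<in>row_space. \<phi> y \<oplus>\<^bsub>N\<^esub> \<psi> y)"
        using \<phi> \<psi> by (simp add: coind_mod_simps)
      then show ?thesis
        using a[OF coind_add[OF \<phi>(1) \<psi>(1)]] lX(8)[OF u v] a[OF \<phi>(1)] a[OF \<psi>(1)] u v \<phi>(2) \<psi>(2) row_closed(5) by simp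
    qed
    show "a (b \<odot>\<^bsub>corner_mod ?M\<^esub> u) = b \<odot>\<^bsub>N\<^esub> a u" if b: "b \<in> carrier B" and u: "u \<in> ?X" for b u
    proof -
      obtain \<phi> where \<phi>: "\<phi> \<in> coind N" "u = j \<phi>" "\<forall>y\<in>row_space. \<phi> (y \<otimes>\<^bsub>A\<^esub> \<epsilon>) = \<phi> y"
        using Xe[OF u] by blast
      have "b \<odot>\<^bsub>corner_mod ?M\<^esub> u = j (\<lambda>y\<in>row_space. \<phi> (y \<otimes>\<^bsub>A\<^esub> \<iota> b))"
        using \<phi> by (simp add: coind_mod_simps)
      then have "a (b \<odot>\<^bsub>corner_mod ?M\<^esub> u) = \<phi> (\<epsilon> \<otimes>\<^bsub>A\<^esub> \<iota> b)"
        using a[OF coind_act[OF \<phi>(1) iota_closed[OF b]]] lX(3)[OF b u] row_closed(5) by simp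
      also have "\<dots> = \<phi> (\<iota> b \<otimes>\<^bsub>A\<^esub> \<epsilon>)"
        using b by (simp add: iota_eps)
      also have "\<dots> = b \<odot>\<^bsub>N\<^esub> \<phi> \<epsilon>"
        using coindD(4)[OF \<phi>(1) b row_closed(5)] .
      finally show ?thesis
        using a[OF \<phi>(1)] u \<phi>(2) by simp
    qed
  qed (simp add: a_def)
  have "inj_on a ?X"
  proof (rule inj_onI)
    fix u v assume u: "u \<in> ?X" and v: "v \<in> ?X" and eq: "a u = a v"
    obtain \<phi> where \<phi>: "\<phi> \<in> coind N" "u = j \<phi>" "\<forall>y\<in>row_space. \<phi> (y \<otimes>\<^bsub>A\<^esub> \<epsilon>) = \<phi> y"
      using Xe[OF u] by blast
    obtain \<psi> where \<psi>: "\<psi> \<in> coind N" "v = j \<psi>" "\<forall>y\<in>row_space. \<psi> (y \<otimes>\<^bsub>A\<^esub> \<epsilon>) = \<psi> y"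
      using Xe[OF v] by blast
    have eval_at: "\<chi> y = b \<odot>\<^bsub>N\<^esub> \<chi> \<epsilon>"
      if "\<chi> \<in> coind N" "\<forall>y\<in>row_space. \<chi> (y \<otimes>\<^bsub>A\<^esub> \<epsilon>) = \<chi> y" "y \<in> row_space" "b \<in> carrier B" "y \<otimes>\<^bsub>A\<^esub> \<epsilon> = \<iota> b" for \<chi> y b
    proof -
      have "\<chi> y = \<chi> (\<iota> b \<otimes>\<^bsub>A\<^esub> \<epsilon>)"
        using that by (simp add: iota_eps flip: that(5))
          (metis that(2,3,5) T.A_m_assoc eps row_closed(1))
      then show ?thesis
        using coindD(4)[OF that(1,4) row_closed(5)] by simp
    qed
    have "\<phi> = \<psi>"
    proof (rule extensionalityI)
      fix y assume y: "y \<in> row_space"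
      obtain b where b: "b \<in> carrier B" "y \<otimes>\<^bsub>A\<^esub> \<epsilon> = \<iota> b"
        using row_eps_iota[OF y T.A_one_closed] row_closed(1)[OF y] by auto
      show "\<phi> y = \<psi> y"
        using eval_at[OF \<phi>(1,3) y b] eval_at[OF \<psi>(1,3) y b] eq a[OF \<phi>(1)] a[OF \<psi>(1)] u v \<phi>(2) \<psi>(2) by simp
    qed (use coindD(2) \<phi>(1) \<psi>(1) in auto)
    then show "u = v" using \<phi>(2) \<psi>(2) by simp
  qed
  moreover have "\<exists>u\<in>?X. a u = x" if x: "x \<in> carrier N" for x
  proof -
    define \<kappa> where "\<kappa> = inv_into (carrier B) \<iota>"
    have \<kappa>: "\<kappa> (\<iota> b) = b" if "b \<in> carrier B" for b
      using that iota(2) by (simp add: \<kappa>_def bij_betw_def)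
    have re: "\<exists>b\<in>carrier B. y \<otimes>\<^bsub>A\<^esub> \<epsilon> = \<iota> b" if "y \<in> row_space" for y
      using row_eps_iota[OF that T.A_one_closed] row_closed(1)[OF that] by simp
    \<comment> \<open>The preimage of \<open>x\<close> is forced by
      \<open>\<phi>(y) = b \<phi>(\<epsilon>)\<close>; the inverse \<open>\<kappa>\<close> of
      \<open>\<iota>\<close> recovers \<open>b\<close> from \<open>y \<epsilon>\<close>.\<close>
    define \<theta> where "\<theta> = (\<lambda>y\<in>row_space. \<kappa> (y \<otimes>\<^bsub>A\<^esub> \<epsilon>) \<odot>\<^bsub>N\<^esub> x)"
    have \<theta>: "\<theta> y = b \<odot>\<^bsub>N\<^esub> x" if "y \<in> row_space" "b \<in> carrier B" "y \<otimes>\<^bsub>A\<^esub> \<epsilon> = \<iota> b" for y b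
      using that \<kappa> by (simp add: \<theta>_def)
    have \<theta>_coind: "\<theta> \<in> coind N"
    proof (rule coindI)
      show "\<theta> y \<in> carrier N" if "y \<in> row_space" for y
        using re[OF that] \<theta>[OF that] lN(3) x by auto
      show "\<theta> (y \<oplus>\<^bsub>A\<^esub> z) = \<theta> y \<oplus>\<^bsub>N\<^esub> \<theta> z" if y: "y \<in> row_space" and z: "z \<in> row_space" for y z
      proof -
        obtain b c where b: "b \<in> carrier B" "y \<otimes>\<^bsub>A\<^esub> \<epsilon> = \<iota> b" and c: "c \<in> carrier B" "z \<otimes>\<^bsub>A\<^esub> \<epsilon> = \<iota> c"
          using re[OF y] re[OF z] by blast
        have bc: "b \<oplus>\<^bsub>B\<^esub> c \<in> carrier B"
          by (rule abelian_groupE(1)[OF T'.abelian_group_A b(1) c(1)])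
        have "(y \<oplus>\<^bsub>A\<^esub> z) \<otimes>\<^bsub>A\<^esub> \<epsilon> = \<iota> (b \<oplus>\<^bsub>B\<^esub> c)"
          using b c row_closed(1) y z by (simp add: T.A_l_distr iota)
        then have "\<theta> (y \<oplus>\<^bsub>A\<^esub> z) = (b \<oplus>\<^bsub>B\<^esub> c) \<odot>\<^bsub>N\<^esub> x"
          by (rule \<theta>[OF row_closed(2)[OF y z] bc])
        then show ?thesis
          using \<theta>[OF y b] \<theta>[OF z c] b(1) c(1) x by (simp add: lN(4))
      qed
      show "\<theta> (\<iota> b \<otimes>\<^bsub>A\<^esub> y) = b \<odot>\<^bsub>N\<^esub> \<theta> y" if b: "b \<in> carrier B" and y: "y \<in> row_space" for b y
      proof -
        obtain c where c: "c \<in> carrier B" "y \<otimes>\<^bsub>A\<^esub> \<epsilon> = \<iota> c"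
          using re[OF y] by blast
        have "(\<iota> b \<otimes>\<^bsub>A\<^esub> y) \<otimes>\<^bsub>A\<^esub> \<epsilon> = \<iota> (b \<otimes>\<^bsub>B\<^esub> c)"
          using b c row_closed(1)[OF y] by (simp add: T.A_m_assoc iota)
        then have "\<theta> (\<iota> b \<otimes>\<^bsub>A\<^esub> y) = (b \<otimes>\<^bsub>B\<^esub> c) \<odot>\<^bsub>N\<^esub> x"
          by (rule \<theta>[OF row_closed(4)[OF b y] T'.A_m_closed[OF b c(1)]])
        then show ?thesis
          using \<theta>[OF y c] b c(1) x by (simp add: lN(6))
      qed
    qed (simp add: \<theta>_def)
    have "(\<lambda>y\<in>row_space. \<theta> (y \<otimes>\<^bsub>A\<^esub> \<epsilon>)) = \<theta>"
    proof (rule extensionalityI[where A = row_space])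
      fix y assume y: "y \<in> row_space"
      have "y \<otimes>\<^bsub>A\<^esub> \<epsilon> \<otimes>\<^bsub>A\<^esub> \<epsilon> = y \<otimes>\<^bsub>A\<^esub> \<epsilon>"
        using row_closed(1)[OF y] by (simp add: T.A_m_assoc)
      then show "(\<lambda>y\<in>row_space. \<theta> (y \<otimes>\<^bsub>A\<^esub> \<epsilon>)) y = \<theta> y"
        using y row_closed(3)[OF y] by (simp add: \<theta>_def)
    qed (simp_all add: \<theta>_def)
    then have X: "j \<theta> \<in> ?X"
      using \<theta>_coind by (simp add: coind_mod_simps)
    have "\<theta> \<epsilon> = \<one>\<^bsub>B\<^esub> \<odot>\<^bsub>N\<^esub> x"
      by (rule \<theta>) (simp_all add: row_closed iota)
    then have "a (j \<theta>) = x"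
      using a[OF \<theta>_coind X] x by (simp add: lN(7))
    then show ?thesis using X by blast
  qed
  ultimately have "bij_betw a ?X (carrier N)"
    using module_homsD(1)[OF hom] by (auto simp: bij_betw_def)
  then show ?thesis
    using cat_iso_module_catI[OF corner_left_module[OF coind_left_module] N hom] by blast
qed

end

theorem morita: "morita_equivalent TYPE('m) A B"
  unfolding morita_equivalent_def
proof (rule equivalent_catsI)
  let ?F' = "\<lambda>(M :: ('a, 'm) module) (N :: ('a, 'm) module) f. restrict f (carrier (corner_mod M))"
  show "linear_category (module_cat TYPE('m) A)" "linear_category (module_cat TYPE('m) B)"
    by (rule linear_category_module_cat[OF T.complex_alg_axioms],
      rule linear_category_module_cat[OF T'.complex_alg_axioms])
  show "linear_functor (module_cat TYPE('m) A) (module_cat TYPE('m) B) corner_mod ?F'"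
    unfolding linear_functor_def module_cat_simps mem_Collect_eq
  proof (intro conjI ballI allI; unfold mem_Collect_eq)
    fix M N :: "('a, 'm) module" and f c
    assume M: "left_module A M" and N: "left_module A N" and f: "f \<in> module_homs A M N"
    show "restrict f (carrier (corner_mod M)) \<in> module_homs B (corner_mod M) (corner_mod N)"
      by (rule restrict_hom[OF M N f])
    \<comment> \<open>For \<open>B\<close>-modules scalars act through
      \<open>\<iota> (c 1) = c \<epsilon>\<close>, and \<open>\<epsilon>\<close> fixes the values of
      \<open>f\<close> on the corner module.\<close>
    have "(c \<odot>\<^bsub>A\<^esub> \<one>\<^bsub>A\<^esub>) \<odot>\<^bsub>N\<^esub> f x = \<iota> (c \<odot>\<^bsub>B\<^esub> \<one>\<^bsub>B\<^esub>) \<odot>\<^bsub>N\<^esub> f x" if "x \<in> carrier (corner_mod M)" for x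
    proof -
      have fx: "f x \<in> carrier N" "\<epsilon> \<odot>\<^bsub>N\<^esub> f x = f x"
        using that module_homsD(1)[OF f] module_homsD(4)[OF f, of \<epsilon> x] by auto
      have "\<iota> (c \<odot>\<^bsub>B\<^esub> \<one>\<^bsub>B\<^esub>) = (c \<odot>\<^bsub>A\<^esub> \<one>\<^bsub>A\<^esub>) \<otimes>\<^bsub>A\<^esub> \<epsilon>"
        using T.smult_eq_mult_left[of \<epsilon> c] by (simp add: iota)
      then show ?thesis
        using fx left_module_facts(6)[OF N, of "c \<odot>\<^bsub>A\<^esub> \<one>\<^bsub>A\<^esub>" \<epsilon> "f x"] by simp
    qed
    then show "restrict (\<lambda>x\<in>carrier M. (c \<odot>\<^bsub>A\<^esub> \<one>\<^bsub>A\<^esub>) \<odot>\<^bsub>N\<^esub> f x) (carrier (corner_mod M)) =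
        (\<lambda>x\<in>carrier (corner_mod M). (c \<odot>\<^bsub>B\<^esub> \<one>\<^bsub>B\<^esub>) \<odot>\<^bsub>corner_mod N\<^esub> restrict f (carrier (corner_mod M)) x)"
      by (intro restrict_ext) simp
  next
    fix L M N :: "('a, 'm) module" and f g
    assume L: "left_module A L" and f: "f \<in> module_homs A L M"
    have "f x \<in> carrier (corner_mod M)" if "x \<in> carrier (corner_mod L)" for x
      using that module_homsD(1)[OF f] module_homsD(4)[OF f, of \<epsilon> x] by auto
    then show "restrict (compose (carrier L) g f) (carrier (corner_mod L)) =
        compose (carrier (corner_mod L)) (restrict g (carrier (corner_mod M))) (restrict f (carrier (corner_mod L)))"
      unfolding compose_def by (intro restrict_ext) auto
  qed (auto simp: corner_left_module intro!: restrict_ext)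
  show "bij_betw (?F' M N) (Hom (module_cat TYPE('m) A) M N)
      (Hom (module_cat TYPE('m) B) (corner_mod M) (corner_mod N))"
    if "M \<in> Ob (module_cat TYPE('m) A)" "N \<in> Ob (module_cat TYPE('m) A)" for M N
  proof -
    have M: "left_module A M" and N: "left_module A N" using that by auto
    have "inj_on (?F' M N) (module_homs A M N)"
      by (rule inj_onI) (rule restrict_inj[OF M N])
    moreover have "?F' M N ` module_homs A M N = module_homs B (corner_mod M) (corner_mod N)"
      using restrict_hom[OF M N] restrict_surj[OF M N] by blast
    ultimately show ?thesis by (simp add: bij_betw_def)
  qed
  show "\<exists>M\<in>Ob (module_cat TYPE('m) A). \<exists>a. cat_iso (module_cat TYPE('m) B) (corner_mod M) N a"
    if "N \<in> Ob (module_cat TYPE('m) B)" for N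
  proof -
    have N: "left_module B N" using that by simp
    obtain j :: "('a \<Rightarrow> 'm) \<Rightarrow> 'm" where j: "inj_on j (coind N)"
      using coind_embedding[OF N] by blast
    show ?thesis
      using coind_left_module[OF N j] coind_counit[OF N j] by auto
  qed
qed

end

section \<open>Derivation quotients of corners\<close>

text \<open>Derivative spaces are generated as additive groups; by this lemma inclusions between
  their images under additive maps are checked on generators.\<close>

lemma additive_generate:
  assumes G: "abelian_group G" and K: "abelian_group K" and H: "subgroup H (add_monoid K)"
    and cl: "\<And>x. x \<in> carrier G \<Longrightarrow> f x \<in> carrier K"
    and add: "\<And>x y. x \<in> carrier G \<Longrightarrow> y \<in> carrier G \<Longrightarrow> f (x \<oplus>\<^bsub>G\<^esub> y) = f x \<oplus>\<^bsub>K\<^esub> f y"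
    and X: "X \<subseteq> carrier G" and fX: "\<And>x. x \<in> X \<Longrightarrow> f x \<in> H"
    and x: "x \<in> generate (add_monoid G) X"
  shows "f x \<in> H"
proof -
  interpret G: abelian_group G by (rule G)
  interpret K: abelian_group K by (rule K)
  have z: "f \<zero>\<^bsub>G\<^esub> = \<zero>\<^bsub>K\<^esub>"
    by (rule additive_zero[OF G K cl add])
  have gen: "y \<in> carrier G" if "y \<in> generate (add_monoid G) X" for y
    using group.generate_in_carrier[OF G.a_group, of X y] X that by simp
  show ?thesis
    using x
  proof (induction rule: generate.induct)
    case one
    then show ?case using subgroup.one_closed[OF H] by (simp add: z)
  next
    case (incl h)
    then show ?case by (rule fX)
  next
    case (inv h)
    then have h: "h \<in> carrier G" using X by auto
    have "f (\<ominus>\<^bsub>G\<^esub> h) \<oplus>\<^bsub>K\<^esub> f h = \<zero>\<^bsub>K\<^esub>"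
      using add[of "\<ominus>\<^bsub>G\<^esub> h" h] h by (simp add: G.l_neg z)
    then have "\<ominus>\<^bsub>K\<^esub> f h = f (\<ominus>\<^bsub>G\<^esub> h)"
      using h cl by (intro K.minus_equality) auto
    then show ?case
      using subgroup.m_inv_closed[OF H fX[OF inv]] by (simp flip: a_inv_def)
  next
    case (eng h1 h2)
    then show ?case
      using subgroup.m_closed[OF H eng.IH] add[OF gen[OF eng.hyps(1)] gen[OF eng.hyps(2)]] by simp
  qed
qed

text \<open>Negatives in the generated subgroup are absorbed by
  \<open>- (s e t) = (- s) e t\<close>, and a sum of two sums is formed by appending one term at a
  time.\<close>

lemma two_sided_span_sum:
  fixes S (structure)
  assumes S: "complex_alg S" and e: "e \<in> carrier S" and x: "x \<in> two_sided_span S e"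
  shows "\<exists>(n::nat) p q. (\<forall>i. p i \<in> carrier S) \<and> (\<forall>i. q i \<in> carrier S) \<and>
    finsum S (\<lambda>i. p i \<otimes> e \<otimes> q i) {..<n} = x"
proof -
  interpret G: abelian_group S by (rule complex_alg.abelian_group_A[OF S])
  interpret S: complex_alg S by (rule S)
  let ?R = "\<lambda>x n p q. (\<forall>i. p i \<in> carrier S) \<and> (\<forall>i. q i \<in> carrier S) \<and>
    finsum S (\<lambda>i. p i \<otimes> e \<otimes> q i) {..<n::nat} = x"
  have step: "\<exists>n p q. ?R (x \<oplus> s \<otimes> e \<otimes> t) n p q"
    if ex: "\<exists>n p q. ?R x n p q" and st: "s \<in> carrier S" "t \<in> carrier S" for x s t
  proof -
    obtain n p q where pq: "?R x n p q" using ex by blast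
    let ?p = "p(n := s)" and ?q = "q(n := t)"
    have "finsum S (\<lambda>i. ?p i \<otimes> e \<otimes> ?q i) {..<Suc n} =
        (?p n \<otimes> e \<otimes> ?q n) \<oplus> finsum S (\<lambda>i. ?p i \<otimes> e \<otimes> ?q i) {..<n}"
      unfolding lessThan_Suc using pq st e by (intro G.finsum_insert) auto
    also have "finsum S (\<lambda>i. ?p i \<otimes> e \<otimes> ?q i) {..<n} = finsum S (\<lambda>i. p i \<otimes> e \<otimes> q i) {..<n}"
      using pq e by (intro G.finsum_cong') auto
    also have "(?p n \<otimes> e \<otimes> ?q n) \<oplus> finsum S (\<lambda>i. p i \<otimes> e \<otimes> q i) {..<n} = x \<oplus> s \<otimes> e \<otimes> t"
    proof -
      have "x \<in> carrier S" using pq e by (auto intro!: G.finsum_closed)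
      then show ?thesis using pq st e by (simp add: G.a_comm)
    qed
    finally have "?R (x \<oplus> s \<otimes> e \<otimes> t) (Suc n) ?p ?q"
      using pq st by simp
    then show ?thesis by blast
  qed
  have zero: "\<exists>n p q. ?R \<zero> n p q"
    by (rule exI[of _ 0]) (auto intro!: exI[of _ "\<lambda>_. \<zero>"])
  have single: "\<exists>n p q. ?R (s \<otimes> e \<otimes> t) n p q" if "s \<in> carrier S" "t \<in> carrier S" for s t
    using step[OF zero that] that e by simp
  have sum: "\<exists>n p q. ?R (x \<oplus> y) n p q" if x: "\<exists>n p q. ?R x n p q" and y: "\<exists>n p q. ?R y n p q" for x y
  proof -
    obtain m p q where pq: "?R y m p q" using y by blast
    have xc: "x \<in> carrier S" using x e by (auto intro!: G.finsum_closed)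
    have "\<exists>n p' q'. ?R (x \<oplus> finsum S (\<lambda>i. p i \<otimes> e \<otimes> q i) {..<l}) n p' q'" for l :: nat
    proof (induction l)
      case 0
      then show ?case using x xc by simp
    next
      case (Suc l)
      have c: "finsum S (\<lambda>i. p i \<otimes> e \<otimes> q i) {..<l} \<in> carrier S"
        using pq e by (auto intro!: G.finsum_closed)
      have "finsum S (\<lambda>i. p i \<otimes> e \<otimes> q i) {..<Suc l} = (p l \<otimes> e \<otimes> q l) \<oplus> finsum S (\<lambda>i. p i \<otimes> e \<otimes> q i) {..<l}"
        unfolding lessThan_Suc using pq e by (intro G.finsum_insert) auto
      then have "x \<oplus> finsum S (\<lambda>i. p i \<otimes> e \<otimes> q i) {..<Suc l} =
          x \<oplus> finsum S (\<lambda>i. p i \<otimes> e \<otimes> q i) {..<l} \<oplus> p l \<otimes> e \<otimes> q l"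
        using xc c pq e by (simp add: G.a_ac)
      then show ?case
        using step[OF Suc.IH, of "p l" "q l"] pq by simp
    qed
    then show ?thesis using pq by blast
  qed
  show ?thesis
    using x unfolding two_sided_span_def
  proof (induction rule: generate.induct)
    case one
    then show ?case using zero by simp
  next
    case (incl h)
    then show ?case using single by auto
  next
    case (inv h)
    then obtain s t where st: "s \<in> carrier S" "t \<in> carrier S" "h = s \<otimes> e \<otimes> t"
      by auto
    have "\<ominus> h = \<ominus> s \<otimes> e \<otimes> t"
      using st e by (simp add: ring.l_minus[OF S.ring_A])
    then show ?case
      using single[of "\<ominus> s" t] st by (simp flip: a_inv_def)
  next
    case (eng h1 h2)
    then show ?case using sum by simp
  qed
qed

section \<open>The degree zero part of the tensor algebra\<close>

context complex_bimodule
begin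

lemma tensor_scalar_one: "tensor_scalar S V \<one>\<^bsub>S\<^esub> = \<one>\<^bsub>tensor_alg S V\<^esub>"
  by (simp add: tensor_scalar_def tensor_alg_one)

lemma tensor_scalar_add: "s \<in> carrier S \<Longrightarrow> t \<in> carrier S \<Longrightarrow>
    tensor_scalar S V (s \<oplus>\<^bsub>S\<^esub> t) = tensor_scalar S V s \<oplus>\<^bsub>tensor_alg S V\<^esub> tensor_scalar S V t"
  using relation_Scalar_add by (simp add: tensor_scalar_def tensor_alg_add tensor_class_eq_iff tcong_def)

text \<open>The scalar relations combine any element supported on scalar words into a single
  \<open>Scalar s\<close>. A graded automorphism preserves degree 0 and hence maps scalars to
  scalars.\<close>

lemma tensor_power_0:
  assumes "x \<in> tensor_power S V 0"
  shows "\<exists>s\<in>carrier S. x = tensor_scalar S V s"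
proof -
  obtain f where f: "f \<in> fcarrier S V" "\<forall>u\<in>Poly_Mapping.keys f. word_degree u = 0" "x = tensor_class S V f"
    using assms by (auto simp: tensor_power_def)
  let ?P = "{f. \<exists>s\<in>carrier S. tcong S V f (word (Scalar s))}"
  have "free.subspace ?P"
  proof (rule free.subspaceI)
    have "\<zero>\<^bsub>S\<^esub> \<in> carrier S" by (rule abelian_groupE(2)[OF S.abelian_group_A])
    \<comment> \<open>The word of the zero of \<open>S\<close> is null: this is the empty case of
      additivity under finite sums.\<close>
    moreover have "tcong S V 0 (word (Scalar \<zero>\<^bsub>S\<^esub>))"
      using tcong_sym[OF tcong_finsum[OF S.abelian_group_A, of S V "\<lambda>s. word (Scalar s)" "{}"]] relation_Scalar_add
        abelian_monoid.finsum_empty[OF abelian_group.axioms(1)[OF S.abelian_group_A]]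
      by (simp add: tcong_def)
    ultimately show "0 \<in> ?P" by blast
    show "f + g \<in> ?P" if fg: "f \<in> ?P" "g \<in> ?P" for f g
    proof -
      obtain s t where s: "s \<in> carrier S" "tcong S V f (word (Scalar s))" and t: "t \<in> carrier S" "tcong S V g (word (Scalar t))"
        using fg by blast
      have "tcong S V (f + g) (word (Scalar (s \<oplus>\<^bsub>S\<^esub> t)))"
        using tcong_trans[OF tcong_add[OF s(2) t(2)]] tcong_sym[of S V "word (Scalar (s \<oplus>\<^bsub>S\<^esub> t))"] relation_Scalar_add[OF s(1) t(1)]
        by (simp add: tcong_def)
      then show ?thesis
        using abelian_groupE(1)[OF S.abelian_group_A s(1) t(1)] by blast
    qed
    show "free_scale c f \<in> ?P" if fg: "f \<in> ?P" for c f
    proof -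
      obtain s where s: "s \<in> carrier S" "tcong S V f (word (Scalar s))"
        using fg by blast
      have "tcong S V (free_scale c f) (word (Scalar (c \<odot>\<^bsub>S\<^esub> s)))"
        using tcong_trans[OF tcong_scale[OF s(2)]] tcong_sym[of S V "word (Scalar (c \<odot>\<^bsub>S\<^esub> s))"] relation_Scalar_smult[OF s(1)]
        by (simp add: tcong_def del: free_scale_single)
      then show ?thesis
        using S.smult_carrier[OF s(1)] by blast
    qed
  qed
  moreover have "word u \<in> ?P" if u: "u \<in> Poly_Mapping.keys f" for u
  proof -
    have "u \<in> tensor_words S V" using u f(1) by (auto simp: fcarrier_def)
    then show ?thesis
    proof (cases rule: tensor_words_cases)
      case (1 s)
      then show ?thesis using tcong_refl[of S V "word (Scalar s)"] by blast
    qed (use u f(2) in auto)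
  qed
  ultimately have "f \<in> ?P" by (rule free_induct)
  then show ?thesis
    using f(3) by (auto simp: tensor_scalar_def tensor_class_eq_iff)
qed

lemma tensor_scalar_power_0: "s \<in> carrier S \<Longrightarrow> tensor_scalar S V s \<in> tensor_power S V 0"
  by (auto simp: tensor_power_def tensor_scalar_def intro!: exI[of _ "word (Scalar s)"])

end

section \<open>Spaces of derivatives\<close>

context traced_bimodule
begin

abbreviation (input) "TT \<equiv> tensor_alg S V"
abbreviation "contractions \<phi>s x \<equiv> foldr (contract S Tr V) \<phi>s x"

lemma TT_alg: "complex_alg TT"
  by (rule tensor_alg_complex_alg)

interpretation TT: complex_alg TT
  by (rule TT_alg)

lemma contractions_closed [simp]:
  "set \<phi>s \<subseteq> dual_space V \<Longrightarrow> x \<in> carrier TT \<Longrightarrow> contractions \<phi>s x \<in> carrier TT"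
  by (induction \<phi>s) auto

lemma contractions_add:
  "set \<phi>s \<subseteq> dual_space V \<Longrightarrow> x \<in> carrier TT \<Longrightarrow> y \<in> carrier TT \<Longrightarrow>
    contractions \<phi>s (x \<oplus>\<^bsub>TT\<^esub> y) = contractions \<phi>s x \<oplus>\<^bsub>TT\<^esub> contractions \<phi>s y"
  by (induction \<phi>s) (auto simp: contract_add)

lemma contractions_mult_scalar:
  "set \<phi>s \<subseteq> dual_space V \<Longrightarrow> x \<in> carrier TT \<Longrightarrow> t \<in> carrier S \<Longrightarrow>
    contractions \<phi>s (x \<otimes>\<^bsub>TT\<^esub> tensor_scalar S V t) = contractions \<phi>s x \<otimes>\<^bsub>TT\<^esub> tensor_scalar S V t"
  by (induction \<phi>s) (auto simp: contract_mult_scalar)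

definition derivatives :: "('s, 'v) tensor \<Rightarrow> nat \<Rightarrow> ('s, 'v) tensor set" where
  "derivatives \<omega> k = {tensor_scalar S V s \<otimes>\<^bsub>TT\<^esub> contractions \<phi>s (\<omega> \<otimes>\<^bsub>TT\<^esub> tensor_scalar S V x) | s \<phi>s x.
      s \<in> carrier S \<and> x \<in> carrier S \<and> set \<phi>s \<subseteq> dual_space V \<and> length \<phi>s = k}"

lemma derivative_space_generate: "derivative_space S Tr V \<omega> k = generate (add_monoid TT) (derivatives \<omega> k)"
  by (simp add: derivative_space_def derivatives_def)

lemma derivatives_closed: "\<omega> \<in> carrier TT \<Longrightarrow> derivatives \<omega> k \<subseteq> carrier TT"
  by (auto simp: derivatives_def)

lemma derivative_space_subgroup:
  assumes "\<omega> \<in> carrier TT" shows "subgroup (derivative_space S Tr V \<omega> k) (add_monoid TT)"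
  unfolding derivative_space_generate
  using derivatives_closed[OF assms]
  by (intro group.generate_is_subgroup abelian_group.a_group[OF TT.abelian_group_A]) simp

text \<open>A left multiplier merges with the outer scalar of a generator. A right multiplier
  commutes with the contractions and merges with the scalar next to \<open>\<omega>\<close>.\<close>

lemma derivative_space_sub_bimodule:
  assumes \<omega>: "\<omega> \<in> carrier TT"
  shows "sub_bimodule S V (derivative_space S Tr V \<omega> k)"
  unfolding sub_bimodule_def
proof (intro conjI ballI)
  note sg = derivative_space_subgroup[OF \<omega>, of k]
  show "subgroup (derivative_space S Tr V \<omega> k) (add_monoid TT)" by (rule sg)
  fix t m assume t: "t \<in> carrier S" and m: "m \<in> derivative_space S Tr V \<omega> k"
  note m' = m[unfolded derivative_space_generate]
  have incl: "x \<in> derivatives \<omega> k \<Longrightarrow> x \<in> derivative_space S Tr V \<omega> k" for x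
    unfolding derivative_space_generate by (rule generate.incl)
  show "tensor_scalar S V t \<otimes>\<^bsub>TT\<^esub> m \<in> derivative_space S Tr V \<omega> k"
  proof (rule additive_generate[OF TT.abelian_group_A TT.abelian_group_A sg _ _ derivatives_closed[OF \<omega>] _ m'])
    fix x assume "x \<in> derivatives \<omega> k"
    then obtain s \<phi>s y where x: "x = tensor_scalar S V s \<otimes>\<^bsub>TT\<^esub> contractions \<phi>s (\<omega> \<otimes>\<^bsub>TT\<^esub> tensor_scalar S V y)"
      "s \<in> carrier S" "y \<in> carrier S" "set \<phi>s \<subseteq> dual_space V" "length \<phi>s = k"
      by (auto simp: derivatives_def)
    have "tensor_scalar S V t \<otimes>\<^bsub>TT\<^esub> x =
        tensor_scalar S V (t \<otimes>\<^bsub>S\<^esub> s) \<otimes>\<^bsub>TT\<^esub> contractions \<phi>s (\<omega> \<otimes>\<^bsub>TT\<^esub> tensor_scalar S V y)"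
      using x t \<omega> by (simp flip: tensor_scalar_mult TT.A_m_assoc)
    then have "tensor_scalar S V t \<otimes>\<^bsub>TT\<^esub> x \<in> derivatives \<omega> k"
      using x t S.A_m_closed[OF t x(2)] unfolding derivatives_def by blast
    then show "tensor_scalar S V t \<otimes>\<^bsub>TT\<^esub> x \<in> derivative_space S Tr V \<omega> k" by (rule incl)
  qed (use t in \<open>auto simp: TT.A_r_distr\<close>)
  show "m \<otimes>\<^bsub>TT\<^esub> tensor_scalar S V t \<in> derivative_space S Tr V \<omega> k"
  proof (rule additive_generate[OF TT.abelian_group_A TT.abelian_group_A sg _ _ derivatives_closed[OF \<omega>] _ m'])
    fix x assume "x \<in> derivatives \<omega> k"
    then obtain s \<phi>s y where x: "x = tensor_scalar S V s \<otimes>\<^bsub>TT\<^esub> contractions \<phi>s (\<omega> \<otimes>\<^bsub>TT\<^esub> tensor_scalar S V y)"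
      "s \<in> carrier S" "y \<in> carrier S" "set \<phi>s \<subseteq> dual_space V" "length \<phi>s = k"
      by (auto simp: derivatives_def)
    have "x \<otimes>\<^bsub>TT\<^esub> tensor_scalar S V t =
        tensor_scalar S V s \<otimes>\<^bsub>TT\<^esub> contractions \<phi>s (\<omega> \<otimes>\<^bsub>TT\<^esub> tensor_scalar S V (y \<otimes>\<^bsub>S\<^esub> t))"
      using x t \<omega> by (simp add: TT.A_m_assoc flip: tensor_scalar_mult contractions_mult_scalar)
    then have "x \<otimes>\<^bsub>TT\<^esub> tensor_scalar S V t \<in> derivatives \<omega> k"
      using x t S.A_m_closed[OF x(3) t] unfolding derivatives_def by blast
    then show "x \<otimes>\<^bsub>TT\<^esub> tensor_scalar S V t \<in> derivative_space S Tr V \<omega> k" by (rule incl)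
  qed (use t in \<open>auto simp: TT.A_l_distr\<close>)
qed

text \<open>\<open>dual_space\<close> does not constrain functionals outside the carrier, so a
  functional on \<open>eVe\<close> and its extension restricted to \<open>eVe\<close> may differ as
  functions; contraction does not see this.\<close>

lemma contract_cong:
  assumes "\<phi> \<in> dual_space V" "\<psi> \<in> dual_space V" "\<And>v. v \<in> carrier V \<Longrightarrow> \<phi> v = \<psi> v" "x \<in> carrier TT"
  shows "contract S Tr V \<phi> x = contract S Tr V \<psi> x"
proof -
  obtain f where f: "f \<in> fcarrier S V" "x = tensor_class S V f"
    using assms(4) by (rule tensor_alg_cases)
  have br: "br \<phi> v = br \<psi> v" if "v \<in> carrier V" for v
    using that assms(1-3) by (intro bracket_eqI) (auto simp: bracket_trace)
  have "contract_word S Tr V \<phi> u = contract_word S Tr V \<psi> u" if "u \<in> tensor_words S V" for u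
    using that
  proof (cases rule: tensor_words_cases)
    case (2 v vs)
    then show ?thesis by (cases vs) (simp_all add: br)
  qed simp
  then have "contract_free S Tr V \<phi> f = contract_free S Tr V \<psi> f"
    unfolding contract_free_lin using f(1) by (intro lin_cong) (auto simp: fcarrier_def)
  then show ?thesis
    using f(2) assms(1,2) by (simp add: contract_class)
qed

end

section \<open>Trace, functionals and contractions on the corner\<close>

locale traced_full_corner = full_corner S V e n p q + traced_bimodule S V Tr
  for S :: "(complex, 's) module" and V :: "('s, 'v) bimodule" and e n p q Tr
begin

text \<open>For \<open>x\<close> in \<open>eSe\<close>, cyclicity gives
  \<open>Tr(x s) = Tr(x (ese))\<close>, so testing against the corner amounts to testing against
  \<open>S\<close>.\<close>

lemma corner_nondegenerate: "nondegenerate_trace S' Tr"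
proof -
  have "x = \<zero>\<^bsub>S\<^esub>" if x: "x \<in> carrier S'" and 0: "\<forall>y\<in>carrier S'. Tr (x \<otimes>\<^bsub>S\<^esub> y) = 0" for x
  proof -
    have x': "x \<in> carrier S" "e \<otimes>\<^bsub>S\<^esub> x = x" "x \<otimes>\<^bsub>S\<^esub> e = x"
      using x by (auto simp: S'_iff)
    have "Tr (x \<otimes>\<^bsub>S\<^esub> s) = 0" if s: "s \<in> carrier S" for s
    proof -
      have "x \<otimes>\<^bsub>S\<^esub> (e \<otimes>\<^bsub>S\<^esub> s \<otimes>\<^bsub>S\<^esub> e) = (x \<otimes>\<^bsub>S\<^esub> s) \<otimes>\<^bsub>S\<^esub> e"
        using x' s by (simp flip: S.A_m_assoc)
      moreover have "Tr ((x \<otimes>\<^bsub>S\<^esub> s) \<otimes>\<^bsub>S\<^esub> e) = Tr (e \<otimes>\<^bsub>S\<^esub> (x \<otimes>\<^bsub>S\<^esub> s))"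
        using trace x' s by (auto simp: nondegenerate_trace_def)
      moreover have "e \<otimes>\<^bsub>S\<^esub> (x \<otimes>\<^bsub>S\<^esub> s) = (e \<otimes>\<^bsub>S\<^esub> x) \<otimes>\<^bsub>S\<^esub> s"
        using x'(1) s by (simp only: S.A_m_assoc e_closed)
      ultimately show ?thesis
        using bspec[OF 0 S'_sandwich[OF s]] x'(2) by simp
    qed
    then show ?thesis
      using trace x' by (auto simp: nondegenerate_trace_def)
  qed
  then show ?thesis
    using trace by (auto simp: nondegenerate_trace_def S'_S)
qed

text \<open>The form \<open>s |-> f(ese)\<close> on \<open>S\<close> is represented by some
  \<open>r\<close>, and \<open>ere\<close> represents \<open>f\<close>, because cyclicity of the
  trace moves the outer \<open>e\<close> next to \<open>s\<close>.\<close>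

lemma corner_representation:
  assumes f: "linear_form S' f"
  shows "\<exists>r\<in>carrier S'. \<forall>s\<in>carrier S'. Tr (r \<otimes>\<^bsub>S'\<^esub> s) = f s"
proof -
  have "linear_form S (\<lambda>s. f (e \<otimes>\<^bsub>S\<^esub> s \<otimes>\<^bsub>S\<^esub> e))"
    using linear_form_add[OF f] linear_form_smult[OF f]
    by (auto simp: linear_form_def S.A_l_distr S.A_r_distr S.smult_mult_left[symmetric] S.smult_mult_right[symmetric])
  then obtain r where r: "r \<in> carrier S" "\<And>s. s \<in> carrier S \<Longrightarrow> Tr (r \<otimes>\<^bsub>S\<^esub> s) = f (e \<otimes>\<^bsub>S\<^esub> s \<otimes>\<^bsub>S\<^esub> e)"
    using representation by blast
  have "Tr (e \<otimes>\<^bsub>S\<^esub> r \<otimes>\<^bsub>S\<^esub> e \<otimes>\<^bsub>S\<^esub> s) = f s" if s: "s \<in> carrier S'" for s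
  proof -
    have s': "s \<in> carrier S" "e \<otimes>\<^bsub>S\<^esub> s = s" "s \<otimes>\<^bsub>S\<^esub> e = s"
      using s by (auto simp: S'_iff)
    have "Tr (e \<otimes>\<^bsub>S\<^esub> r \<otimes>\<^bsub>S\<^esub> e \<otimes>\<^bsub>S\<^esub> s) = Tr (e \<otimes>\<^bsub>S\<^esub> (r \<otimes>\<^bsub>S\<^esub> s))"
      using s' r(1) by (simp add: S.A_m_assoc)
    also have "\<dots> = Tr ((r \<otimes>\<^bsub>S\<^esub> s) \<otimes>\<^bsub>S\<^esub> e)"
      using trace s' r(1) by (auto simp: nondegenerate_trace_def)
    also have "\<dots> = f s"
      using s' r by (simp add: S.A_m_assoc)
    finally show ?thesis .
  qed
  then show ?thesis
    using r(1) by (intro bexI[of _ "e \<otimes>\<^bsub>S\<^esub> r \<otimes>\<^bsub>S\<^esub> e"]) simp_all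
qed

sublocale CT: traced_bimodule S' V' Tr
  by unfold_locales (rule corner_nondegenerate, rule corner_representation)

sublocale I: corner_iso T T' \<epsilon> "corner_map S V"
  by (intro corner_iso.intro corner_iso_axioms.intro T_alg T'_alg corner_map_iso) simp_all

lemma corner_map_scalar: "corner_map S V (tensor_scalar S' V' s) = tensor_scalar S V s"
  by (simp add: tensor_scalar_def corner_map_class)

lemma dual_corner: "\<phi> \<in> dual_space V \<Longrightarrow> \<phi> \<in> dual_space V'"
  by (auto simp: dual_space_def V'_iff)

text \<open>The condition on \<open>\<phi>\<close> says \<open>e \<phi> = \<phi>\<close> and forces
  the bracket to be fixed by \<open>e\<close> on the left; \<open>w = w e\<close> does the same on
  the right. So the bracket over \<open>S\<close> lies in \<open>eSe\<close> and has the property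
  that characterizes the bracket over the corner.\<close>

lemma contract_corner:
  assumes \<phi>: "\<phi> \<in> dual_space V" and right: "\<And>w. w \<in> carrier V \<Longrightarrow> \<phi> (ract V w e) = \<phi> w"
    and u: "u \<in> carrier T'"
  shows "corner_map S V (contract S' Tr V' \<phi> u) = contract S Tr V \<phi> (corner_map S V u)"
proof -
  obtain f where f: "f \<in> fcarrier S' V'" "u = tensor_class S' V' f"
    using u by (rule C.tensor_alg_cases)
  have br: "bracket S' Tr V' \<phi> w = bracket S Tr V \<phi> w" if w: "w \<in> carrier V'" for w
  proof (rule CT.bracket_eqI[OF dual_corner[OF \<phi>] w])
    have w': "w \<in> carrier V" "ract V w e = w" using w by (auto simp: V'_iff)
    have "br \<phi> w \<otimes>\<^bsub>S\<^esub> e = br \<phi> w"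
      using bracket_ract[OF \<phi> w'(1) e_closed] w'(2) by simp
    moreover have "e \<otimes>\<^bsub>S\<^esub> br \<phi> w = br \<phi> w"
    proof -
      have "br (\<lambda>v. \<phi> (ract V v e)) w = br \<phi> w"
        using \<phi> w' right by (intro bracket_eqI dual_ract) (auto simp: bracket_trace)
      then show ?thesis
        using mult_bracket[OF \<phi> w'(1) e_closed] by simp
    qed
    ultimately show "br \<phi> w \<in> carrier S'"
      using \<phi> w' by (simp add: S'_iff)
    show "Tr (br \<phi> w \<otimes>\<^bsub>S'\<^esub> s) = \<phi> (ract V' w s)" if "s \<in> carrier S'" for s
      using \<phi> w' S'_S[OF that] by (simp add: bracket_trace)
  qed
  have "contract_word S' Tr V' \<phi> w = contract_word S Tr V \<phi> w" if "w \<in> tensor_words S' V'" for w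
    using that
  proof (cases rule: C.tensor_words_cases)
    case (2 v vs)
    then show ?thesis by (cases vs) (simp_all add: br)
  qed simp
  then have "contract_free S' Tr V' \<phi> f = contract_free S Tr V \<phi> f"
    unfolding contract_free_lin CT.contract_free_lin using f(1) by (intro lin_cong) (auto simp: fcarrier_def)
  then show ?thesis
    using f \<phi> dual_corner[OF \<phi>] by (simp add: CT.contract_class contract_class corner_map_class)
qed

text \<open>Extension along the projection \<open>v |-> eve\<close>, that is, by zero on the other
  Peirce components of \<open>V\<close>. The result satisfies the invariance demanded by
  \<open>contract_corner\<close>.\<close>

definition extend_dual :: "('v \<Rightarrow> complex) \<Rightarrow> 'v \<Rightarrow> complex" where
  "extend_dual \<phi> v = \<phi> (ract V (lact V e v) e)"

lemma sandwich_V' [simp]: "v \<in> carrier V \<Longrightarrow> ract V (lact V e v) e \<in> carrier V'"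
  by (auto simp: corner_bimod_def)

lemma extend_dual: "\<phi> \<in> dual_space V' \<Longrightarrow> extend_dual \<phi> \<in> dual_space V"
  by (auto simp: dual_space_iff linear_form_def extend_dual_def lact_add ract_add lact_smult_right ract_smult_left)

lemma contractions_corner:
  assumes "set \<phi>s \<subseteq> dual_space V'" "u \<in> carrier T'"
  shows "corner_map S V (CT.contractions \<phi>s u) = contractions (map extend_dual \<phi>s) (corner_map S V u)"
  using assms(1)
proof (induction \<phi>s)
  case (Cons \<phi> \<phi>s)
  then have \<phi>: "\<phi> \<in> dual_space V'" and x: "CT.contractions \<phi>s u \<in> carrier T'"
    using assms(2) by auto
  have "contract S' Tr V' \<phi> (CT.contractions \<phi>s u) = contract S' Tr V' (extend_dual \<phi>) (CT.contractions \<phi>s u)"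
    by (rule CT.contract_cong[OF \<phi> dual_corner[OF extend_dual[OF \<phi>]] _ x]) (simp add: extend_dual_def V'_iff)
  moreover have "corner_map S V \<dots> = contract S Tr V (extend_dual \<phi>) (corner_map S V (CT.contractions \<phi>s u))"
    using \<phi> x by (intro contract_corner extend_dual) (auto simp: extend_dual_def lact_ract)
  ultimately show ?case
    using Cons by simp
qed simp

lemma scalar_full: "finsum T (\<lambda>i. tensor_scalar S V (p i) \<otimes>\<^bsub>T\<^esub> \<epsilon> \<otimes>\<^bsub>T\<^esub> tensor_scalar S V (q i)) {..<n} = \<one>\<^bsub>T\<^esub>"
proof -
  have "tensor_scalar S V (finsum S (\<lambda>i. p i \<otimes>\<^bsub>S\<^esub> e \<otimes>\<^bsub>S\<^esub> q i) {..<n}) =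
      finsum T (\<lambda>i. tensor_scalar S V (p i \<otimes>\<^bsub>S\<^esub> e \<otimes>\<^bsub>S\<^esub> q i)) {..<n}"
    by (intro finsum_additive S.abelian_group_A I.T.abelian_group_A) (auto simp: tensor_scalar_add)
  then show ?thesis
    by (simp add: full tensor_scalar_one tensor_scalar_mult)
qed

text \<open>1 is inserted in front of the contraction. Multiplying by \<open>e q_i\<close> changes
  the functional to \<open>v |-> \<phi>(v e q_i)\<close>, which is invariant under
  \<open>v |-> v e\<close>, so that this contraction can be computed inside the corner.\<close>

lemma contract_expand:
  assumes \<phi>: "\<phi> \<in> dual_space V" and u: "u \<in> carrier T'"
  shows "contract S Tr V \<phi> (corner_map S V u) = finsum T (\<lambda>i. tensor_scalar S V (p i) \<otimes>\<^bsub>T\<^esub>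
    corner_map S V (contract S' Tr V' (\<lambda>v. \<phi> (ract V v (e \<otimes>\<^bsub>S\<^esub> q i))) u)) {..<n}"
proof -
  let ?x = "contract S Tr V \<phi> (corner_map S V u)"
  have x: "?x \<in> carrier T" using \<phi> u by simp
  have "?x = finsum T (\<lambda>i. tensor_scalar S V (p i) \<otimes>\<^bsub>T\<^esub> \<epsilon> \<otimes>\<^bsub>T\<^esub> tensor_scalar S V (q i)) {..<n} \<otimes>\<^bsub>T\<^esub> ?x"
    using x by (simp add: scalar_full)
  also have "\<dots> = finsum T (\<lambda>i. (tensor_scalar S V (p i) \<otimes>\<^bsub>T\<^esub> \<epsilon> \<otimes>\<^bsub>T\<^esub> tensor_scalar S V (q i)) \<otimes>\<^bsub>T\<^esub> ?x) {..<n}"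
    using x by (intro finsum_additive[where f = "\<lambda>y. y \<otimes>\<^bsub>T\<^esub> ?x"] I.T.abelian_group_A) (auto simp: I.T.A_l_distr)
  also have "(\<lambda>i. (tensor_scalar S V (p i) \<otimes>\<^bsub>T\<^esub> \<epsilon> \<otimes>\<^bsub>T\<^esub> tensor_scalar S V (q i)) \<otimes>\<^bsub>T\<^esub> ?x) =
      (\<lambda>i. tensor_scalar S V (p i) \<otimes>\<^bsub>T\<^esub> corner_map S V (contract S' Tr V' (\<lambda>v. \<phi> (ract V v (e \<otimes>\<^bsub>S\<^esub> q i))) u))"
  proof
    fix i
    have "(tensor_scalar S V (p i) \<otimes>\<^bsub>T\<^esub> \<epsilon> \<otimes>\<^bsub>T\<^esub> tensor_scalar S V (q i)) \<otimes>\<^bsub>T\<^esub> ?x =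
        tensor_scalar S V (p i) \<otimes>\<^bsub>T\<^esub> (tensor_scalar S V (e \<otimes>\<^bsub>S\<^esub> q i) \<otimes>\<^bsub>T\<^esub> ?x)"
      using x by (simp add: I.T.A_m_assoc flip: tensor_scalar_mult)
    also have "tensor_scalar S V (e \<otimes>\<^bsub>S\<^esub> q i) \<otimes>\<^bsub>T\<^esub> ?x = contract S Tr V (\<lambda>v. \<phi> (ract V v (e \<otimes>\<^bsub>S\<^esub> q i))) (corner_map S V u)"
      using \<phi> u by (intro scalar_mult_contract) simp_all
    also have "\<dots> = corner_map S V (contract S' Tr V' (\<lambda>v. \<phi> (ract V v (e \<otimes>\<^bsub>S\<^esub> q i))) u)"
      using \<phi> u by (intro contract_corner[symmetric] dual_ract) (simp_all flip: ract_mult)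
    finally show "(tensor_scalar S V (p i) \<otimes>\<^bsub>T\<^esub> \<epsilon> \<otimes>\<^bsub>T\<^esub> tensor_scalar S V (q i)) \<otimes>\<^bsub>T\<^esub> ?x =
        tensor_scalar S V (p i) \<otimes>\<^bsub>T\<^esub> corner_map S V (contract S' Tr V' (\<lambda>v. \<phi> (ract V v (e \<otimes>\<^bsub>S\<^esub> q i))) u)" .
  qed
  finally show ?thesis .
qed

lemma corner_map_subgroup:
  assumes H: "subgroup H (add_monoid T')"
  shows "subgroup (corner_map S V ` H) (add_monoid T)"
proof (rule subgroup.intro)
  have H': "x \<in> carrier T'" if "x \<in> H" for x
    using subgroup.mem_carrier[OF H that] by simp
  show "corner_map S V ` H \<subseteq> carrier (add_monoid T)"
    using H' by auto
  show "x \<otimes>\<^bsub>add_monoid T\<^esub> y \<in> corner_map S V ` H"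
    if "x \<in> corner_map S V ` H" "y \<in> corner_map S V ` H" for x y
  proof -
    obtain a b where ab: "a \<in> H" "x = corner_map S V a" "b \<in> H" "y = corner_map S V b"
      using \<open>x \<in> corner_map S V ` H\<close> \<open>y \<in> corner_map S V ` H\<close> by blast
    then have "x \<oplus>\<^bsub>T\<^esub> y = corner_map S V (a \<oplus>\<^bsub>T'\<^esub> b)"
      using H' by (simp add: I.iota)
    then show ?thesis
      using subgroup.m_closed[OF H ab(1,3)] by simp
  qed
  show "\<one>\<^bsub>add_monoid T\<^esub> \<in> corner_map S V ` H"
    using imageI[OF subgroup.one_closed[OF H], of "corner_map S V"] by (simp add: I.iota_zero)
  show "inv\<^bsub>add_monoid T\<^esub> x \<in> corner_map S V ` H" if x: "x \<in> corner_map S V ` H" for x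
  proof -
    obtain a where a: "a \<in> H" "x = corner_map S V a"
      using x by blast
    then have "\<ominus>\<^bsub>T\<^esub> x = corner_map S V (\<ominus>\<^bsub>T'\<^esub> a)"
      using H' by (simp add: I.iota_uminus)
    then show ?thesis
      using subgroup.m_inv_closed[OF H a(1)] by (simp flip: a_inv_def)
  qed
qed

text \<open>Like the space of derivatives over the corner, but with no scalar to the right of
  \<open>u\<close>: before this span is used, the twist has moved that scalar to the left.\<close>

definition contraction_span :: "('s, 'v) tensor \<Rightarrow> nat \<Rightarrow> ('s, 'v) tensor set" where
  "contraction_span u k = generate (add_monoid T')
     {tensor_scalar S' V' r \<otimes>\<^bsub>T'\<^esub> CT.contractions \<phi>s u | r \<phi>s.
       r \<in> carrier S' \<and> set \<phi>s \<subseteq> dual_space V' \<and> length \<phi>s = k}"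

lemma contraction_span_subgroup:
  assumes "u \<in> carrier T'" shows "subgroup (contraction_span u k) (add_monoid T')"
  unfolding contraction_span_def
  using assms complex_alg.A_m_closed[OF T'_alg]
  by (intro group.generate_is_subgroup abelian_group.a_group[OF complex_alg.abelian_group_A[OF T'_alg]]) auto

text \<open>\<open>foldr\<close> applies the last functional of the list first, so a contraction
  carried out beforehand is recorded by appending \<open>\<phi>\<close> at the end.\<close>

lemma contraction_span_Suc:
  assumes "\<phi> \<in> dual_space V'"
  shows "contraction_span (contract S' Tr V' \<phi> u) k \<subseteq> contraction_span u (Suc k)"
  unfolding contraction_span_def
proof (rule group.mono_generate[OF abelian_group.a_group[OF complex_alg.abelian_group_A[OF T'_alg]]], safe)
  fix r \<phi>s assume "r \<in> carrier S'" "set \<phi>s \<subseteq> dual_space V'" "k = length \<phi>s"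
  then show "\<exists>r' \<phi>s'. tensor_scalar S' V' r \<otimes>\<^bsub>T'\<^esub> CT.contractions \<phi>s (contract S' Tr V' \<phi> u) =
      tensor_scalar S' V' r' \<otimes>\<^bsub>T'\<^esub> CT.contractions \<phi>s' u \<and>
      r' \<in> carrier S' \<and> set \<phi>s' \<subseteq> dual_space V' \<and> length \<phi>s' = Suc (length \<phi>s)"
    using assms by (intro exI[of _ r] exI[of _ "\<phi>s @ [\<phi>]"]) auto
qed

text \<open>
  By \<open>contract_expand\<close> a contraction of an element of the corner is a left \<open>S\<close>-combination of
  contractions taken inside the corner, and the coefficients are absorbed by the next functional.
\<close>

lemma contractions_in_span:
  assumes "set \<phi>s \<subseteq> dual_space V" "u \<in> carrier T'" "s \<in> carrier S" "t \<in> carrier S"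
  shows "tensor_scalar S V (e \<otimes>\<^bsub>S\<^esub> s) \<otimes>\<^bsub>T\<^esub> contractions \<phi>s (tensor_scalar S V t \<otimes>\<^bsub>T\<^esub> corner_map S V u)
    \<in> corner_map S V ` contraction_span u (length \<phi>s)"
  using assms
\<comment> \<open>Reverse induction peels off the functional that is applied first. Both
  \<open>u\<close> and \<open>t\<close> vary, because the induction hypothesis is applied to a
  contraction of \<open>u\<close> with coefficient \<open>p i\<close>.\<close>
proof (induction \<phi>s arbitrary: u t rule: rev_induct)
  case Nil
  define r where "r = e \<otimes>\<^bsub>S\<^esub> (s \<otimes>\<^bsub>S\<^esub> t) \<otimes>\<^bsub>S\<^esub> e"
  have r: "r \<in> carrier S'" using Nil by (simp add: r_def)
  have "tensor_scalar S V (e \<otimes>\<^bsub>S\<^esub> s) \<otimes>\<^bsub>T\<^esub> (tensor_scalar S V t \<otimes>\<^bsub>T\<^esub> corner_map S V u) =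
      tensor_scalar S V (e \<otimes>\<^bsub>S\<^esub> s) \<otimes>\<^bsub>T\<^esub> (tensor_scalar S V t \<otimes>\<^bsub>T\<^esub> (\<epsilon> \<otimes>\<^bsub>T\<^esub> corner_map S V u))"
    using Nil by (simp add: I.iota_eps)
  also have "\<dots> = tensor_scalar S V r \<otimes>\<^bsub>T\<^esub> corner_map S V u"
    using Nil by (simp add: r_def S.A_m_assoc tensor_scalar_mult flip: I.T.A_m_assoc)
  also have "\<dots> = corner_map S V (tensor_scalar S' V' r \<otimes>\<^bsub>T'\<^esub> CT.contractions [] u)"
    using Nil r by (simp add: I.iota corner_map_scalar)
  finally have "tensor_scalar S V (e \<otimes>\<^bsub>S\<^esub> s) \<otimes>\<^bsub>T\<^esub> (tensor_scalar S V t \<otimes>\<^bsub>T\<^esub> corner_map S V u) =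
      corner_map S V (tensor_scalar S' V' r \<otimes>\<^bsub>T'\<^esub> CT.contractions [] u)" .
  moreover have "tensor_scalar S' V' r \<otimes>\<^bsub>T'\<^esub> CT.contractions [] u \<in> contraction_span u 0"
    unfolding contraction_span_def using r
    by (intro generate.incl CollectI exI[of _ r] exI[of _ "[]"]) simp
  ultimately show ?case by simp
next
  case (snoc \<phi> \<phi>s)
  define \<psi> where "\<psi> = (\<lambda>v. \<phi> (lact V t v))"
  have \<phi>: "\<phi> \<in> dual_space V" and \<phi>s: "set \<phi>s \<subseteq> dual_space V" using snoc by auto
  have \<psi>: "\<psi> \<in> dual_space V" unfolding \<psi>_def using \<phi> snoc by (intro dual_lact) auto
  define \<chi> where "\<chi> i = (\<lambda>v. \<psi> (ract V v (e \<otimes>\<^bsub>S\<^esub> q i)))" for i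
  have \<chi>: "\<chi> i \<in> dual_space V'" for i
    unfolding \<chi>_def using \<psi> by (intro dual_corner dual_ract) auto
  define g where "g = (\<lambda>i. tensor_scalar S V (p i) \<otimes>\<^bsub>T\<^esub> corner_map S V (contract S' Tr V' (\<chi> i) u))"
  have cu: "contract S' Tr V' (\<chi> i) u \<in> carrier T'" for i
    using \<chi> snoc by simp
  have g: "g i \<in> carrier T" for i
    unfolding g_def using cu by simp
  let ?f = "\<lambda>x. tensor_scalar S V (e \<otimes>\<^bsub>S\<^esub> s) \<otimes>\<^bsub>T\<^esub> contractions \<phi>s x"
  let ?H = "corner_map S V ` contraction_span u (Suc (length \<phi>s))"
  note sg = corner_map_subgroup[OF contraction_span_subgroup[OF snoc.prems(2)], of "Suc (length \<phi>s)"]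
  have "contract S Tr V \<phi> (tensor_scalar S V t \<otimes>\<^bsub>T\<^esub> corner_map S V u) = finsum T g {..<n}"
    using contract_scalar_mult[OF \<phi> snoc.prems(4), of "corner_map S V u", folded \<psi>_def]
      contract_expand[OF \<psi>, of u] snoc.prems
    by (simp add: g_def \<chi>_def)
  then have "tensor_scalar S V (e \<otimes>\<^bsub>S\<^esub> s) \<otimes>\<^bsub>T\<^esub> contractions (\<phi>s @ [\<phi>]) (tensor_scalar S V t \<otimes>\<^bsub>T\<^esub> corner_map S V u) =
      ?f (finsum T g {..<n})"
    by simp
  also have "\<dots> = finsum T (\<lambda>i. ?f (g i)) {..<n}"
    using snoc.prems \<phi>s g
    by (intro finsum_additive I.T.abelian_group_A) (auto simp: contractions_add I.T.A_r_distr)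
  also have "\<dots> \<in> ?H"
  proof (rule finsum_closed_under[OF I.T.abelian_group_A])
    show "?H \<subseteq> carrier T" "\<zero>\<^bsub>T\<^esub> \<in> ?H" "\<And>x y. x \<in> ?H \<Longrightarrow> y \<in> ?H \<Longrightarrow> x \<oplus>\<^bsub>T\<^esub> y \<in> ?H"
      using subgroup.subset[OF sg] subgroup.one_closed[OF sg] subgroup.m_closed[OF sg] by simp_all
    show "?f (g i) \<in> ?H" for i
      using snoc.IH[OF \<phi>s cu[of i] snoc.prems(3) p_closed[of i]] contraction_span_Suc[OF \<chi>[of i], of u "length \<phi>s"]
      unfolding g_def by blast
  qed
  finally show ?case by simp
qed

text \<open>Derivatives over the corner become derivatives of \<open>\<omega>\<close> once
  functionals are extended by \<open>extend_dual\<close>, and they are their own compressions.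
  Conversely, the twist brings a compressed derivative of \<open>\<omega>\<close> into the form
  treated by \<open>contractions_in_span\<close>.\<close>

lemma derivative_space_corner:
  assumes \<tau>: "graded_trace_automorphism S Tr V \<tau>" and \<tau>e: "\<tau> \<epsilon> = \<epsilon>"
    and \<omega>: "twisted_weak_potential S V \<tau> m \<omega>"
    and \<omega>': "\<omega>' \<in> carrier T'" "corner_map S V \<omega>' = \<epsilon> \<otimes>\<^bsub>T\<^esub> \<omega> \<otimes>\<^bsub>T\<^esub> \<epsilon>"
  shows "corner_map S V ` derivative_space S' Tr V' \<omega>' k =
    (\<lambda>w. \<epsilon> \<otimes>\<^bsub>T\<^esub> w \<otimes>\<^bsub>T\<^esub> \<epsilon>) ` derivative_space S Tr V \<omega> k"
proof -
  have \<omega>T: "\<omega> \<in> carrier T"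
    using \<omega> by (auto simp: twisted_weak_potential_def tensor_power_def)
  have twist: "\<tau> (tensor_scalar S V s) \<otimes>\<^bsub>T\<^esub> \<omega> = \<omega> \<otimes>\<^bsub>T\<^esub> tensor_scalar S V s" if "s \<in> carrier S" for s
    using \<omega> that by (auto simp: twisted_weak_potential_def)
  have \<tau>_iso: "\<tau> \<in> alg_iso T T" and \<tau>_deg: "\<tau> ` tensor_power S V 0 = tensor_power S V 0"
    using \<tau> by (auto simp: graded_trace_automorphism_def)
  \<comment> \<open>As \<open>\<tau>\<close> fixes \<open>e\<close>, the twisted condition at
    \<open>e\<close> says that \<open>e\<close> commutes with \<open>\<omega>\<close>; hence
    \<open>e \<omega> e = e \<omega>\<close>.\<close>
  have \<epsilon>\<omega>: "\<epsilon> \<otimes>\<^bsub>T\<^esub> \<omega> = \<omega> \<otimes>\<^bsub>T\<^esub> \<epsilon>"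
    using twist[OF e_closed] by (simp add: \<tau>e)
  have \<omega>'_eq: "corner_map S V \<omega>' = \<epsilon> \<otimes>\<^bsub>T\<^esub> \<omega>"
  proof -
    have "\<epsilon> \<otimes>\<^bsub>T\<^esub> (\<omega> \<otimes>\<^bsub>T\<^esub> \<epsilon>) = \<epsilon> \<otimes>\<^bsub>T\<^esub> \<epsilon> \<otimes>\<^bsub>T\<^esub> \<omega>"
      using \<omega>T by (simp add: I.T.A_m_assoc flip: \<epsilon>\<omega> del: eps_idem)
    then show ?thesis using \<omega>T by (simp add: \<omega>'(2) I.T.A_m_assoc)
  qed
  note sg = derivative_space_subgroup[OF \<omega>T, of k] and sg' = CT.derivative_space_subgroup[OF \<omega>'(1), of k]
  have T'_ab: "abelian_group T'" by (rule complex_alg.abelian_group_A[OF T'_alg])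
  have 1: "corner_map S V w \<in> derivative_space S Tr V \<omega> k" if w: "w \<in> derivative_space S' Tr V' \<omega>' k" for w
  proof (rule additive_generate[OF T'_ab I.T.abelian_group_A sg _ _ CT.derivatives_closed[OF \<omega>'(1)] _
        w[unfolded CT.derivative_space_generate]])
    fix x assume "x \<in> CT.derivatives \<omega>' k"
    then obtain s \<phi>s y where x: "x = tensor_scalar S' V' s \<otimes>\<^bsub>T'\<^esub> CT.contractions \<phi>s (\<omega>' \<otimes>\<^bsub>T'\<^esub> tensor_scalar S' V' y)"
      "s \<in> carrier S'" "y \<in> carrier S'" "set \<phi>s \<subseteq> dual_space V'" "length \<phi>s = k"
      by (auto simp: CT.derivatives_def)
    have \<omega>y: "\<omega>' \<otimes>\<^bsub>T'\<^esub> tensor_scalar S' V' y \<in> carrier T'"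
      using x \<omega>' complex_alg.A_m_closed[OF T'_alg] by simp
    have y: "y \<in> carrier S" "e \<otimes>\<^bsub>S\<^esub> y = y" using x(3) by (auto simp: S'_iff)
    have "\<omega> \<otimes>\<^bsub>T\<^esub> \<epsilon> \<otimes>\<^bsub>T\<^esub> tensor_scalar S V y = \<omega> \<otimes>\<^bsub>T\<^esub> tensor_scalar S V y"
      using \<omega>T y by (simp add: I.T.A_m_assoc tensor_scalar_mult)
    then have "corner_map S V (\<omega>' \<otimes>\<^bsub>T'\<^esub> tensor_scalar S' V' y) = \<omega> \<otimes>\<^bsub>T\<^esub> tensor_scalar S V y"
      using \<omega>' x by (simp add: I.iota corner_map_scalar \<omega>'_eq \<epsilon>\<omega>)
    then have "corner_map S V x = tensor_scalar S V s \<otimes>\<^bsub>T\<^esub> contractions (map extend_dual \<phi>s) (\<omega> \<otimes>\<^bsub>T\<^esub> tensor_scalar S V y)"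
      using x(1,2,4) \<omega>y by (simp add: I.iota corner_map_scalar contractions_corner)
    moreover have "\<dots> \<in> derivatives \<omega> k"
      unfolding derivatives_def using x extend_dual S'_S
      by (intro CollectI exI[of _ s] exI[of _ "map extend_dual \<phi>s"] exI[of _ y]) auto
    ultimately show "corner_map S V x \<in> derivative_space S Tr V \<omega> k"
      unfolding derivative_space_generate by (simp add: generate.incl)
  qed (simp_all add: I.iota)
  have span: "contraction_span \<omega>' k \<subseteq> derivative_space S' Tr V' \<omega>' k"
    unfolding contraction_span_def CT.derivative_space_generate
  proof (rule group.mono_generate[OF abelian_group.a_group[OF T'_ab]], safe)
    fix r \<phi>s assume "r \<in> carrier S'" "set \<phi>s \<subseteq> dual_space V'" "k = length \<phi>s"
    \<comment> \<open>The unit of \<open>T'\<close> is the scalar \<open>e\<close>; it supplies the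
      scalar that generators of the derivative space carry to the right of
      \<open>\<omega>'\<close>.\<close>
    moreover have "\<omega>' = \<omega>' \<otimes>\<^bsub>T'\<^esub> tensor_scalar S' V' e"
      using C.tensor_scalar_one complex_alg.A_r_one[OF T'_alg \<omega>'(1)] by simp
    moreover have "e \<in> carrier S'" by (simp add: S'_iff)
    ultimately show "tensor_scalar S' V' r \<otimes>\<^bsub>T'\<^esub> CT.contractions \<phi>s \<omega>' \<in> CT.derivatives \<omega>' (length \<phi>s)"
      unfolding CT.derivatives_def by (intro CollectI exI[of _ r] exI[of _ \<phi>s] exI[of _ e]) auto
  qed
  have 2: "\<epsilon> \<otimes>\<^bsub>T\<^esub> w \<otimes>\<^bsub>T\<^esub> \<epsilon> \<in> corner_map S V ` derivative_space S' Tr V' \<omega>' k"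
    if w: "w \<in> derivative_space S Tr V \<omega> k" for w
  proof (rule additive_generate[OF I.T.abelian_group_A I.T.abelian_group_A corner_map_subgroup[OF sg'] _ _
        derivatives_closed[OF \<omega>T] _ w[unfolded derivative_space_generate]])
    fix x assume "x \<in> derivatives \<omega> k"
    then obtain s \<phi>s y where x: "x = tensor_scalar S V s \<otimes>\<^bsub>T\<^esub> contractions \<phi>s (\<omega> \<otimes>\<^bsub>T\<^esub> tensor_scalar S V y)"
      "s \<in> carrier S" "y \<in> carrier S" "set \<phi>s \<subseteq> dual_space V" "length \<phi>s = k"
      by (auto simp: derivatives_def)
    \<comment> \<open>\<open>\<tau>\<close> preserves degree 0, so \<open>\<tau>(y)\<close> is a
      scalar \<open>t\<close>. Moving \<open>y e\<close> across \<open>\<omega>\<close> then gives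
      \<open>t (e \<omega>)\<close>, a left multiple of an element of the corner.\<close>
    obtain t where t: "t \<in> carrier S" "\<tau> (tensor_scalar S V y) = tensor_scalar S V t"
      using tensor_power_0 \<tau>_deg tensor_scalar_power_0[OF x(3)] by blast
    have "\<omega> \<otimes>\<^bsub>T\<^esub> tensor_scalar S V y \<otimes>\<^bsub>T\<^esub> \<epsilon> = \<omega> \<otimes>\<^bsub>T\<^esub> tensor_scalar S V (y \<otimes>\<^bsub>S\<^esub> e)"
      using \<omega>T x(3) by (simp add: I.T.A_m_assoc tensor_scalar_mult)
    also have "\<dots> = \<tau> (tensor_scalar S V (y \<otimes>\<^bsub>S\<^esub> e)) \<otimes>\<^bsub>T\<^esub> \<omega>"
      using twist x(3) by simp
    also have "\<dots> = \<tau> (tensor_scalar S V y) \<otimes>\<^bsub>T\<^esub> \<tau> \<epsilon> \<otimes>\<^bsub>T\<^esub> \<omega>"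
      using alg_isoD(5)[OF \<tau>_iso, of "tensor_scalar S V y" \<epsilon>] x(3) by (simp add: tensor_scalar_mult)
    also have "\<dots> = tensor_scalar S V t \<otimes>\<^bsub>T\<^esub> corner_map S V \<omega>'"
      using t \<omega>T by (simp add: \<tau>e \<omega>'_eq I.T.A_m_assoc)
    finally have *: "\<omega> \<otimes>\<^bsub>T\<^esub> tensor_scalar S V y \<otimes>\<^bsub>T\<^esub> \<epsilon> = tensor_scalar S V t \<otimes>\<^bsub>T\<^esub> corner_map S V \<omega>'" .
    have "\<epsilon> \<otimes>\<^bsub>T\<^esub> x \<otimes>\<^bsub>T\<^esub> \<epsilon> =
        tensor_scalar S V (e \<otimes>\<^bsub>S\<^esub> s) \<otimes>\<^bsub>T\<^esub> contractions \<phi>s (\<omega> \<otimes>\<^bsub>T\<^esub> tensor_scalar S V y \<otimes>\<^bsub>T\<^esub> \<epsilon>)"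
    proof -
      define z where "z = \<omega> \<otimes>\<^bsub>T\<^esub> tensor_scalar S V y"
      have "z \<in> carrier T" using \<omega>T x(3) by (simp add: z_def)
      then show ?thesis
        unfolding x(1) z_def[symmetric] using x(2,4)
        by (simp add: contractions_mult_scalar I.T.A_m_assoc flip: tensor_scalar_mult)
    qed
    also have "\<dots> \<in> corner_map S V ` contraction_span \<omega>' k"
      unfolding * using contractions_in_span[OF x(4) \<omega>'(1) x(2) t(1)] x(5) by simp
    finally show "\<epsilon> \<otimes>\<^bsub>T\<^esub> x \<otimes>\<^bsub>T\<^esub> \<epsilon> \<in> corner_map S V ` derivative_space S' Tr V' \<omega>' k"
      using span by blast
  qed (auto simp: I.T.A_l_distr I.T.A_r_distr)
  show ?thesis
  proof
    show "corner_map S V ` derivative_space S' Tr V' \<omega>' k \<subseteq> (\<lambda>w. \<epsilon> \<otimes>\<^bsub>T\<^esub> w \<otimes>\<^bsub>T\<^esub> \<epsilon>) ` derivative_space S Tr V \<omega> k"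
    proof (rule image_subsetI)
      fix w assume w: "w \<in> derivative_space S' Tr V' \<omega>' k"
      then have "w \<in> carrier T'" using subgroup.mem_carrier[OF sg'] by simp
      then have "corner_map S V w = \<epsilon> \<otimes>\<^bsub>T\<^esub> corner_map S V w \<otimes>\<^bsub>T\<^esub> \<epsilon>"
        by (simp add: I.iota_eps)
      then show "corner_map S V w \<in> (\<lambda>w. \<epsilon> \<otimes>\<^bsub>T\<^esub> w \<otimes>\<^bsub>T\<^esub> \<epsilon>) ` derivative_space S Tr V \<omega> k"
        using 1[OF w] by (rule image_eqI)
    qed
  qed (use 2 in blast)
qed

section \<open>Comparison of ideals and quotients, and the theorem\<close>

lemma corner_ideals:
  assumes M: "sub_bimodule S V M" and M': "M' \<subseteq> carrier T'"
    and image: "corner_map S V ` M' = (\<lambda>m. \<epsilon> \<otimes>\<^bsub>T\<^esub> m \<otimes>\<^bsub>T\<^esub> \<epsilon>) ` M"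
  shows "ideal (Idl\<^bsub>T\<^esub> M) T" "ideal (Idl\<^bsub>T'\<^esub> M') T'"
    "x \<in> carrier T' \<Longrightarrow> x \<in> Idl\<^bsub>T'\<^esub> M' \<longleftrightarrow> corner_map S V x \<in> Idl\<^bsub>T\<^esub> M"
proof -
  have MT: "M \<subseteq> carrier T"
    using M subgroup.subset unfolding sub_bimodule_def by fastforce
  show "ideal (Idl\<^bsub>T\<^esub> M) T"
    by (rule ring.genideal_ideal[OF I.T.ring_A MT])
  show "ideal (Idl\<^bsub>T'\<^esub> M') T'"
    by (rule ring.genideal_ideal[OF complex_alg.ring_A[OF T'_alg] M'])
  show "x \<in> carrier T' \<Longrightarrow> x \<in> Idl\<^bsub>T'\<^esub> M' \<longleftrightarrow> corner_map S V x \<in> Idl\<^bsub>T\<^esub> M"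
    by (rule I.ideal_correspondence[OF MT M' image _ _ scalar_full])
      (use M in \<open>simp_all add: sub_bimodule_def\<close>)
qed

lemma quotient_morita:
  assumes M: "sub_bimodule S V M" and M': "M' \<subseteq> carrier T'"
    and image: "corner_map S V ` M' = (\<lambda>m. \<epsilon> \<otimes>\<^bsub>T\<^esub> m \<otimes>\<^bsub>T\<^esub> \<epsilon>) ` M"
  shows "morita_equivalent TYPE('m) (quot_alg T (Idl\<^bsub>T\<^esub> M)) (quot_alg T' (Idl\<^bsub>T'\<^esub> M'))"
proof -
  note ids = corner_ideals[OF M M' image]
  let ?J = "Idl\<^bsub>T\<^esub> M"
  interpret J: alg_ideal T ?J
    using ids(1) T_alg by (simp add: alg_ideal_def)
  interpret J': alg_ideal T' "Idl\<^bsub>T'\<^esub> M'"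
    using ids(2) T'_alg by (simp add: alg_ideal_def)
  obtain h where h: "h \<in> alg_iso (quot_alg T' (Idl\<^bsub>T'\<^esub> M')) (corner (quot_alg T ?J) (?J +>\<^bsub>T\<^esub> \<epsilon>))"
    using I.quotient_corner_iso[OF ids] by blast
  \<comment> \<open>Fullness passes to the quotient: the quotient map is applied to the
    decomposition of 1 in \<open>T\<close>.\<close>
  have "finsum J.Q (\<lambda>i. (?J +>\<^bsub>T\<^esub> tensor_scalar S V (p i)) \<otimes>\<^bsub>J.Q\<^esub> (?J +>\<^bsub>T\<^esub> \<epsilon>) \<otimes>\<^bsub>J.Q\<^esub> (?J +>\<^bsub>T\<^esub> tensor_scalar S V (q i))) {..<n} =
      \<one>\<^bsub>J.Q\<^esub>"
  proof -
    have "?J +>\<^bsub>T\<^esub> finsum T (\<lambda>i. tensor_scalar S V (p i) \<otimes>\<^bsub>T\<^esub> \<epsilon> \<otimes>\<^bsub>T\<^esub> tensor_scalar S V (q i)) {..<n} =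
        finsum J.Q (\<lambda>i. ?J +>\<^bsub>T\<^esub> (tensor_scalar S V (p i) \<otimes>\<^bsub>T\<^esub> \<epsilon> \<otimes>\<^bsub>T\<^esub> tensor_scalar S V (q i))) {..<n}"
      by (intro finsum_additive I.T.abelian_group_A complex_alg.abelian_group_A[OF J.quot_complex_alg])
        (auto simp: J.quot_add)
    then show ?thesis
      by (simp add: J.quot_mult J.quot_one scalar_full)
  qed
  then have "full_idempotent J.Q J'.Q (?J +>\<^bsub>T\<^esub> \<epsilon>) h n (\<lambda>i. ?J +>\<^bsub>T\<^esub> tensor_scalar S V (p i)) (\<lambda>i. ?J +>\<^bsub>T\<^esub> tensor_scalar S V (q i))"
    using h J.quot_complex_alg J'.quot_complex_alg
    by (intro full_idempotent.intro corner_iso.intro corner_iso_axioms.intro full_idempotent_axioms.intro)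
      (simp_all add: J.quot_mult)
  then show ?thesis
    by (rule full_idempotent.morita)
qed

lemma identify:
  assumes "x \<in> carrier T"
  shows "corner_identify S V e (corner_elt S V e x) \<in> carrier T'"
    "corner_map S V (corner_identify S V e (corner_elt S V e x)) = \<epsilon> \<otimes>\<^bsub>T\<^esub> x \<otimes>\<^bsub>T\<^esub> \<epsilon>"
proof -
  have "corner_elt S V e x \<in> corner_map S V ` carrier T'"
    unfolding corner_elt_def using I.iota_surj[OF corner_mem[OF assms]] by blast
  then show "corner_identify S V e (corner_elt S V e x) \<in> carrier T'"
    "corner_map S V (corner_identify S V e (corner_elt S V e x)) = \<epsilon> \<otimes>\<^bsub>T\<^esub> x \<otimes>\<^bsub>T\<^esub> \<epsilon>"
    by (simp_all add: corner_identify_def corner_elt_def inv_into_into f_inv_into_f)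
qed

end

theorem lemma2p2:
  fixes S :: "(complex, 's) module"
    and V :: "('s, 'v) bimodule"
    and Tr :: "'s \<Rightarrow> complex"
    and e :: 's
  assumes "complex_alg S" and "finite_dim S" and "semisimple_ring S"
    and "nondegenerate_trace S Tr"
    and "complex_bimodule S V" and "finite_dim V"
    and "e \<in> carrier S" and "e \<otimes>\<^bsub>S\<^esub> e = e"
    and "two_sided_span S e = carrier S"
  shows "let T = tensor_alg S V; S' = corner S e; V' = corner_bimod V e; T' = tensor_alg S' V' in
    corner_map S V \<in> alg_iso T' (corner T (tensor_scalar S V e)) \<and>
    (\<forall>M. sub_bimodule S V M \<longrightarrow>
       morita_equivalent TYPE('m)
         (quot_alg T (Idl\<^bsub>T\<^esub> M))
         (quot_alg T' (Idl\<^bsub>T'\<^esub> (corner_identify S V e ` corner_elt S V e ` M)))) \<and>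
    (\<forall>\<tau> n k \<omega>.
       graded_trace_automorphism S Tr V \<tau> \<and>
       \<tau> (tensor_scalar S V e) = tensor_scalar S V e \<and>
       twisted_weak_potential S V \<tau> n \<omega> \<and> k \<le> n \<longrightarrow>
       (let \<omega>' = corner_identify S V e (corner_elt S V e \<omega>);
            I = derivation_ideal S Tr V \<omega> k;
            I' = derivation_ideal S' Tr V' \<omega>' k
        in \<exists>h \<in> alg_iso (derivation_quotient S' Tr V' \<omega>' k)
                 (corner (derivation_quotient S Tr V \<omega> k) (I +>\<^bsub>T\<^esub> tensor_scalar S V e)).
             \<forall>x\<in>carrier T'. h (I' +>\<^bsub>T'\<^esub> x) = I +>\<^bsub>T\<^esub> corner_map S V x))"
proof -
  \<comment> \<open>Membership of 1 in \<open>SeS\<close> supplies the elements \<open>p\<close> and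
    \<open>q\<close> that fix the interpretation below.\<close>
  have "\<one>\<^bsub>S\<^esub> \<in> two_sided_span S e"
    using complex_alg.A_one_closed[OF assms(1)] assms(9) by simp
  then obtain n :: nat and p q where pq: "\<forall>i. p i \<in> carrier S" "\<forall>i. q i \<in> carrier S"
    "finsum S (\<lambda>i. p i \<otimes>\<^bsub>S\<^esub> e \<otimes>\<^bsub>S\<^esub> q i) {..<n} = \<one>\<^bsub>S\<^esub>"
    using two_sided_span_sum[OF assms(1,7)] by blast
  interpret traced_full_corner S V e n p q Tr
  proof (intro traced_full_corner.intro full_corner.intro traced_bimodule.intro assms(5)
      full_corner_axioms.intro traced_bimodule_axioms.intro)
    show "\<exists>r\<in>carrier S. \<forall>s\<in>carrier S. Tr (r \<otimes>\<^bsub>S\<^esub> s) = f s" if "linear_form S f" for f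
      by (rule trace_representation[OF assms(1,2,4) that])
  qed (use pq assms in auto)
  have morita: "morita_equivalent TYPE('m) (quot_alg T (Idl\<^bsub>T\<^esub> M))
      (quot_alg T' (Idl\<^bsub>T'\<^esub> (corner_identify S V e ` corner_elt S V e ` M)))" if M: "sub_bimodule S V M" for M
  proof (rule quotient_morita[OF M])
    have MT: "m \<in> carrier T" if "m \<in> M" for m
      using M subgroup.mem_carrier[of M "add_monoid T" m] that by (simp add: sub_bimodule_def)
    then show "corner_identify S V e ` corner_elt S V e ` M \<subseteq> carrier T'"
      using identify(1) by auto
    show "corner_map S V ` corner_identify S V e ` corner_elt S V e ` M = (\<lambda>m. \<epsilon> \<otimes>\<^bsub>T\<^esub> m \<otimes>\<^bsub>T\<^esub> \<epsilon>) ` M"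
      unfolding image_image using MT identify(2) by (intro image_cong) auto
  qed
  have quotient: "\<exists>h\<in>alg_iso (derivation_quotient S' Tr V' \<omega>' k)
        (corner (derivation_quotient S Tr V \<omega> k) (derivation_ideal S Tr V \<omega> k +>\<^bsub>T\<^esub> \<epsilon>)).
      \<forall>x\<in>carrier T'. h (derivation_ideal S' Tr V' \<omega>' k +>\<^bsub>T'\<^esub> x) = derivation_ideal S Tr V \<omega> k +>\<^bsub>T\<^esub> corner_map S V x"
    if \<tau>: "graded_trace_automorphism S Tr V \<tau>" "\<tau> \<epsilon> = \<epsilon>" and \<omega>: "twisted_weak_potential S V \<tau> m \<omega>"
      and \<omega>'_def: "\<omega>' = corner_identify S V e (corner_elt S V e \<omega>)" for \<tau> m k \<omega> \<omega>'
  proof -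
    have \<omega>T: "\<omega> \<in> carrier T"
      using \<omega> by (auto simp: twisted_weak_potential_def tensor_power_def)
    note \<omega>' = identify[OF \<omega>T, folded \<omega>'_def]
    have sub: "derivative_space S' Tr V' \<omega>' k \<subseteq> carrier T'"
      using subgroup.subset[OF CT.derivative_space_subgroup[OF \<omega>'(1)]] by simp
    \<comment> \<open>The derivative space of \<open>\<omega>\<close> is a sub-bimodule, and by
      \<open>derivative_space_corner\<close> its compression is the derivative space over the
      corner; so the two derivation ideals correspond and the quotients can be compared.\<close>
    show ?thesis
      unfolding derivation_quotient_def derivation_ideal_def
      by (rule I.quotient_corner_iso[OF corner_ideals[OF derivative_space_sub_bimodule[OF \<omega>T] sub
            derivative_space_corner[OF \<tau> \<omega> \<omega>']]])
  qed
  show ?thesis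
    unfolding Let_def
    by (intro conjI allI impI; (elim conjE)?;
      (rule corner_map_iso | erule morita | (rule quotient; (assumption | rule refl))))
qed

end
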